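(* For all $n\ge1$ and $m\ge0$, the Spencer operator $\mathcal S^{n,m}_d\colon\Omega^m_dJ^n_d\to\Omega^{m+1}_dJ^{n-1}_d$ is a natural linear differential operator of order at most $1$. Moreover, it has (restriction) symbol $\wedge^{1,m}\otimes_A\pi^{n,n-1}_d$; that is, its natural lift $\widetilde{\mathcal S}^{n,m}_d\colon J^1_d\Omega^m_dJ^n_d\to\Omega^{m+1}_dJ^{n-1}_d$ satisfies, for every left $A$-module $E$, $$\widetilde{\mathcal S}^{n,m}_{d,E}\circ\iota^1_{d,\Omega^m_dJ^n_dE}=\wedge^{1,m}\otimes_A\pi^{n,n-1}_{d,E}\colon\Omega^1_d\otimes_A\Omega^m_d\otimes_AJ^n_dE\to\Omega^{m+1}_d\otimes_AJ^{n-1}_dE,$$ where $\wedge^{1,m}\colon\Omega^1_d\otimes_A\Omega^m_d\to\Omega^{m+1}_d$ is the product.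
   Context: **Setting.** $\Bbbk$ is a commutative unital ring, $A$ an associative unital $\Bbbk$-algebra, $\otimes=\otimes_\Bbbk$. $(\Omega^\bullet_d,\wedge,d)$ is an exterior algebra over $A$: a differential graded $\Bbbk$-algebra with $\Omega^0_d=A$, generated by $A$ and $dA$ (each $\Omega^k_d$ is spanned by elements $a_0da_1\wedge\dots\wedge da_k$), $d$ satisfying the graded Leibniz rule. $\Omega^k_d$ also denotes the functor $E\mapsto\Omega^k_dE=\Omega^k_d\otimes_AE$ on left $A$-modules. **1-jets.** $J^1_dE=(A\otimes E)/\{\sum_ia_i\otimes e_i:\sum_ia_ie_i=0,\ \sum_ida_i\otimes_Ae_i=0\}$, with $a[b\otimes e]=[ab\otimes e]$, functorial in $E$. Maps: $\pi^{1,0}_{d,E}([a\otimes e])=ae$, $j^1_{d,E}(e)=[1\otimes e]$ ($\Bbbk$-linear), $\iota^1_{d,E}\colon\Omega^1_dE\to J^1_dE$, $a\,db\otimes_Ae\mapsto[a\otimes be]-[ab\otimes e]$. **Holonomic jets.** Put $J^0_dE=E$, $l^1=\mathrm{id}$; for $n\ge2$, $l^n_{d,E}\colon J^n_dE\hookrightarrow J^1_dJ^{n-1}_dE$ is the inclusion of the left $A$-submodule of those $x$ such that $J^1_d(l^{n-1}_{d,E})(x)\in J^1_dJ^1_dJ^{n-2}_dE$ is annihilated by both maps $[a\otimes[c\otimes e]]\mapsto a\,dc\otimes_Ae\in\Omega^1_dJ^{n-2}_dE$ and $[a\otimes[c\otimes e]]\mapsto da\wedge dc\otimes_Ae\in\Omega^2_dJ^{n-2}_dE$.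 Jet projections: $\pi^{n,n-1}_{d,E}=\pi^{1,0}_{d,J^{n-1}_dE}\circ l^n_{d,E}$. **Spencer operators.** For $n\ge1$, $m\ge0$, $\mathcal S^{n,m}_{d,E}\colon\Omega^m_dJ^n_dE\to\Omega^{m+1}_dJ^{n-1}_dE$ is the $\Bbbk$-linear map $\omega\otimes_A\xi\mapsto\sum_jd(\omega y_j)\otimes_A\xi_j$, where $l^n_{d,E}(\xi)=\sum_j[y_j\otimes\xi_j]\in J^1_dJ^{n-1}_dE$ with $y_j\in A$, $\xi_j\in J^{n-1}_dE$. **Natural differential operators.** Let $F,G$ be functors from left $A$-modules to left $A$-modules. A natural transformation $\Delta\colon F\to G$ with $\Bbbk$-linear components (i.e. natural after composing with the forgetful functor to $\Bbbk$-modules) is a natural linear differential operator of order at most $n$ if there is a natural transformation $\widetilde\Delta\colon J^n_dF\to G$ with left $A$-linear components (a natural lift) such that $\widetilde\Delta\circ j^n_{d,F}=\Delta$. For $n=1$ the lift is unique; the restriction symbol of $\Delta$ is $\widetilde\Delta\circ\iota^1_{d,F}\colon\Omega^1_dF\to G$. *)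

theory Defs
  imports "HOL-Algebra.Algebra"
begin

section \<open>Left modules and algebras\<close>

text \<open>The locales \<open>module\<close> and \<open>algebra\<close> of HOL-Algebra assume commutativity (of the scalars,
  respectively of the algebra), hence the following two variants.  Left modules reuse the record
  type \<open>module\<close>; its fields \<open>mult\<close> and \<open>one\<close> play no role for them.\<close>

locale left_module = R?: ring R + M?: abelian_group M
  for R :: "('a, 'c) ring_scheme" (structure) and M :: "('a, 'b, 'd) module_scheme" (structure) +
  assumes smult_closed:
      "\<lbrakk> a \<in> carrier R; x \<in> carrier M \<rbrakk> \<Longrightarrow> a \<odot>\<^bsub>M\<^esub> x \<in> carrier M"
    and smult_l_distr:
      "\<lbrakk> a \<in> carrier R; b \<in> carrier R; x \<in> carrier M \<rbrakk> \<Longrightarrow>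
        (a \<oplus>\<^bsub>R\<^esub> b) \<odot>\<^bsub>M\<^esub> x = a \<odot>\<^bsub>M\<^esub> x \<oplus>\<^bsub>M\<^esub> b \<odot>\<^bsub>M\<^esub> x"
    and smult_r_distr:
      "\<lbrakk> a \<in> carrier R; x \<in> carrier M; y \<in> carrier M \<rbrakk> \<Longrightarrow>
        a \<odot>\<^bsub>M\<^esub> (x \<oplus>\<^bsub>M\<^esub> y) = a \<odot>\<^bsub>M\<^esub> x \<oplus>\<^bsub>M\<^esub> a \<odot>\<^bsub>M\<^esub> y"
    and smult_assoc:
      "\<lbrakk> a \<in> carrier R; b \<in> carrier R; x \<in> carrier M \<rbrakk> \<Longrightarrow>
        (a \<otimes>\<^bsub>R\<^esub> b) \<odot>\<^bsub>M\<^esub> x = a \<odot>\<^bsub>M\<^esub> (b \<odot>\<^bsub>M\<^esub> x)"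
    and smult_one: "x \<in> carrier M \<Longrightarrow> \<one>\<^bsub>R\<^esub> \<odot>\<^bsub>M\<^esub> x = x"

locale assoc_algebra = module K A + ring A
  for K :: "('k, 'c) ring_scheme" (structure) and A :: "('k, 'w, 'd) module_scheme" (structure) +
  assumes smult_mult_left:
      "\<lbrakk> c \<in> carrier K; x \<in> carrier A; y \<in> carrier A \<rbrakk> \<Longrightarrow>
        c \<odot>\<^bsub>A\<^esub> (x \<otimes>\<^bsub>A\<^esub> y) = (c \<odot>\<^bsub>A\<^esub> x) \<otimes>\<^bsub>A\<^esub> y"
    and smult_mult_right:
      "\<lbrakk> c \<in> carrier K; x \<in> carrier A; y \<in> carrier A \<rbrakk> \<Longrightarrow>
        c \<odot>\<^bsub>A\<^esub> (x \<otimes>\<^bsub>A\<^esub> y) = x \<otimes>\<^bsub>A\<^esub> (c \<odot>\<^bsub>A\<^esub> y)"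


section \<open>Exterior algebras\<close>

record ('k, 'w) dga = "('k, 'w) module" +
  grade :: "nat \<Rightarrow> 'w set"
  diff :: "'w \<Rightarrow> 'w"

locale dg_algebra = assoc_algebra K W
  for K :: "'k ring" (structure) and W :: "('k, 'w) dga" (structure) +
  assumes grade_submodule: "submodule (grade W p) K W"
    and grade_sum: "x \<in> carrier W \<Longrightarrow>
      \<exists>N f. (\<forall>i. f i \<in> grade W i) \<and> x = (\<Oplus>\<^bsub>W\<^esub>i\<in>{..N::nat}. f i)"
    and grade_direct: "\<lbrakk> \<And>i. f i \<in> grade W i; (\<Oplus>\<^bsub>W\<^esub>i\<in>{..N::nat}. f i) = \<zero>\<^bsub>W\<^esub>; j \<le> N \<rbrakk> \<Longrightarrow>
      f j = \<zero>\<^bsub>W\<^esub>"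
    and one_grade: "\<one>\<^bsub>W\<^esub> \<in> grade W 0"
    and mult_grade: "\<lbrakk> x \<in> grade W p; y \<in> grade W q \<rbrakk> \<Longrightarrow> x \<otimes>\<^bsub>W\<^esub> y \<in> grade W (p + q)"
    and diff_grade: "x \<in> grade W p \<Longrightarrow> diff W x \<in> grade W (Suc p)"
    and diff_add: "\<lbrakk> x \<in> carrier W; y \<in> carrier W \<rbrakk> \<Longrightarrow>
      diff W (x \<oplus>\<^bsub>W\<^esub> y) = diff W x \<oplus>\<^bsub>W\<^esub> diff W y"
    and diff_smult: "\<lbrakk> c \<in> carrier K; x \<in> carrier W \<rbrakk> \<Longrightarrow>
      diff W (c \<odot>\<^bsub>W\<^esub> x) = c \<odot>\<^bsub>W\<^esub> diff W x"
    and diff_diff: "x \<in> carrier W \<Longrightarrow> diff W (diff W x) = \<zero>\<^bsub>W\<^esub>"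
    and leibniz: "\<lbrakk> x \<in> grade W p; y \<in> carrier W \<rbrakk> \<Longrightarrow>
      diff W (x \<otimes>\<^bsub>W\<^esub> y)
        = diff W x \<otimes>\<^bsub>W\<^esub> y \<oplus>\<^bsub>W\<^esub> ((\<ominus>\<^bsub>W\<^esub> \<one>\<^bsub>W\<^esub>) [^]\<^bsub>W\<^esub> p) \<otimes>\<^bsub>W\<^esub> (x \<otimes>\<^bsub>W\<^esub> diff W y)"

text \<open>\<open>exterior_algebra K A W\<close>: the degree zero part of \<open>W\<close> is the algebra \<open>A\<close>, and every
  \<open>grade W p\<close> is additively spanned by the forms \<open>a\<^sub>0 da\<^sub>1 \<and> \<dots> \<and> da\<^sub>p\<close>.\<close>

locale exterior_algebra = dg_algebra K W
  for K :: "'k ring" (structure) and A :: "('k, 'w) module" (structure)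
    and W :: "('k, 'w) dga" (structure) +
  assumes A_carrier: "carrier A = grade W 0"
    and A_one: "\<one>\<^bsub>A\<^esub> = \<one>\<^bsub>W\<^esub>"
    and A_zero: "\<zero>\<^bsub>A\<^esub> = \<zero>\<^bsub>W\<^esub>"
    and A_add: "\<lbrakk> a \<in> carrier A; b \<in> carrier A \<rbrakk> \<Longrightarrow> a \<oplus>\<^bsub>A\<^esub> b = a \<oplus>\<^bsub>W\<^esub> b"
    and A_mult: "\<lbrakk> a \<in> carrier A; b \<in> carrier A \<rbrakk> \<Longrightarrow> a \<otimes>\<^bsub>A\<^esub> b = a \<otimes>\<^bsub>W\<^esub> b"
    and A_smult: "\<lbrakk> c \<in> carrier K; a \<in> carrier A \<rbrakk> \<Longrightarrow> c \<odot>\<^bsub>A\<^esub> a = c \<odot>\<^bsub>W\<^esub> a"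
    and spanned: "grade W p \<subseteq> generate (add_monoid W)
      {foldl (\<lambda>w a. w \<otimes>\<^bsub>W\<^esub> diff W a) a0 as | a0 as.
         a0 \<in> carrier A \<and> set as \<subseteq> carrier A \<and> length as = p}"


section \<open>A universe of modules closed under tensor products\<close>

text \<open>The type of \<open>J\<^sup>n E\<close> must not depend on \<open>n\<close>, and functors must be iterable.  All left
  \<open>A\<close>-modules are therefore taken with carriers in the type \<open>('w, 'e) univ\<close>, where \<open>'w\<close> is the
  type of forms and \<open>'e\<close> is an arbitrary type: every left \<open>A\<close>-module on \<open>'e\<close> has a copy in it
  along \<open>Atom\<close>.  The type is closed under formal sums \<open>\<Sum>\<^sub>i w\<^sub>i \<otimes> e\<^sub>i\<close>, so that an element of a tensor
  product can be represented by a chosen formal sum in its class.\<close>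

datatype ('w, 'e) univ = Atom 'e | Formal "('w \<times> ('w, 'e) univ) list"

primrec terms :: "('w, 'e) univ \<Rightarrow> ('w \<times> ('w, 'e) univ) list" where
  "terms (Atom e) = []"
| "terms (Formal p) = p"

type_synonym ('w, 'e) lmod = "('w, ('w, 'e) univ) module"

definition list_sum :: "('b, 'd) ring_scheme \<Rightarrow> 'b list \<Rightarrow> 'b" where
  "list_sum M xs = foldr (add M) xs \<zero>\<^bsub>M\<^esub>"

text \<open>The tensor product \<open>V \<otimes>\<^sub>S E\<close> of a right \<open>S\<close>-module \<open>V\<close> (action \<open>r\<close>) and a left \<open>S\<close>-module \<open>E\<close>
  (action \<open>l\<close>) is the free abelian group on \<open>V \<times> E\<close> modulo the subgroup \<open>tensor_relations\<close>.\<close>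

definition tensor_relations ::
    "'s set \<Rightarrow> ('w \<Rightarrow> 's \<Rightarrow> 'w) \<Rightarrow> ('s \<Rightarrow> 'u \<Rightarrow> 'u) \<Rightarrow> ('w, 'c) ring_scheme \<Rightarrow> ('u, 'd) ring_scheme
      \<Rightarrow> (('w \<times> 'u) \<Rightarrow>\<^sub>0 int) set" where
  "tensor_relations S r l V E = generate (free_Abelian_group (carrier V \<times> carrier E))
     ({frag_of (x \<oplus>\<^bsub>V\<^esub> y, e) - frag_of (x, e) - frag_of (y, e) | x y e.
         x \<in> carrier V \<and> y \<in> carrier V \<and> e \<in> carrier E}
    \<union> {frag_of (x, e \<oplus>\<^bsub>E\<^esub> e') - frag_of (x, e) - frag_of (x, e') | x e e'.
         x \<in> carrier V \<and> e \<in> carrier E \<and> e' \<in> carrier E}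
    \<union> {frag_of (r x s, e) - frag_of (x, l s e) | x s e.
         x \<in> carrier V \<and> s \<in> S \<and> e \<in> carrier E})"

text \<open>The class of the formal sum \<open>p\<close>, represented by a formal sum which depends only on the class.
  Thus \<open>t = tensor_class \<dots> (terms t)\<close> for every \<open>t\<close> in the tensor product.\<close>

definition tensor_class ::
    "'s set \<Rightarrow> ('w \<Rightarrow> 's \<Rightarrow> 'w) \<Rightarrow> ('s \<Rightarrow> ('w, 'e) univ \<Rightarrow> ('w, 'e) univ) \<Rightarrow> ('w, 'c) ring_scheme
      \<Rightarrow> ('w, 'e) lmod \<Rightarrow> ('w \<times> ('w, 'e) univ) list \<Rightarrow> ('w, 'e) univ" where
  "tensor_class S r l V E p = Formal (SOME q. set q \<subseteq> carrier V \<times> carrier E \<and>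
     sum_list (map frag_of q) - sum_list (map frag_of p) \<in> tensor_relations S r l V E)"

text \<open>\<open>V \<otimes>\<^sub>S E\<close> as a left module with \<open>a (x \<otimes> e) = m a x \<otimes> e\<close>.\<close>

definition tensor_module ::
    "'s set \<Rightarrow> ('w \<Rightarrow> 's \<Rightarrow> 'w) \<Rightarrow> ('s \<Rightarrow> ('w, 'e) univ \<Rightarrow> ('w, 'e) univ) \<Rightarrow> ('w \<Rightarrow> 'w \<Rightarrow> 'w)
      \<Rightarrow> ('w, 'c) ring_scheme \<Rightarrow> ('w, 'e) lmod \<Rightarrow> ('w, 'e) lmod" where
  "tensor_module S r l m V E =
    \<lparr> carrier = {tensor_class S r l V E p | p. set p \<subseteq> carrier V \<times> carrier E},
      monoid.mult = undefined, one = undefined,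
      ring.zero = tensor_class S r l V E [],
      ring.add = (\<lambda>t t'. tensor_class S r l V E (terms t @ terms t')),
      module.smult = (\<lambda>a t. tensor_class S r l V E (map (\<lambda>(x, e). (m a x, e)) (terms t))) \<rparr>"

text \<open>The value at \<open>t\<close> of the additive map into \<open>N\<close> with \<open>x \<otimes> e \<mapsto> f x e\<close>, computed on the formal sum
  representing \<open>t\<close>; meaningful when \<open>f\<close> respects the relations of the source.\<close>

definition tensor_ext ::
    "('b, 'd) ring_scheme \<Rightarrow> ('w \<Rightarrow> ('w, 'e) univ \<Rightarrow> 'b) \<Rightarrow> ('w, 'e) univ \<Rightarrow> 'b" where
  "tensor_ext N f t = list_sum N (map (\<lambda>(x, e). f x e) (terms t))"

text \<open>The quotient \<open>M/N\<close>, every coset being replaced by a chosen element of it, so that the carrier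
  type does not change.\<close>

definition coset_rep :: "('w, 'u) module \<Rightarrow> 'u set \<Rightarrow> 'u \<Rightarrow> 'u" where
  "coset_rep M N x = (SOME y. y \<in> N +>\<^bsub>M\<^esub> x)"

definition quotient_module :: "('w, 'u) module \<Rightarrow> 'u set \<Rightarrow> ('w, 'u) module" where
  "quotient_module M N =
    \<lparr> carrier = coset_rep M N ` carrier M,
      monoid.mult = undefined, one = undefined,
      ring.zero = coset_rep M N \<zero>\<^bsub>M\<^esub>,
      ring.add = (\<lambda>x y. coset_rep M N (x \<oplus>\<^bsub>M\<^esub> y)),
      module.smult = (\<lambda>a x. coset_rep M N (a \<odot>\<^bsub>M\<^esub> x)) \<rparr>"


section \<open>The functors of forms\<close>

definition forms_elem ::
    "('k, 'w) module \<Rightarrow> ('k, 'w) dga \<Rightarrow> nat \<Rightarrow> ('w, 'e) lmod \<Rightarrow> 'w \<Rightarrow> ('w, 'e) univ \<Rightarrow> ('w, 'e) univ" where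
  "forms_elem A W m E \<omega> e =
     tensor_class (carrier A) (monoid.mult W) (smult E) (W\<lparr>carrier := grade W m\<rparr>) E [(\<omega>, e)]"

definition forms :: "('k, 'w) module \<Rightarrow> ('k, 'w) dga \<Rightarrow> nat \<Rightarrow> ('w, 'e) lmod \<Rightarrow> ('w, 'e) lmod" where
  "forms A W m E =
     tensor_module (carrier A) (monoid.mult W) (smult E) (monoid.mult W) (W\<lparr>carrier := grade W m\<rparr>) E"

definition forms_map ::
    "('k, 'w) module \<Rightarrow> ('k, 'w) dga \<Rightarrow> nat \<Rightarrow> ('w, 'e) lmod
      \<Rightarrow> (('w, 'e) univ \<Rightarrow> ('w, 'e) univ) \<Rightarrow> ('w, 'e) univ \<Rightarrow> ('w, 'e) univ" where
  "forms_map A W m E' f = tensor_ext (forms A W m E') (\<lambda>\<omega> e. forms_elem A W m E' \<omega> (f e))"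


section \<open>1-jets\<close>

text \<open>The \<open>K\<close>-module structure underlying a left \<open>A\<close>-module.\<close>

definition base_smult :: "('k, 'w) module \<Rightarrow> ('w, 'u) module \<Rightarrow> 'k \<Rightarrow> 'u \<Rightarrow> 'u" where
  "base_smult A E c x = (c \<odot>\<^bsub>A\<^esub> \<one>\<^bsub>A\<^esub>) \<odot>\<^bsub>E\<^esub> x"

definition free_class ::
    "'k ring \<Rightarrow> ('k, 'w) module \<Rightarrow> ('w, 'e) lmod \<Rightarrow> ('w \<times> ('w, 'e) univ) list \<Rightarrow> ('w, 'e) univ" where
  "free_class K A E = tensor_class (carrier K) (\<lambda>x c. c \<odot>\<^bsub>A\<^esub> x) (base_smult A E) A E"

text \<open>\<open>A \<otimes>\<^sub>K E\<close>\<close>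

definition free_module :: "'k ring \<Rightarrow> ('k, 'w) module \<Rightarrow> ('w, 'e) lmod \<Rightarrow> ('w, 'e) lmod" where
  "free_module K A E =
     tensor_module (carrier K) (\<lambda>x c. c \<odot>\<^bsub>A\<^esub> x) (base_smult A E) (monoid.mult A) A E"

definition jet1_relations ::
    "'k ring \<Rightarrow> ('k, 'w) module \<Rightarrow> ('k, 'w) dga \<Rightarrow> ('w, 'e) lmod \<Rightarrow> ('w, 'e) univ set" where
  "jet1_relations K A W E =
    {free_class K A E p | p. set p \<subseteq> carrier A \<times> carrier E
       \<and> list_sum E (map (\<lambda>(a, e). a \<odot>\<^bsub>E\<^esub> e) p) = \<zero>\<^bsub>E\<^esub>
       \<and> list_sum (forms A W 1 E) (map (\<lambda>(a, e). forms_elem A W 1 E (diff W a) e) p)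
           = \<zero>\<^bsub>forms A W 1 E\<^esub>}"

definition jet1 ::
    "'k ring \<Rightarrow> ('k, 'w) module \<Rightarrow> ('k, 'w) dga \<Rightarrow> ('w, 'e) lmod \<Rightarrow> ('w, 'e) lmod" where
  "jet1 K A W E = quotient_module (free_module K A E) (jet1_relations K A W E)"

text \<open>\<open>[a \<otimes> e]\<close>.  As \<open>coset_rep\<close> picks elements of \<open>A \<otimes>\<^sub>K E\<close>, an element \<open>\<xi>\<close> of \<open>J\<^sup>1 E\<close> is again the
  sum of the \<open>[y\<^sub>j \<otimes> \<xi>\<^sub>j]\<close> with \<open>(y\<^sub>j, \<xi>\<^sub>j)\<close> running through \<open>terms \<xi>\<close>, and \<open>tensor_ext\<close> also describes
  maps out of \<open>J\<^sup>1 E\<close>.\<close>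

definition jet1_elem ::
    "'k ring \<Rightarrow> ('k, 'w) module \<Rightarrow> ('k, 'w) dga \<Rightarrow> ('w, 'e) lmod
      \<Rightarrow> 'w \<Rightarrow> ('w, 'e) univ \<Rightarrow> ('w, 'e) univ" where
  "jet1_elem K A W E a e =
     coset_rep (free_module K A E) (jet1_relations K A W E) (free_class K A E [(a, e)])"

definition jet1_map ::
    "'k ring \<Rightarrow> ('k, 'w) module \<Rightarrow> ('k, 'w) dga \<Rightarrow> ('w, 'e) lmod
      \<Rightarrow> (('w, 'e) univ \<Rightarrow> ('w, 'e) univ) \<Rightarrow> ('w, 'e) univ \<Rightarrow> ('w, 'e) univ" where
  "jet1_map K A W E' f = tensor_ext (jet1 K A W E') (\<lambda>a e. jet1_elem K A W E' a (f e))"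

definition jet1_proj :: "('w, 'e) lmod \<Rightarrow> ('w, 'e) univ \<Rightarrow> ('w, 'e) univ" where
  "jet1_proj E = tensor_ext E (\<lambda>a e. a \<odot>\<^bsub>E\<^esub> e)"

definition jet1_prolong ::
    "'k ring \<Rightarrow> ('k, 'w) module \<Rightarrow> ('k, 'w) dga \<Rightarrow> ('w, 'e) lmod \<Rightarrow> ('w, 'e) univ \<Rightarrow> ('w, 'e) univ" where
  "jet1_prolong K A W E e = jet1_elem K A W E \<one>\<^bsub>A\<^esub> e"

text \<open>\<open>\<iota>\<^sup>1\<close>; the 1-form \<open>\<alpha>\<close> is written as \<open>\<Sum>\<^sub>i a\<^sub>i db\<^sub>i\<close> in some way.\<close>

definition jet1_iota ::
    "'k ring \<Rightarrow> ('k, 'w) module \<Rightarrow> ('k, 'w) dga \<Rightarrow> ('w, 'e) lmod \<Rightarrow> ('w, 'e) univ \<Rightarrow> ('w, 'e) univ" where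
  "jet1_iota K A W E = tensor_ext (jet1 K A W E) (\<lambda>\<alpha> e.
     list_sum (jet1 K A W E)
       (map (\<lambda>(a, b). jet1_elem K A W E a (b \<odot>\<^bsub>E\<^esub> e) \<ominus>\<^bsub>jet1 K A W E\<^esub> jet1_elem K A W E (a \<otimes>\<^bsub>A\<^esub> b) e)
         (SOME p. set p \<subseteq> carrier A \<times> carrier A
            \<and> \<alpha> = list_sum W (map (\<lambda>(a, b). a \<otimes>\<^bsub>W\<^esub> diff W b) p))))"


section \<open>Holonomic jets\<close>

text \<open>The maps \<open>[a \<otimes> [c \<otimes> e]] \<mapsto> a dc \<otimes> e\<close> and \<open>[a \<otimes> [c \<otimes> e]] \<mapsto> da \<and> dc \<otimes> e\<close> on \<open>J\<^sup>1 J\<^sup>1 E\<close>.\<close>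

definition jet1_jet1_form1 ::
    "('k, 'w) module \<Rightarrow> ('k, 'w) dga \<Rightarrow> ('w, 'e) lmod \<Rightarrow> ('w, 'e) univ \<Rightarrow> ('w, 'e) univ" where
  "jet1_jet1_form1 A W E = tensor_ext (forms A W 1 E) (\<lambda>a.
     tensor_ext (forms A W 1 E) (\<lambda>c e. forms_elem A W 1 E (a \<otimes>\<^bsub>W\<^esub> diff W c) e))"

definition jet1_jet1_form2 ::
    "('k, 'w) module \<Rightarrow> ('k, 'w) dga \<Rightarrow> ('w, 'e) lmod \<Rightarrow> ('w, 'e) univ \<Rightarrow> ('w, 'e) univ" where
  "jet1_jet1_form2 A W E = tensor_ext (forms A W 2 E) (\<lambda>a.
     tensor_ext (forms A W 2 E) (\<lambda>c e. forms_elem A W 2 E (diff W a \<otimes>\<^bsub>W\<^esub> diff W c) e))"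

text \<open>For \<open>n \<ge> 1\<close> the carrier of \<open>J\<^sup>n E\<close> is literally a subset of that of \<open>J\<^sup>1 J\<^bsup>n-1\<^esup> E\<close>, so that \<open>l\<^sup>n\<close> is
  the map \<open>\<lambda>x. x\<close>.  Note that \<open>J\<^sup>1(l\<^sup>n)\<close> is not: it takes classes in a different tensor product.\<close>

fun jet :: "'k ring \<Rightarrow> ('k, 'w) module \<Rightarrow> ('k, 'w) dga \<Rightarrow> nat \<Rightarrow> ('w, 'e) lmod \<Rightarrow> ('w, 'e) lmod" where
  "jet K A W 0 E = E"
| "jet K A W (Suc 0) E = jet1 K A W E"
| "jet K A W (Suc (Suc n)) E = (jet1 K A W (jet K A W (Suc n) E))\<lparr>carrier :=
     {x \<in> carrier (jet1 K A W (jet K A W (Suc n) E)).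
        let y = jet1_map K A W (jet1 K A W (jet K A W n E)) (\<lambda>x. x) x in
          jet1_jet1_form1 A W (jet K A W n E) y = \<zero>\<^bsub>forms A W 1 (jet K A W n E)\<^esub>
        \<and> jet1_jet1_form2 A W (jet K A W n E) y = \<zero>\<^bsub>forms A W 2 (jet K A W n E)\<^esub>}\<rparr>"

primrec jet_map ::
    "'k ring \<Rightarrow> ('k, 'w) module \<Rightarrow> ('k, 'w) dga \<Rightarrow> nat \<Rightarrow> ('w, 'e) lmod
      \<Rightarrow> (('w, 'e) univ \<Rightarrow> ('w, 'e) univ) \<Rightarrow> ('w, 'e) univ \<Rightarrow> ('w, 'e) univ" where
  "jet_map K A W 0 E' f = f"
| "jet_map K A W (Suc n) E' f = jet1_map K A W (jet K A W n E') (jet_map K A W n E' f)"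

text \<open>\<open>j\<^sup>n\<close> is determined by \<open>l\<^bsup>n+1\<^esup> \<circ> j\<^bsup>n+1\<^esup> = j\<^sup>1 \<circ> j\<^sup>n\<close>.\<close>

primrec jet_prolong ::
    "'k ring \<Rightarrow> ('k, 'w) module \<Rightarrow> ('k, 'w) dga \<Rightarrow> nat \<Rightarrow> ('w, 'e) lmod
      \<Rightarrow> ('w, 'e) univ \<Rightarrow> ('w, 'e) univ" where
  "jet_prolong K A W 0 E e = e"
| "jet_prolong K A W (Suc n) E e = jet1_prolong K A W (jet K A W n E) (jet_prolong K A W n E e)"

text \<open>\<open>\<pi>\<^bsup>n,n-1\<^esup>\<close> for \<open>n \<ge> 1\<close>\<close>

definition jet_proj ::
    "'k ring \<Rightarrow> ('k, 'w) module \<Rightarrow> ('k, 'w) dga \<Rightarrow> nat \<Rightarrow> ('w, 'e) lmod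
      \<Rightarrow> ('w, 'e) univ \<Rightarrow> ('w, 'e) univ" where
  "jet_proj K A W n E = jet1_proj (jet K A W (n - 1) E)"


section \<open>Spencer operators\<close>

definition spencer ::
    "'k ring \<Rightarrow> ('k, 'w) module \<Rightarrow> ('k, 'w) dga \<Rightarrow> nat \<Rightarrow> nat \<Rightarrow> ('w, 'e) lmod
      \<Rightarrow> ('w, 'e) univ \<Rightarrow> ('w, 'e) univ" where
  "spencer K A W n m E =
    (let F = jet K A W (n - 1) E in
       tensor_ext (forms A W (m + 1) F) (\<lambda>\<omega>.
         tensor_ext (forms A W (m + 1) F) (\<lambda>y \<eta>. forms_elem A W (m + 1) F (diff W (\<omega> \<otimes>\<^bsub>W\<^esub> y)) \<eta>)))"

text \<open>\<open>\<and>\<^bsup>1,m\<^esup> \<otimes> \<pi>\<^bsup>n,n-1\<^esup>\<close>, i.e. \<open>\<alpha> \<otimes> (\<omega> \<otimes> \<xi>) \<mapsto> (\<alpha> \<and> \<omega>) \<otimes> \<pi>\<^bsup>n,n-1\<^esup> \<xi>\<close>.\<close>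

definition wedge_proj ::
    "'k ring \<Rightarrow> ('k, 'w) module \<Rightarrow> ('k, 'w) dga \<Rightarrow> nat \<Rightarrow> nat \<Rightarrow> ('w, 'e) lmod
      \<Rightarrow> ('w, 'e) univ \<Rightarrow> ('w, 'e) univ" where
  "wedge_proj K A W n m E =
    (let F = jet K A W (n - 1) E in
       tensor_ext (forms A W (m + 1) F) (\<lambda>\<alpha>.
         tensor_ext (forms A W (m + 1) F) (\<lambda>\<omega> \<xi>.
           forms_elem A W (m + 1) F (\<alpha> \<otimes>\<^bsub>W\<^esub> \<omega>) (jet_proj K A W n E \<xi>))))"


section \<open>Natural differential operators\<close>

text \<open>Morphisms of modules are functions up to agreement on the carrier of the source.\<close>

definition linear_maps :: "('k, 'w) module \<Rightarrow> ('w, 'u) module \<Rightarrow> ('w, 'u) module \<Rightarrow> ('u \<Rightarrow> 'u) set" where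
  "linear_maps A E E' = {f \<in> carrier E \<rightarrow> carrier E'.
     (\<forall>x\<in>carrier E. \<forall>y\<in>carrier E. f (x \<oplus>\<^bsub>E\<^esub> y) = f x \<oplus>\<^bsub>E'\<^esub> f y)
   \<and> (\<forall>a\<in>carrier A. \<forall>x\<in>carrier E. f (a \<odot>\<^bsub>E\<^esub> x) = a \<odot>\<^bsub>E'\<^esub> f x)}"

definition base_linear_maps ::
    "'k ring \<Rightarrow> ('k, 'w) module \<Rightarrow> ('w, 'u) module \<Rightarrow> ('w, 'u) module \<Rightarrow> ('u \<Rightarrow> 'u) set" where
  "base_linear_maps K A E E' = {f \<in> carrier E \<rightarrow> carrier E'.
     (\<forall>x\<in>carrier E. \<forall>y\<in>carrier E. f (x \<oplus>\<^bsub>E\<^esub> y) = f x \<oplus>\<^bsub>E'\<^esub> f y)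
   \<and> (\<forall>c\<in>carrier K. \<forall>x\<in>carrier E. f (base_smult A E c x) = base_smult A E' c (f x))}"

record ('w, 'u) mod_functor =
  obj :: "('w, 'u) module \<Rightarrow> ('w, 'u) module"
  mor :: "('w, 'u) module \<Rightarrow> ('w, 'u) module \<Rightarrow> ('u \<Rightarrow> 'u) \<Rightarrow> 'u \<Rightarrow> 'u"

locale module_functor =
  fixes A :: "('k, 'w) module" and F :: "('w, 'u) mod_functor"
  assumes obj_module: "left_module A E \<Longrightarrow> left_module A (obj F E)"
    and mor_linear: "\<lbrakk> left_module A E; left_module A E'; f \<in> linear_maps A E E' \<rbrakk> \<Longrightarrow>
      mor F E E' f \<in> linear_maps A (obj F E) (obj F E')"
    and mor_cong: "\<lbrakk> left_module A E; left_module A E'; f \<in> linear_maps A E E'; g \<in> linear_maps A E E';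
        \<And>x. x \<in> carrier E \<Longrightarrow> f x = g x; x \<in> carrier (obj F E) \<rbrakk> \<Longrightarrow> mor F E E' f x = mor F E E' g x"
    and mor_id: "\<lbrakk> left_module A E; x \<in> carrier (obj F E) \<rbrakk> \<Longrightarrow> mor F E E (\<lambda>x. x) x = x"
    and mor_comp: "\<lbrakk> left_module A E; left_module A E'; left_module A E'';
        f \<in> linear_maps A E E'; g \<in> linear_maps A E' E''; x \<in> carrier (obj F E) \<rbrakk> \<Longrightarrow>
      mor F E E'' (g \<circ> f) x = mor F E' E'' g (mor F E E' f x)"

definition functor_comp ::
    "('w, 'u) mod_functor \<Rightarrow> ('w, 'u) mod_functor \<Rightarrow> ('w, 'u) mod_functor" (infixr \<open>\<circ>\<^sub>F\<close> 55) where
  "F \<circ>\<^sub>F G = \<lparr> obj = (\<lambda>E. obj F (obj G E)),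
              mor = (\<lambda>E E' f. mor F (obj G E) (obj G E') (mor G E E' f)) \<rparr>"

definition forms_functor ::
    "('k, 'w) module \<Rightarrow> ('k, 'w) dga \<Rightarrow> nat \<Rightarrow> ('w, ('w, 'e) univ) mod_functor" where
  "forms_functor A W m = \<lparr> obj = forms A W m, mor = (\<lambda>E E' f. forms_map A W m E' f) \<rparr>"

definition jet_functor ::
    "'k ring \<Rightarrow> ('k, 'w) module \<Rightarrow> ('k, 'w) dga \<Rightarrow> nat \<Rightarrow> ('w, ('w, 'e) univ) mod_functor" where
  "jet_functor K A W n = \<lparr> obj = jet K A W n, mor = (\<lambda>E E' f. jet_map K A W n E' f) \<rparr>"

text \<open>Naturality is that of maps of sets; linearity of the components is imposed separately.\<close>

definition natural ::
    "('k, 'w) module \<Rightarrow> ('w, 'u) mod_functor \<Rightarrow> ('w, 'u) mod_functor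
      \<Rightarrow> (('w, 'u) module \<Rightarrow> 'u \<Rightarrow> 'u) \<Rightarrow> bool" where
  "natural A F G \<Delta> \<longleftrightarrow>
     (\<forall>E. left_module A E \<longrightarrow> \<Delta> E \<in> carrier (obj F E) \<rightarrow> carrier (obj G E))
   \<and> (\<forall>E E' f x. left_module A E \<longrightarrow> left_module A E' \<longrightarrow> f \<in> linear_maps A E E'
        \<longrightarrow> x \<in> carrier (obj F E) \<longrightarrow> \<Delta> E' (mor F E E' f x) = mor G E E' f (\<Delta> E x))"

definition natural_lift ::
    "'k ring \<Rightarrow> ('k, 'w) module \<Rightarrow> ('k, 'w) dga \<Rightarrow> nat
      \<Rightarrow> ('w, ('w, 'e) univ) mod_functor \<Rightarrow> ('w, ('w, 'e) univ) mod_functor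
      \<Rightarrow> (('w, 'e) lmod \<Rightarrow> ('w, 'e) univ \<Rightarrow> ('w, 'e) univ)
      \<Rightarrow> (('w, 'e) lmod \<Rightarrow> ('w, 'e) univ \<Rightarrow> ('w, 'e) univ) \<Rightarrow> bool" where
  "natural_lift K A W n F G \<Delta> L \<longleftrightarrow>
     natural A (jet_functor K A W n \<circ>\<^sub>F F) G L
   \<and> (\<forall>E. left_module A E \<longrightarrow> L E \<in> linear_maps A (jet K A W n (obj F E)) (obj G E))
   \<and> (\<forall>E. left_module A E \<longrightarrow>
        (\<forall>x\<in>carrier (obj F E). L E (jet_prolong K A W n (obj F E) x) = \<Delta> E x))"

definition natural_diff_op ::
    "'k ring \<Rightarrow> ('k, 'w) module \<Rightarrow> ('k, 'w) dga \<Rightarrow> nat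
      \<Rightarrow> ('w, ('w, 'e) univ) mod_functor \<Rightarrow> ('w, ('w, 'e) univ) mod_functor
      \<Rightarrow> (('w, 'e) lmod \<Rightarrow> ('w, 'e) univ \<Rightarrow> ('w, 'e) univ) \<Rightarrow> bool" where
  "natural_diff_op K A W n F G \<Delta> \<longleftrightarrow>
     module_functor A F \<and> module_functor A G
   \<and> natural A F G \<Delta>
   \<and> (\<forall>E. left_module A E \<longrightarrow> \<Delta> E \<in> base_linear_maps K A (obj F E) (obj G E))
   \<and> (\<exists>L. natural_lift K A W n F G \<Delta> L)"

end

theory Submission
  imports Defs
begin

text \<open>An element \<open>\<xi>\<close> of \<open>J\<^sup>1 E\<close> is determined by the pair of \<open>\<pi> \<xi>\<close> and \<open>D \<xi>\<close>, where \<open>\<pi> [a \<otimes> e] = a e\<close> and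
  \<open>D [a \<otimes> e] = da \<otimes> e\<close>; here \<open>\<pi>\<close> is linear and \<open>D (a \<xi>) = da \<otimes> \<pi> \<xi> + a D \<xi>\<close>.  By the Leibniz rule,
  \<open>S (\<omega> \<otimes> \<xi>) = d\<omega> \<otimes> \<pi> \<xi> + (-1)\<^sup>m \<omega> \<and> D \<xi>\<close>, which is balanced over \<open>A\<close> and satisfies
  \<open>S (a t) = da \<and> \<pi> t + a S t\<close>.  On \<open>J\<^sup>1 \<Omega>\<^sup>m J\<^sup>n E\<close> the linear lift is therefore \<open>S (\<pi> z) - (\<and> \<otimes> \<pi>) (D z)\<close>.
  Conversely a linear lift \<open>L\<close> sends \<open>[a \<otimes> t]\<close> to \<open>a S t\<close>, hence \<open>\<iota> (a db \<otimes> t)\<close> to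
  \<open>a (S (b t) - b S t) = a db \<and> \<pi> t\<close>.  The two holonomy conditions on \<open>y \<in> J\<^sup>1 J\<^sup>1 E\<close> read
  \<open>D (\<pi> y) = \<Omega>\<^sup>1(\<pi>) (D y)\<close> and \<open>S (D y) = 0\<close>; the second is linear only modulo the first.\<close>

section \<open>Additive maps and tensor products\<close>

text \<open>Every value of \<open>tensor_ext\<close> is computed on a formal sum picked by choice,
  so each formula needs a reason not to depend on the pick. On a tensor product the reason is the
  universal property \<open>cls_universal\<close>. On J1, whose relations are a common kernel rather
  than a list of generators, it is that the formula has the form g(\<pi> \<xi>) + h(D \<xi>) with g
  and h additive. Without flatness, J1 of the inclusion l^n need not be injective, so J^n E need not
  embed in an iterated J1. The results on Spencer operators are therefore stated for a module P with
  a linear inclusion into J1 F, and an induction over consecutive pairs J^(n+1) E, J^n E supplies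
  such P and F. The minus sign in the lift comes from D (\<iota> (a db \<otimes> t)) = da \<otimes>
  b t - d(a b) \<otimes> t = - a db \<otimes> t.\<close>

definition additive_maps :: "('a, 'c) ring_scheme \<Rightarrow> ('b, 'd) ring_scheme \<Rightarrow> ('a \<Rightarrow> 'b) set" where
  "additive_maps M N = {f \<in> carrier M \<rightarrow> carrier N.
     \<forall>x\<in>carrier M. \<forall>y\<in>carrier M. f (x \<oplus>\<^bsub>M\<^esub> y) = f x \<oplus>\<^bsub>N\<^esub> f y}"

lemma additive_mapsI:
  assumes "\<And>x. x \<in> carrier M \<Longrightarrow> f x \<in> carrier N"
    and "\<And>x y. \<lbrakk> x \<in> carrier M; y \<in> carrier M \<rbrakk> \<Longrightarrow> f (x \<oplus>\<^bsub>M\<^esub> y) = f x \<oplus>\<^bsub>N\<^esub> f y"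
  shows "f \<in> additive_maps M N"
  using assms by (auto simp: additive_maps_def)

lemma additive_closed: "f \<in> additive_maps M N \<Longrightarrow> x \<in> carrier M \<Longrightarrow> f x \<in> carrier N"
  by (auto simp: additive_maps_def)

lemma additive_add:
  "f \<in> additive_maps M N \<Longrightarrow> x \<in> carrier M \<Longrightarrow> y \<in> carrier M \<Longrightarrow> f (x \<oplus>\<^bsub>M\<^esub> y) = f x \<oplus>\<^bsub>N\<^esub> f y"
  by (auto simp: additive_maps_def)

lemma additive_zero:
  assumes "abelian_group M" "abelian_group N" "f \<in> additive_maps M N"
  shows "f \<zero>\<^bsub>M\<^esub> = \<zero>\<^bsub>N\<^esub>"
proof -
  interpret M: abelian_group M by fact
  interpret N: abelian_group N by fact
  have "f \<zero>\<^bsub>M\<^esub> \<oplus>\<^bsub>N\<^esub> f \<zero>\<^bsub>M\<^esub> = f \<zero>\<^bsub>M\<^esub>"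
    using additive_add[OF assms(3) M.zero_closed M.zero_closed] by simp
  then show ?thesis
    using additive_closed[OF assms(3) M.zero_closed] N.add.l_cancel_one by fastforce
qed

lemma additive_a_inv:
  assumes "abelian_group M" "abelian_group N" "f \<in> additive_maps M N" "x \<in> carrier M"
  shows "f (\<ominus>\<^bsub>M\<^esub> x) = \<ominus>\<^bsub>N\<^esub> f x"
proof -
  interpret M: abelian_group M by fact
  interpret N: abelian_group N by fact
  have "f (\<ominus>\<^bsub>M\<^esub> x) \<oplus>\<^bsub>N\<^esub> f x = \<zero>\<^bsub>N\<^esub>"
    using additive_add[OF assms(3), of "\<ominus>\<^bsub>M\<^esub> x" x] additive_zero[OF assms(1-3)] assms(4)
    by (simp add: M.l_neg)
  then show ?thesis
    using additive_closed[OF assms(3)] assms(4) by (metis M.a_inv_closed N.minus_equality)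
qed

lemma additive_minus:
  assumes "abelian_group M" "abelian_group N" "f \<in> additive_maps M N"
    "x \<in> carrier M" "y \<in> carrier M"
  shows "f (x \<ominus>\<^bsub>M\<^esub> y) = f x \<ominus>\<^bsub>N\<^esub> f y"
  using assms by (simp add: a_minus_def additive_add[OF assms(3)] additive_a_inv[OF assms(1-3)]
      abelian_group.a_inv_closed[OF assms(1)])

lemma additive_comp:
  "f \<in> additive_maps M N \<Longrightarrow> g \<in> additive_maps N P \<Longrightarrow> (\<lambda>x. g (f x)) \<in> additive_maps M P"
  by (auto simp: additive_maps_def Pi_def)

lemma additive_id: "(\<lambda>x. x) \<in> additive_maps M M"
  by (auto simp: additive_maps_def)

lemma additive_zero_map: "abelian_group N \<Longrightarrow> (\<lambda>x. \<zero>\<^bsub>N\<^esub>) \<in> additive_maps M N"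
  by (auto simp: additive_maps_def abelian_group.axioms abelian_monoid.zero_closed abelian_monoid.l_zero)

lemma additive_plus:
  assumes "abelian_group N" "f \<in> additive_maps M N" "g \<in> additive_maps M N"
  shows "(\<lambda>x. f x \<oplus>\<^bsub>N\<^esub> g x) \<in> additive_maps M N"
proof -
  interpret N: abelian_group N by fact
  show ?thesis
    using additive_closed[OF assms(2)] additive_closed[OF assms(3)]
    by (intro additive_mapsI)
      (auto simp: additive_add[OF assms(2)] additive_add[OF assms(3)] N.add.m_ac)
qed

lemma additive_uminus:
  assumes "abelian_group N" "f \<in> additive_maps M N"
  shows "(\<lambda>x. \<ominus>\<^bsub>N\<^esub> f x) \<in> additive_maps M N"
proof -
  interpret N: abelian_group N by fact
  show ?thesis
    using additive_closed[OF assms(2)]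
    by (intro additive_mapsI) (auto simp: additive_add[OF assms(2)] N.minus_add)
qed

lemma additive_diff:
  assumes "abelian_group N" "f \<in> additive_maps M N" "g \<in> additive_maps M N"
  shows "(\<lambda>x. f x \<ominus>\<^bsub>N\<^esub> g x) \<in> additive_maps M N"
  unfolding a_minus_def by (intro additive_plus additive_uminus assms)

section \<open>Finite sums indexed by lists\<close>

lemma list_sum_Nil [simp]: "list_sum M [] = \<zero>\<^bsub>M\<^esub>"
  and list_sum_Cons [simp]: "list_sum M (x # xs) = x \<oplus>\<^bsub>M\<^esub> list_sum M xs"
  by (simp_all add: list_sum_def)

lemma list_sum_closed:
  assumes "abelian_group M" "set xs \<subseteq> carrier M"
  shows "list_sum M xs \<in> carrier M"
proof -
  interpret M: abelian_group M by fact
  show ?thesis using assms(2) by (induction xs) auto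
qed

lemma list_sum_append:
  assumes "abelian_group M" "set xs \<subseteq> carrier M" "set ys \<subseteq> carrier M"
  shows "list_sum M (xs @ ys) = list_sum M xs \<oplus>\<^bsub>M\<^esub> list_sum M ys"
proof -
  interpret M: abelian_group M by fact
  show ?thesis using assms(2,3)
    by (induction xs) (auto simp: list_sum_closed[OF assms(1)] M.a_assoc)
qed

lemma additive_list_sum:
  assumes "abelian_group M" "abelian_group N" "f \<in> additive_maps M N" "set xs \<subseteq> carrier M"
  shows "f (list_sum M xs) = list_sum N (map f xs)"
  using assms(4)
  by (induction xs)
    (auto simp: additive_zero[OF assms(1-3)] additive_add[OF assms(3)] list_sum_closed[OF assms(1)])

lemma additive_list_sum_map:
  assumes "abelian_group M" "abelian_group N" "f \<in> additive_maps M N"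
    "\<And>z. z \<in> set zs \<Longrightarrow> g z \<in> carrier M"
  shows "f (list_sum M (map g zs)) = list_sum N (map (\<lambda>z. f (g z)) zs)"
  using additive_list_sum[OF assms(1-3), of "map g zs"] assms(4) by (auto simp: o_def)

lemma list_sum_add:
  assumes "abelian_group M" "\<And>z. z \<in> set zs \<Longrightarrow> f z \<in> carrier M" "\<And>z. z \<in> set zs \<Longrightarrow> g z \<in> carrier M"
  shows "list_sum M (map (\<lambda>z. f z \<oplus>\<^bsub>M\<^esub> g z) zs) = list_sum M (map f zs) \<oplus>\<^bsub>M\<^esub> list_sum M (map g zs)"
proof -
  interpret M: abelian_group M by fact
  have "set (map f zs) \<subseteq> carrier M" "set (map g zs) \<subseteq> carrier M" using assms(2,3) by auto
  then show ?thesis using assms(2,3)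
    by (induction zs) (auto simp: M.add.m_ac list_sum_closed[OF assms(1)])
qed

section \<open>Tensor products by generators and relations\<close>

lemma keys_diff_frag:
  assumes "x \<in> B" "y \<in> B"
  shows "Poly_Mapping.keys (frag_of x - frag_of y) \<subseteq> B"
  using assms Poly_Mapping.keys_diff[of "frag_of x" "frag_of y"] by (auto simp: keys_frag_of)

lemma keys_diff_frag3:
  assumes "x \<in> B" "y \<in> B" "z \<in> B"
  shows "Poly_Mapping.keys (frag_of x - frag_of y - frag_of z) \<subseteq> B"
  using assms(3) keys_diff_frag[OF assms(1,2)]
    Poly_Mapping.keys_diff[of "frag_of x - frag_of y" "frag_of z"]
  by (auto simp: keys_frag_of)

text \<open>One locale serves both tensor products of the development: \<open>A\<close> over
  \<open>K\<close> with E, and the forms of a fixed degree over \<open>A\<close> with E. The scalars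
  are therefore just a set \<open>S\<close> with a right action \<open>r\<close> on V and a left
  action \<open>l\<close> on E.\<close>

locale tensor_data =
  fixes S :: "'s set" and r :: "'w \<Rightarrow> 's \<Rightarrow> 'w" and l :: "'s \<Rightarrow> ('w, 'e) univ \<Rightarrow> ('w, 'e) univ"
    and V :: "('w, 'c) ring_scheme" and E :: "('w, 'e) lmod"
  assumes V: "abelian_group V" and E: "abelian_group E"
    and r_closed: "\<lbrakk> x \<in> carrier V; s \<in> S \<rbrakk> \<Longrightarrow> r x s \<in> carrier V"
    and l_closed: "\<lbrakk> s \<in> S; e \<in> carrier E \<rbrakk> \<Longrightarrow> l s e \<in> carrier E"
begin

sublocale V: abelian_group V by (fact V)
sublocale E: abelian_group E by (fact E)

abbreviation "G \<equiv> free_Abelian_group (carrier V \<times> carrier E)"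
abbreviation "rel \<equiv> tensor_relations S r l V E"
abbreviation "cls \<equiv> tensor_class S r l V E"
abbreviation "tens x e \<equiv> cls [(x, e)]"
abbreviation frag_sum :: "('w \<times> ('w, 'e) univ) list \<Rightarrow> ('w \<times> ('w, 'e) univ) \<Rightarrow>\<^sub>0 int" where
  "frag_sum p \<equiv> sum_list (map frag_of p)"
abbreviation "ok p \<equiv> set p \<subseteq> carrier V \<times> carrier E"

definition balanced :: "('b, 'd) ring_scheme \<Rightarrow> ('w \<Rightarrow> ('w, 'e) univ \<Rightarrow> 'b) \<Rightarrow> bool" where
  "balanced N f \<longleftrightarrow>
     (\<forall>x\<in>carrier V. (\<lambda>e. f x e) \<in> additive_maps E N)
   \<and> (\<forall>e\<in>carrier E. (\<lambda>x. f x e) \<in> additive_maps V N)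
   \<and> (\<forall>x\<in>carrier V. \<forall>s\<in>S. \<forall>e\<in>carrier E. f (r x s) e = f x (l s e))"

lemma balanced_closed: "balanced N f \<Longrightarrow> x \<in> carrier V \<Longrightarrow> e \<in> carrier E \<Longrightarrow> f x e \<in> carrier N"
  unfolding balanced_def using additive_closed by metis

lemma frag_sum_carrier: "ok p \<Longrightarrow> frag_sum p \<in> carrier G"
proof (induction p)
  case (Cons a p)
  then show ?case using keys_add[of "frag_of a" "frag_sum p"] by (auto simp: keys_frag_of)
qed simp

lemma rel_subgroup: "subgroup rel G"
  unfolding tensor_relations_def
proof (intro group.generate_is_subgroup group_free_Abelian_group Un_least subsetI;
    elim CollectE exE conjE; hypsubst)
qed (unfold carrier_free_Abelian_group_iff,
    (intro keys_diff_frag3 keys_diff_frag; simp add: r_closed l_closed)+)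

lemma rel_zero: "0 \<in> rel"
  using subgroup.one_closed[OF rel_subgroup] by simp

lemma rel_add: "a \<in> rel \<Longrightarrow> b \<in> rel \<Longrightarrow> a + b \<in> rel"
  using subgroup.m_closed[OF rel_subgroup] by simp

lemma rel_uminus: "a \<in> rel \<Longrightarrow> - a \<in> rel"
  using subgroup.m_inv_closed[OF rel_subgroup, of a] subgroup.mem_carrier[OF rel_subgroup, of a]
  by simp

lemma rel_generators:
  "\<lbrakk> x \<in> carrier V; y \<in> carrier V; e \<in> carrier E \<rbrakk> \<Longrightarrow>
     frag_of (x \<oplus>\<^bsub>V\<^esub> y, e) - frag_of (x, e) - frag_of (y, e) \<in> rel"
  "\<lbrakk> x \<in> carrier V; e \<in> carrier E; e' \<in> carrier E \<rbrakk> \<Longrightarrow>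
     frag_of (x, e \<oplus>\<^bsub>E\<^esub> e') - frag_of (x, e) - frag_of (x, e') \<in> rel"
  "\<lbrakk> x \<in> carrier V; s \<in> S; e \<in> carrier E \<rbrakk> \<Longrightarrow> frag_of (r x s, e) - frag_of (x, l s e) \<in> rel"
  unfolding tensor_relations_def by (rule generate.incl, blast)+

text \<open>The formal sum \<open>p\<close> itself satisfies the predicate under \<open>SOME\<close>
  in \<open>tensor_class\<close>, so the chosen formal sum is a representative of the class of
  \<open>p\<close>.\<close>

lemma terms_cls:
  assumes "ok p"
  shows "ok (terms (cls p))" and "frag_sum (terms (cls p)) - frag_sum p \<in> rel"
proof -
  have "ok (terms (cls p)) \<and> frag_sum (terms (cls p)) - frag_sum p \<in> rel"
    unfolding tensor_class_def terms.simps
    by (rule someI[where x = p]) (simp add: assms rel_zero)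
  then show "ok (terms (cls p))" and "frag_sum (terms (cls p)) - frag_sum p \<in> rel" by auto
qed

text \<open>The predicate under \<open>SOME\<close> depends on \<open>p\<close> only modulo
  \<open>rel\<close>. Congruent formal sums thus select the very same representative, and equality
  of classes becomes equality of values.\<close>

lemma cls_eqI:
  assumes "frag_sum p - frag_sum q \<in> rel"
  shows "cls p = cls q"
proof -
  have *: "t - b \<in> rel" if "t - a \<in> rel" "a - b \<in> rel" for t a b
    using rel_add[OF that] by simp
  have "frag_sum q - frag_sum p \<in> rel" using rel_uminus[OF assms] by simp
  then have "frag_sum t - frag_sum p \<in> rel \<longleftrightarrow> frag_sum t - frag_sum q \<in> rel" for t
    using * assms by blast
  then show ?thesis by (simp add: tensor_class_def)
qed

lemma cls_eqD:
  assumes "cls p = cls q" "ok p" "ok q"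
  shows "frag_sum p - frag_sum q \<in> rel"
  using rel_add[OF terms_cls(2)[OF assms(3)] rel_uminus[OF terms_cls(2)[OF assms(2)]]] assms(1)
  by simp

lemma cls_terms_cls: "ok p \<Longrightarrow> cls (terms (cls p)) = cls p"
  by (intro cls_eqI terms_cls)

text \<open>The homomorphism of the free abelian group that extends f kills the relations, so
  summing f over a formal sum gives a value that depends on the class alone. This is what permits
  evaluation on chosen representatives.\<close>

lemma cls_universal:
  assumes N: "abelian_group N" and f: "balanced N f" and p: "ok p" "ok q" and eq: "cls p = cls q"
  shows "list_sum N (map (\<lambda>(x, e). f x e) p) = list_sum N (map (\<lambda>(x, e). f x e) q)"
proof -
  interpret N: abelian_group N by fact
  interpret G: comm_group G by (rule abelian_free_Abelian_group)
  have "(\<lambda>(x, e). f x e) ` (carrier V \<times> carrier E) \<subseteq> carrier (add_monoid N)"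
    using balanced_closed[OF f] by auto
  from comm_group.free_Abelian_group_universal[OF N.a_comm_group this] obtain h
    where h: "h \<in> hom G (add_monoid N)"
      and h_frag: "\<And>z. z \<in> carrier V \<times> carrier E \<Longrightarrow> h (frag_of z) = (\<lambda>(x, e). f x e) z" by metis
  interpret h: group_hom G "add_monoid N" h
    using h N.a_group by (simp add: group_hom_def group_hom_axioms_def)
  have hz: "h 0 = \<zero>\<^bsub>N\<^esub>" using h.hom_one by simp
  have h_add: "h (a + b) = h a \<oplus>\<^bsub>N\<^esub> h b" if "a \<in> carrier G" "b \<in> carrier G" for a b
    using h.hom_mult[OF that] by simp
  have h_closed: "h a \<in> carrier N" if "a \<in> carrier G" for a using h.hom_closed[OF that] by simp
  have h_diff: "h (a - b) = \<zero>\<^bsub>N\<^esub> \<longleftrightarrow> h a = h b"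
    if "a \<in> carrier G" "b \<in> carrier G" for a b
  proof -
    have ab: "a - b \<in> carrier G" using that keys_diff[of a b] by auto
    have "h a = h (a - b) \<oplus>\<^bsub>N\<^esub> h b" using h_add[OF ab that(2)] by simp
    then show ?thesis using h_closed that ab by (metis N.add.r_cancel_one' N.l_zero)
  qed
  have h_sum: "h (frag_sum p) = list_sum N (map (\<lambda>(x, e). f x e) p)" if "ok p" for p
    using that
  proof (induction p)
    case (Cons z p)
    then have "frag_of z \<in> carrier G" "frag_sum p \<in> carrier G"
      using frag_sum_carrier[of p] by (auto simp: keys_frag_of)
    then show ?case using Cons h_frag[of z] by (simp add: h_add)
  qed (simp add: hz)
  have h_frag': "h (frag_of (x, e)) = f x e" if "x \<in> carrier V" "e \<in> carrier E" for x e
    using h_frag[of "(x, e)"] that by simp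
  have c1: "frag_of (x, e) \<in> carrier G" if "x \<in> carrier V" "e \<in> carrier E" for x e
    using that by (auto simp: keys_frag_of)
  have c2: "frag_of (x, e) + frag_of (y, e') \<in> carrier G"
    if "x \<in> carrier V" "y \<in> carrier V" "e \<in> carrier E" "e' \<in> carrier E" for x y e e'
    using G.m_closed[OF c1[OF that(1,3)] c1[OF that(2,4)]] by simp
  have three: "h (frag_of (x, e) - frag_of (y, e') - frag_of (z, e'')) = \<zero>\<^bsub>N\<^esub>"
    if "f x e = f y e' \<oplus>\<^bsub>N\<^esub> f z e''" "x \<in> carrier V" "y \<in> carrier V" "z \<in> carrier V"
      "e \<in> carrier E" "e' \<in> carrier E" "e'' \<in> carrier E" for x y z e e' e''
    using h_diff[OF c1 c2, of x e y z e' e''] h_add[OF c1 c1, of y e' z e''] that h_frag'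
    by (simp add: diff_diff_eq)
  have ker: "a \<in> kernel G (add_monoid N) h"
    if "Poly_Mapping.keys a \<subseteq> carrier V \<times> carrier E" "h a = \<zero>\<^bsub>N\<^esub>" for a
    using that by (simp add: kernel_def)
  \<comment> \<open>The kernel is a subgroup, so it is enough to place the three families of
    generators in it; each family corresponds to one clause of \<open>balanced\<close>.\<close>
  have "rel \<subseteq> kernel G (add_monoid N) h"
    unfolding tensor_relations_def
  proof (intro G.generate_subgroup_incl h.subgroup_kernel Un_least subsetI)
    fix a assume "a \<in> {frag_of (x \<oplus>\<^bsub>V\<^esub> y, e) - frag_of (x, e) - frag_of (y, e) | x y e.
         x \<in> carrier V \<and> y \<in> carrier V \<and> e \<in> carrier E}"
    then obtain x y e where *: "a = frag_of (x \<oplus>\<^bsub>V\<^esub> y, e) - frag_of (x, e) - frag_of (y, e)"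
        "x \<in> carrier V" "y \<in> carrier V" "e \<in> carrier E" by blast
    then have "f (x \<oplus>\<^bsub>V\<^esub> y) e = f x e \<oplus>\<^bsub>N\<^esub> f y e"
      using f additive_add[of "\<lambda>x. f x e" V N x y] by (auto simp: balanced_def)
    then show "a \<in> kernel G (add_monoid N) h"
      unfolding *(1) using *(2-4) by (intro ker three keys_diff_frag3) simp_all
  next
    fix a assume "a \<in> {frag_of (x, e \<oplus>\<^bsub>E\<^esub> e') - frag_of (x, e) - frag_of (x, e') | x e e'.
         x \<in> carrier V \<and> e \<in> carrier E \<and> e' \<in> carrier E}"
    then obtain x e e' where *: "a = frag_of (x, e \<oplus>\<^bsub>E\<^esub> e') - frag_of (x, e) - frag_of (x, e')"
        "x \<in> carrier V" "e \<in> carrier E" "e' \<in> carrier E" by blast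
    then have "f x (e \<oplus>\<^bsub>E\<^esub> e') = f x e \<oplus>\<^bsub>N\<^esub> f x e'"
      using f additive_add[of "\<lambda>e. f x e" E N e e'] by (auto simp: balanced_def)
    then show "a \<in> kernel G (add_monoid N) h"
      unfolding *(1) using *(2-4) by (intro ker three keys_diff_frag3) simp_all
  next
    fix a assume "a \<in> {frag_of (r x s, e) - frag_of (x, l s e) | x s e.
         x \<in> carrier V \<and> s \<in> S \<and> e \<in> carrier E}"
    then obtain x s e where *: "a = frag_of (r x s, e) - frag_of (x, l s e)"
        "x \<in> carrier V" "s \<in> S" "e \<in> carrier E" by blast
    then have "f (r x s) e = f x (l s e)" using f by (auto simp: balanced_def)
    then show "a \<in> kernel G (add_monoid N) h"
      unfolding *(1) using *(2-4) h_diff[OF c1 c1, of "r x s" e x "l s e"]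
      by (intro ker keys_diff_frag) (simp_all add: h_frag' r_closed l_closed)
  qed
  then have "h (frag_sum p - frag_sum q) = \<zero>\<^bsub>N\<^esub>"
    using cls_eqD[OF eq p] by (auto simp: kernel_def)
  then show ?thesis
    using h_diff[OF frag_sum_carrier frag_sum_carrier, OF p] h_sum p by simp
qed

lemma carrier_TM: "carrier (tensor_module S r l m V E) = {cls p | p. ok p}"
  and zero_TM: "\<zero>\<^bsub>tensor_module S r l m V E\<^esub> = cls []"
  and add_TM: "t \<oplus>\<^bsub>tensor_module S r l m V E\<^esub> t' = cls (terms t @ terms t')"
  and smult_TM: "a \<odot>\<^bsub>tensor_module S r l m V E\<^esub> t = cls (map (\<lambda>(x, e). (m a x, e)) (terms t))"
  by (simp_all add: tensor_module_def)

lemma cls_closed: "ok p \<Longrightarrow> cls p \<in> carrier (tensor_module S r l m V E)"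
  by (auto simp: carrier_TM)

lemma tens_closed:
  "x \<in> carrier V \<Longrightarrow> e \<in> carrier E \<Longrightarrow> tens x e \<in> carrier (tensor_module S r l m V E)"
  by (rule cls_closed) simp

lemma terms_ok: "t \<in> carrier (tensor_module S r l m V E) \<Longrightarrow> ok (terms t)"
  unfolding carrier_TM using terms_cls(1) by blast

lemma add_cls:
  assumes "ok p" "ok q"
  shows "cls p \<oplus>\<^bsub>tensor_module S r l m V E\<^esub> cls q = cls (p @ q)"
  unfolding add_TM
  using rel_add[OF terms_cls(2)[OF assms(1)] terms_cls(2)[OF assms(2)]]
  by (intro cls_eqI) (simp add: add_diff_add)

lemma cls_commute: "cls (p @ q) = cls (q @ p)"
  by (rule cls_eqI) (simp add: add.commute rel_zero)

text \<open>The relation coming from 0 + 0 = 0 in V is minus the generator (0, e).\<close>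

lemma frag_zero_rel:
  assumes e: "e \<in> carrier E"
  shows "frag_of (\<zero>\<^bsub>V\<^esub>, e) \<in> rel"
  using rel_uminus[OF rel_generators(1)[OF V.zero_closed V.zero_closed e]] by simp

lemma frag_uminus_rel:
  assumes "x \<in> carrier V" "e \<in> carrier E"
  shows "frag_of (\<ominus>\<^bsub>V\<^esub> x, e) + frag_of (x, e) \<in> rel"
  using rel_add[OF frag_zero_rel[OF assms(2)]
      rel_uminus[OF rel_generators(1)[OF V.a_inv_closed[OF assms(1)] assms]]] assms
  by (simp add: V.l_neg add.commute)

lemma cls_uminus: "ok p \<Longrightarrow> cls (map (\<lambda>(x, e). (\<ominus>\<^bsub>V\<^esub> x, e)) p @ p) = cls []"
proof (rule cls_eqI, induction p)
  case (Cons z p)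
  then have "(frag_of (\<ominus>\<^bsub>V\<^esub> fst z, snd z) + frag_of (fst z, snd z))
      + (frag_sum (map (\<lambda>(x, e). (\<ominus>\<^bsub>V\<^esub> x, e)) p @ p) - frag_sum []) \<in> rel"
    by (intro rel_add frag_uminus_rel) auto
  then show ?case by (simp add: split_def o_def add.assoc add.left_commute)
qed (simp add: rel_zero)

text \<open>Addition of classes is concatenation of formal sums, and the negative of a class is
  obtained by negating the left factors.\<close>

lemma abelian_group_TM: "abelian_group (tensor_module S r l m V E)"
proof (rule abelian_groupI)
  show "t \<oplus>\<^bsub>tensor_module S r l m V E\<^esub> t' \<in> carrier (tensor_module S r l m V E)"
    if "t \<in> carrier (tensor_module S r l m V E)" "t' \<in> carrier (tensor_module S r l m V E)" for t t'
    unfolding add_TM using terms_ok[OF that(1)] terms_ok[OF that(2)] by (intro cls_closed) simp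
  show "\<exists>y\<in>carrier (tensor_module S r l m V E).
      y \<oplus>\<^bsub>tensor_module S r l m V E\<^esub> t = \<zero>\<^bsub>tensor_module S r l m V E\<^esub>"
    if "t \<in> carrier (tensor_module S r l m V E)" for t
  proof -
    obtain p where p: "t = cls p" "ok p" using \<open>t \<in> _\<close> by (auto simp: carrier_TM)
    have q: "ok (map (\<lambda>(x, e). (\<ominus>\<^bsub>V\<^esub> x, e)) p)" using p(2) by auto
    show ?thesis
      by (rule bexI[OF _ cls_closed[OF q]])
        (simp add: p(1) add_cls[OF q p(2)] zero_TM cls_uminus[OF p(2)])
  qed
qed (auto simp: carrier_TM zero_TM add_cls intro: cls_commute)

lemma cls_sum:
  "ok p \<Longrightarrow> cls p = list_sum (tensor_module S r l m V E) (map (\<lambda>(x, e). tens x e) p)"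
proof (induction p)
  case (Cons z p)
  have "(\<lambda>(x, e). tens x e) = (\<lambda>z. cls [z])" by auto
  with Cons add_cls[of "[z]" p] show ?case by simp
qed (simp add: zero_TM)

lemma TM_induct [consumes 1, case_names zero tens add]:
  assumes t: "t \<in> carrier (tensor_module S r l m V E)"
    and zero: "P \<zero>\<^bsub>tensor_module S r l m V E\<^esub>"
    and tens: "\<And>x e. \<lbrakk> x \<in> carrier V; e \<in> carrier E \<rbrakk> \<Longrightarrow> P (tens x e)"
    and add: "\<And>s t. \<lbrakk> s \<in> carrier (tensor_module S r l m V E); t \<in> carrier (tensor_module S r l m V E);
        P s; P t \<rbrakk> \<Longrightarrow> P (s \<oplus>\<^bsub>tensor_module S r l m V E\<^esub> t)"
  shows "P t"
proof -
  have "P (cls p)" if "ok p" for p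
    using that
  proof (induction p)
    case (Cons z p)
    then show ?case
      using add[of "cls [z]" "cls p"] add_cls[of "[z]" p m] tens[of "fst z" "snd z"]
        cls_closed[of "[z]"] cls_closed[of p] by auto
  qed (use zero zero_TM in simp)
  then show ?thesis using t by (auto simp: carrier_TM)
qed

text \<open>Elementary tensors generate. Identities between maps out of a tensor product are reduced
  to elementary tensors with this.\<close>

lemma additive_eqI:
  assumes "abelian_group N" "f \<in> additive_maps (tensor_module S r l m V E) N"
    "g \<in> additive_maps (tensor_module S r l m V E) N"
    "\<And>x e. \<lbrakk> x \<in> carrier V; e \<in> carrier E \<rbrakk> \<Longrightarrow> f (tens x e) = g (tens x e)"
    "t \<in> carrier (tensor_module S r l m V E)"
  shows "f t = g t"
  using assms(5)
proof (induction rule: TM_induct)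
  case zero
  show ?case
    using additive_zero[OF abelian_group_TM assms(1,2)] additive_zero[OF abelian_group_TM assms(1,3)]
    by simp
qed (simp_all add: assms(4) additive_add[OF assms(2)] additive_add[OF assms(3)])

text \<open>\<open>terms (cls p)\<close> and \<open>p\<close> have the same class, so
  \<open>cls_universal\<close> lets the extension be computed on any formal sum in the class instead
  of the chosen one.\<close>

lemma ext_cls:
  assumes "abelian_group N" "balanced N f" "ok p"
  shows "tensor_ext N f (cls p) = list_sum N (map (\<lambda>(x, e). f x e) p)"
  unfolding tensor_ext_def
  by (rule cls_universal[OF assms(1,2) terms_cls(1) assms(3) cls_terms_cls]) (rule assms(3))+

lemma ext_tens:
  assumes "abelian_group N" "balanced N f" "x \<in> carrier V" "e \<in> carrier E"
  shows "tensor_ext N f (tens x e) = f x e"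
proof -
  interpret N: abelian_group N by fact
  show ?thesis
    using ext_cls[OF assms(1,2), of "[(x, e)]"] balanced_closed[OF assms(2-4)] assms(3,4) by simp
qed

lemma ext_additive:
  assumes N: "abelian_group N" and f: "balanced N f"
  shows "tensor_ext N f \<in> additive_maps (tensor_module S r l m V E) N"
proof -
  have c: "set (map (\<lambda>(x, e). f x e) p) \<subseteq> carrier N" if "ok p" for p
    using that balanced_closed[OF f] by auto
  show ?thesis
    by (rule additive_mapsI)
      (auto simp: carrier_TM add_cls ext_cls[OF assms] list_sum_append[OF N c c, simplified]
        simp del: set_map intro!: list_sum_closed[OF N c])
qed

text \<open>Each clause is one family of generators of \<open>rel\<close>, read as an identity in
  the quotient.\<close>

lemma tens_balanced: "balanced (tensor_module S r l m V E) (\<lambda>x e. tens x e)"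
proof -
  have "tens (x \<oplus>\<^bsub>V\<^esub> y) e = cls [(x, e), (y, e)]" if "x \<in> carrier V" "y \<in> carrier V" "e \<in> carrier E" for x y e
    using rel_generators(1)[OF that] by (intro cls_eqI) (simp add: diff_diff_eq)
  moreover have "tens x (e \<oplus>\<^bsub>E\<^esub> e') = cls [(x, e), (x, e')]"
    if "x \<in> carrier V" "e \<in> carrier E" "e' \<in> carrier E" for x e e'
    using rel_generators(2)[OF that] by (intro cls_eqI) (simp add: diff_diff_eq)
  moreover have "tens (r x s) e = tens x (l s e)" if "x \<in> carrier V" "s \<in> S" "e \<in> carrier E" for x s e
    using rel_generators(3)[OF that] by (intro cls_eqI) simp
  ultimately show ?thesis
    by (simp add: balanced_def additive_maps_def Pi_def tens_closed add_cls)
qed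

end

text \<open>A left action \<open>m\<close> of R on V that commutes with the right action
  \<open>r\<close>, as on a bimodule. This is what lets R act on the tensor product through its
  first factor.\<close>

locale tensor_action = tensor_data S r l V E + R: ring R
  for S :: "'s set" and r :: "'w \<Rightarrow> 's \<Rightarrow> 'w" and l :: "'s \<Rightarrow> ('w, 'e) univ \<Rightarrow> ('w, 'e) univ"
    and V :: "('w, 'c) ring_scheme" and E :: "('w, 'e) lmod" and R :: "('w, 'd) ring_scheme" +
  fixes m :: "'w \<Rightarrow> 'w \<Rightarrow> 'w"
  assumes m_additive: "a \<in> carrier R \<Longrightarrow> m a \<in> additive_maps V V"
    and m_r: "\<lbrakk> a \<in> carrier R; x \<in> carrier V; s \<in> S \<rbrakk> \<Longrightarrow> m a (r x s) = r (m a x) s"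
    and m_add: "\<lbrakk> a \<in> carrier R; b \<in> carrier R; x \<in> carrier V \<rbrakk> \<Longrightarrow>
      m (a \<oplus>\<^bsub>R\<^esub> b) x = m a x \<oplus>\<^bsub>V\<^esub> m b x"
    and m_mult: "\<lbrakk> a \<in> carrier R; b \<in> carrier R; x \<in> carrier V \<rbrakk> \<Longrightarrow> m (a \<otimes>\<^bsub>R\<^esub> b) x = m a (m b x)"
    and m_one: "x \<in> carrier V \<Longrightarrow> m \<one>\<^bsub>R\<^esub> x = x"
begin

abbreviation "T \<equiv> tensor_module S r l m V E"

lemma m_closed: "a \<in> carrier R \<Longrightarrow> x \<in> carrier V \<Longrightarrow> m a x \<in> carrier V"
  using additive_closed[OF m_additive] .

lemma m_balanced:
  assumes a: "a \<in> carrier R"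
  shows "balanced T (\<lambda>x e. tens (m a x) e)"
proof -
  have *: "(\<lambda>e. tens x e) \<in> additive_maps E T" if "x \<in> carrier V" for x
    using tens_balanced that by (auto simp: balanced_def)
  have **: "(\<lambda>x. tens x e) \<in> additive_maps V T" if "e \<in> carrier E" for e
    using tens_balanced that by (auto simp: balanced_def)
  have "tens (r x s) e = tens x (l s e)" if "x \<in> carrier V" "s \<in> S" "e \<in> carrier E" for x s e
    using tens_balanced that by (auto simp: balanced_def)
  then show ?thesis
    unfolding balanced_def using additive_comp[OF m_additive[OF a] **] *
    by (auto simp: m_closed[OF a] m_r[OF a])
qed

text \<open>Scalar multiplication in \<open>tensor_module\<close> acts on the chosen formal sum.
  Recognising it as the extension of a balanced map makes it additive and independent of the
  representative.\<close>

lemma smult_ext: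
  assumes "a \<in> carrier R" "t \<in> carrier T"
  shows "a \<odot>\<^bsub>T\<^esub> t = tensor_ext T (\<lambda>x e. tens (m a x) e) t"
proof -
  have "ok (map (\<lambda>(x, e). (m a x, e)) (terms t))"
    using terms_ok[OF assms(2)] m_closed[OF assms(1)] by auto
  from cls_sum[OF this, of m] show ?thesis
    by (simp add: smult_TM tensor_ext_def o_def split_def)
qed

lemma smult_additive:
  assumes a: "a \<in> carrier R"
  shows "(\<lambda>t. a \<odot>\<^bsub>T\<^esub> t) \<in> additive_maps T T"
proof -
  interpret T: abelian_group T by (rule abelian_group_TM)
  note * = ext_additive[OF abelian_group_TM m_balanced[OF a], of m]
  show ?thesis
    by (rule additive_mapsI) (simp_all add: smult_ext[OF a] additive_closed[OF *] additive_add[OF *])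
qed

lemma smult_tens:
  assumes "a \<in> carrier R" "x \<in> carrier V" "e \<in> carrier E"
  shows "a \<odot>\<^bsub>T\<^esub> tens x e = tens (m a x) e"
  using smult_ext[OF assms(1) tens_closed[OF assms(2,3)]]
    ext_tens[OF abelian_group_TM m_balanced[OF assms(1)] assms(2,3)] by simp

text \<open>Distributivity over sums of tensors is \<open>smult_additive\<close>. In the other
  equations both sides are additive in t, so elementary tensors suffice, and there the laws assumed
  for \<open>m\<close> apply.\<close>

lemma left_module_T: "left_module R T"
proof -
  interpret T: abelian_group T by (rule abelian_group_TM)
  note eqI = additive_eqI[OF abelian_group_TM]
  show ?thesis
  proof (intro left_module.intro left_module_axioms.intro)
    show "ring R" "abelian_group T" by unfold_locales
    fix a b t assume a: "a \<in> carrier R" and b: "b \<in> carrier R" and t: "t \<in> carrier T"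
    show "a \<odot>\<^bsub>T\<^esub> t \<in> carrier T" using additive_closed[OF smult_additive[OF a] t] .
    have "tens (m a x \<oplus>\<^bsub>V\<^esub> m b x) e = tens (m a x) e \<oplus>\<^bsub>T\<^esub> tens (m b x) e"
      if "x \<in> carrier V" "e \<in> carrier E" for x e
      using tens_balanced[of m] that m_closed a b additive_add[of "\<lambda>x. tens x e" V T "m a x" "m b x"]
      unfolding balanced_def by blast
    then show "(a \<oplus>\<^bsub>R\<^esub> b) \<odot>\<^bsub>T\<^esub> t = a \<odot>\<^bsub>T\<^esub> t \<oplus>\<^bsub>T\<^esub> b \<odot>\<^bsub>T\<^esub> t"
      using a b
      by (intro eqI[OF smult_additive additive_plus[OF abelian_group_TM] _ t] smult_additive)
        (simp_all add: smult_tens m_add)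
    show "(a \<otimes>\<^bsub>R\<^esub> b) \<odot>\<^bsub>T\<^esub> t = a \<odot>\<^bsub>T\<^esub> (b \<odot>\<^bsub>T\<^esub> t)"
      using a b
      by (intro eqI[OF smult_additive additive_comp[OF smult_additive smult_additive] _ t])
        (simp_all add: smult_tens m_mult m_closed)
  next
    fix a t t' assume "a \<in> carrier R" "t \<in> carrier T" "t' \<in> carrier T"
    then show "a \<odot>\<^bsub>T\<^esub> (t \<oplus>\<^bsub>T\<^esub> t') = a \<odot>\<^bsub>T\<^esub> t \<oplus>\<^bsub>T\<^esub> a \<odot>\<^bsub>T\<^esub> t'"
      using additive_add[OF smult_additive] by blast
  next
    fix t assume t: "t \<in> carrier T"
    show "\<one>\<^bsub>R\<^esub> \<odot>\<^bsub>T\<^esub> t = t"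
      by (intro eqI[OF smult_additive additive_id _ t]) (simp_all add: smult_tens m_one)
  qed
qed

end

section \<open>Forms with values in a module\<close>

lemma linear_mapsI:
  assumes "f \<in> additive_maps E E'"
    and "\<And>a x. \<lbrakk> a \<in> carrier A; x \<in> carrier E \<rbrakk> \<Longrightarrow> f (a \<odot>\<^bsub>E\<^esub> x) = a \<odot>\<^bsub>E'\<^esub> f x"
  shows "f \<in> linear_maps A E E'"
  using assms by (auto simp: linear_maps_def additive_maps_def)

lemma linear_additive: "f \<in> linear_maps A E E' \<Longrightarrow> f \<in> additive_maps E E'"
  by (auto simp: linear_maps_def additive_maps_def)

lemma linear_smult:
  "f \<in> linear_maps A E E' \<Longrightarrow> a \<in> carrier A \<Longrightarrow> x \<in> carrier E \<Longrightarrow> f (a \<odot>\<^bsub>E\<^esub> x) = a \<odot>\<^bsub>E'\<^esub> f x"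
  by (auto simp: linear_maps_def)

lemma linear_closed: "f \<in> linear_maps A E E' \<Longrightarrow> x \<in> carrier E \<Longrightarrow> f x \<in> carrier E'"
  by (auto simp: linear_maps_def)

lemma linear_comp: "f \<in> linear_maps A E E' \<Longrightarrow> g \<in> linear_maps A E' E'' \<Longrightarrow> (\<lambda>x. g (f x)) \<in> linear_maps A E E''"
  by (auto simp: linear_maps_def Pi_def)

lemma linear_id: "(\<lambda>x. x) \<in> linear_maps A E E"
  by (auto simp: linear_maps_def)

locale calculus = exterior_algebra K A W + A: assoc_algebra K A
  for K :: "'k ring" and A :: "('k, 'w) module" and W :: "('k, 'w) dga"
begin

abbreviation "homogeneous p \<equiv> W\<lparr>carrier := grade W p\<rparr>"
abbreviation "Om \<equiv> forms A W"
abbreviation "felem \<equiv> forms_elem A W"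

lemma module_abelian: "left_module A E \<Longrightarrow> abelian_group E"
  by (simp add: left_module_def)

lemma grade_carrier: "x \<in> grade W p \<Longrightarrow> x \<in> carrier W"
  using subgroup.mem_carrier[OF submodule.axioms(1)[OF grade_submodule[of p]]] by simp

lemma grade_add: "x \<in> grade W p \<Longrightarrow> y \<in> grade W p \<Longrightarrow> x \<oplus>\<^bsub>W\<^esub> y \<in> grade W p"
  using subgroup.m_closed[OF submodule.axioms(1)[OF grade_submodule[of p]]] by simp

lemma grade_uminus: "x \<in> grade W p \<Longrightarrow> \<ominus>\<^bsub>W\<^esub> x \<in> grade W p"
  using subgroup.m_inv_closed[OF submodule.axioms(1)[OF grade_submodule[of p]]]
  by (simp add: a_inv_def)

lemma grade_zero: "\<zero>\<^bsub>W\<^esub> \<in> grade W p"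
  using subgroup.one_closed[OF submodule.axioms(1)[OF grade_submodule[of p]]] by simp

lemma grade_mult: "x \<in> grade W p \<Longrightarrow> y \<in> grade W q \<Longrightarrow> p + q = s \<Longrightarrow> x \<otimes>\<^bsub>W\<^esub> y \<in> grade W s"
  using mult_grade by blast

lemma A_grade: "a \<in> carrier A \<Longrightarrow> a \<in> grade W 0"
  by (simp add: A_carrier)

lemma A_in_W: "a \<in> carrier A \<Longrightarrow> a \<in> carrier W"
  using A_grade grade_carrier by blast

lemma diff_A: "a \<in> carrier A \<Longrightarrow> diff W a \<in> grade W 1"
  using diff_grade[of a 0] A_grade by simp

lemma abelian_homogeneous: "abelian_group (homogeneous p)"
proof (rule abelian_groupI)
  show "\<exists>y\<in>carrier (homogeneous p). y \<oplus>\<^bsub>homogeneous p\<^esub> x = \<zero>\<^bsub>homogeneous p\<^esub>"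
    if "x \<in> carrier (homogeneous p)" for x
    using that grade_uminus grade_carrier by (intro bexI[of _ "\<ominus>\<^bsub>W\<^esub> x"]) (auto simp: l_neg)
qed (auto simp: grade_add grade_zero grade_carrier a_assoc intro: a_comm)

lemma forms_tensor:
  fixes E :: "('w, 'e) lmod"
  assumes E: "left_module A E"
  shows "tensor_action (carrier A) (monoid.mult W) (smult E) (homogeneous p) E A (monoid.mult W)"
proof -
  interpret E: left_module A E by fact
  show ?thesis
  proof (intro tensor_action.intro tensor_data.intro tensor_action_axioms.intro)
    show "abelian_group (homogeneous p)" by (rule abelian_homogeneous)
    show "abelian_group E" "ring A" by unfold_locales
  qed (auto simp: additive_maps_def A_in_W grade_carrier r_distr l_distr m_assoc A_add A_mult A_one
      E.smult_closed intro: grade_mult dest: A_grade)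
qed

text \<open>The predicate \<open>balanced\<close> of \<open>tensor_data\<close> for forms with
  values in E, restated outside that locale so that it remains available where no tensor product is
  interpreted.\<close>

definition forms_balanced ::
    "nat \<Rightarrow> ('w, 'e) lmod \<Rightarrow> ('b, 'd) ring_scheme \<Rightarrow> ('w \<Rightarrow> ('w, 'e) univ \<Rightarrow> 'b) \<Rightarrow> bool" where
  "forms_balanced p E N f \<longleftrightarrow>
     (\<forall>\<omega>\<in>grade W p. (\<lambda>e. f \<omega> e) \<in> additive_maps E N)
   \<and> (\<forall>e\<in>carrier E. (\<lambda>\<omega>. f \<omega> e) \<in> additive_maps (homogeneous p) N)
   \<and> (\<forall>\<omega>\<in>grade W p. \<forall>a\<in>carrier A. \<forall>e\<in>carrier E. f (\<omega> \<otimes>\<^bsub>W\<^esub> a) e = f \<omega> (a \<odot>\<^bsub>E\<^esub> e))"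

lemma forms_balancedI:
  assumes "\<And>\<omega> e. \<lbrakk> \<omega> \<in> grade W p; e \<in> carrier E \<rbrakk> \<Longrightarrow> f \<omega> e \<in> carrier N"
    and "\<And>\<omega> e e'. \<lbrakk> \<omega> \<in> grade W p; e \<in> carrier E; e' \<in> carrier E \<rbrakk> \<Longrightarrow>
      f \<omega> (e \<oplus>\<^bsub>E\<^esub> e') = f \<omega> e \<oplus>\<^bsub>N\<^esub> f \<omega> e'"
    and "\<And>\<omega> \<omega>' e. \<lbrakk> \<omega> \<in> grade W p; \<omega>' \<in> grade W p; e \<in> carrier E \<rbrakk> \<Longrightarrow>
      f (\<omega> \<oplus>\<^bsub>W\<^esub> \<omega>') e = f \<omega> e \<oplus>\<^bsub>N\<^esub> f \<omega>' e"
    and "\<And>\<omega> a e. \<lbrakk> \<omega> \<in> grade W p; a \<in> carrier A; e \<in> carrier E \<rbrakk> \<Longrightarrow>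
      f (\<omega> \<otimes>\<^bsub>W\<^esub> a) e = f \<omega> (a \<odot>\<^bsub>E\<^esub> e)"
  shows "forms_balanced p E N f"
  using assms by (auto simp: forms_balanced_def additive_maps_def)

context
  fixes E :: "('w, 'e) lmod" and p :: nat
  assumes E: "left_module A E"
begin

interpretation E: left_module A E by (fact E)

interpretation T: tensor_action "carrier A" "monoid.mult W" "smult E" "homogeneous p" E A "monoid.mult W"
  by (rule forms_tensor[OF E])

lemma T_forms: "tensor_module (carrier A) (monoid.mult W) (smult E) (monoid.mult W) (homogeneous p) E = Om p E"
  by (simp add: forms_def)

lemma tens_elem: "tensor_class (carrier A) (monoid.mult W) (smult E) (homogeneous p) E [(x, e)] = felem p E x e"
  by (simp add: forms_elem_def)

lemma T_balanced: "T.balanced N f \<longleftrightarrow> forms_balanced p E N f"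
  unfolding forms_balanced_def T.balanced_def by simp

lemma forms_module: "left_module A (Om p E)"
  using T.left_module_T by (simp add: T_forms)

lemma forms_abelian: "abelian_group (Om p E)"
  using forms_module by (rule module_abelian)

lemma elem_closed: "\<omega> \<in> grade W p \<Longrightarrow> e \<in> carrier E \<Longrightarrow> felem p E \<omega> e \<in> carrier (Om p E)"
  using T.tens_closed[where m = "monoid.mult W"] by (simp add: T_forms tens_elem)

lemma elem_balanced: "forms_balanced p E (Om p E) (felem p E)"
  using T.tens_balanced[where m = "monoid.mult W"] by (simp add: T_forms T_balanced tens_elem)

lemma elem_add_right:
  "\<lbrakk> \<omega> \<in> grade W p; e \<in> carrier E; e' \<in> carrier E \<rbrakk> \<Longrightarrow>
    felem p E \<omega> (e \<oplus>\<^bsub>E\<^esub> e') = felem p E \<omega> e \<oplus>\<^bsub>Om p E\<^esub> felem p E \<omega> e'"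
  using elem_balanced by (simp add: forms_balanced_def additive_maps_def)

lemma elem_add_left:
  "\<lbrakk> \<omega> \<in> grade W p; \<omega>' \<in> grade W p; e \<in> carrier E \<rbrakk> \<Longrightarrow>
    felem p E (\<omega> \<oplus>\<^bsub>W\<^esub> \<omega>') e = felem p E \<omega> e \<oplus>\<^bsub>Om p E\<^esub> felem p E \<omega>' e"
  using elem_balanced by (simp add: forms_balanced_def additive_maps_def)

lemma elem_balance:
  "\<lbrakk> \<omega> \<in> grade W p; a \<in> carrier A; e \<in> carrier E \<rbrakk> \<Longrightarrow>
    felem p E (\<omega> \<otimes>\<^bsub>W\<^esub> a) e = felem p E \<omega> (a \<odot>\<^bsub>E\<^esub> e)"
  using elem_balanced by (simp add: forms_balanced_def)

lemma elem_smult: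
  "\<lbrakk> a \<in> carrier A; \<omega> \<in> grade W p; e \<in> carrier E \<rbrakk> \<Longrightarrow>
    a \<odot>\<^bsub>Om p E\<^esub> felem p E \<omega> e = felem p E (a \<otimes>\<^bsub>W\<^esub> \<omega>) e"
  using T.smult_tens by (simp add: T_forms tens_elem)

lemma forms_terms: "\<lbrakk> t \<in> carrier (Om p E); (\<omega>, e) \<in> set (terms t) \<rbrakk> \<Longrightarrow> \<omega> \<in> grade W p \<and> e \<in> carrier E"
  using T.terms_ok[where m = "monoid.mult W"] by (auto simp: T_forms)

lemma forms_eqI:
  assumes "abelian_group N" "f \<in> additive_maps (Om p E) N" "g \<in> additive_maps (Om p E) N"
    "\<And>\<omega> e. \<lbrakk> \<omega> \<in> grade W p; e \<in> carrier E \<rbrakk> \<Longrightarrow> f (felem p E \<omega> e) = g (felem p E \<omega> e)"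
    "t \<in> carrier (Om p E)"
  shows "f t = g t"
  using T.additive_eqI[OF assms(1), where m = "monoid.mult W"] assms(2-) by (simp add: T_forms tens_elem)

lemma forms_ext_additive:
  assumes "abelian_group N" "forms_balanced p E N f"
  shows "tensor_ext N f \<in> additive_maps (Om p E) N"
  using T.ext_additive[OF assms(1), where m = "monoid.mult W"] assms(2) by (simp add: T_forms T_balanced)

lemma forms_ext_elem:
  assumes "abelian_group N" "forms_balanced p E N f" "\<omega> \<in> grade W p" "e \<in> carrier E"
  shows "tensor_ext N f (felem p E \<omega> e) = f \<omega> e"
  using T.ext_tens[OF assms(1)] assms(2-) by (simp add: tens_elem T_balanced)

lemma forms_smult_additive: "a \<in> carrier A \<Longrightarrow> (\<lambda>t. a \<odot>\<^bsub>Om p E\<^esub> t) \<in> additive_maps (Om p E) (Om p E)"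
  using T.smult_additive by (simp add: T_forms)

end

section \<open>Functoriality of forms with values in a module\<close>

lemma forms_map_balanced:
  assumes "left_module A E" "left_module A E'" "f \<in> linear_maps A E E'"
  shows "forms_balanced p E (Om p E') (\<lambda>\<omega> e. felem p E' \<omega> (f e))"
  by (rule forms_balancedI)
    (simp_all add: elem_closed[OF assms(2)] elem_add_right[OF assms(2)] elem_add_left[OF assms(2)]
      elem_balance[OF assms(2)] linear_closed[OF assms(3)] linear_smult[OF assms(3)]
      additive_add[OF linear_additive[OF assms(3)]])

lemma forms_map_elem:
  assumes "left_module A E" "left_module A E'" "f \<in> linear_maps A E E'" "\<omega> \<in> grade W p" "e \<in> carrier E"
  shows "forms_map A W p E' f (felem p E \<omega> e) = felem p E' \<omega> (f e)"
  unfolding forms_map_def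
  by (rule forms_ext_elem[OF assms(1) forms_abelian[OF assms(2)] forms_map_balanced[OF assms(1-3)] assms(4,5)])

lemma forms_map_additive:
  assumes "left_module A E" "left_module A E'" "f \<in> linear_maps A E E'"
  shows "forms_map A W p E' f \<in> additive_maps (Om p E) (Om p E')"
  unfolding forms_map_def
  by (rule forms_ext_additive[OF assms(1) forms_abelian[OF assms(2)] forms_map_balanced[OF assms]])

lemma forms_map_linear:
  assumes "left_module A E" "left_module A E'" "f \<in> linear_maps A E E'"
  shows "forms_map A W p E' f \<in> linear_maps A (Om p E) (Om p E')"
proof (rule linear_mapsI[OF forms_map_additive[OF assms]])
  fix a t assume a: "a \<in> carrier A" and t: "t \<in> carrier (Om p E)"
  note add = forms_map_additive[OF assms]
  show "forms_map A W p E' f (a \<odot>\<^bsub>Om p E\<^esub> t) = a \<odot>\<^bsub>Om p E'\<^esub> forms_map A W p E' f t"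
  proof (rule forms_eqI[OF assms(1) forms_abelian[OF assms(2)] _ _ _ t])
    show "(\<lambda>t. forms_map A W p E' f (a \<odot>\<^bsub>Om p E\<^esub> t)) \<in> additive_maps (Om p E) (Om p E')"
      using additive_comp[OF forms_smult_additive[OF assms(1) a] add] .
    show "(\<lambda>t. a \<odot>\<^bsub>Om p E'\<^esub> forms_map A W p E' f t) \<in> additive_maps (Om p E) (Om p E')"
      using additive_comp[OF add forms_smult_additive[OF assms(2) a]] .
    show "forms_map A W p E' f (a \<odot>\<^bsub>Om p E\<^esub> felem p E \<omega> e) = a \<odot>\<^bsub>Om p E'\<^esub> forms_map A W p E' f (felem p E \<omega> e)"
      if "\<omega> \<in> grade W p" "e \<in> carrier E" for \<omega> e
      using that a grade_mult[OF A_grade[OF a] that(1)]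
      by (simp add: elem_smult[OF assms(1)] elem_smult[OF assms(2)] forms_map_elem[OF assms]
          linear_closed[OF assms(3)])
  qed
qed

lemma forms_map_comp:
  assumes "left_module A E" "left_module A E'" "left_module A E''"
    "f \<in> linear_maps A E E'" "g \<in> linear_maps A E' E''" "t \<in> carrier (Om p E)"
  shows "forms_map A W p E'' g (forms_map A W p E' f t) = forms_map A W p E'' (\<lambda>x. g (f x)) t"
  by (rule forms_eqI[OF assms(1) forms_abelian[OF assms(3), where p = p] _ _ _ assms(6)])
    (simp_all add: additive_comp[OF forms_map_additive forms_map_additive] forms_map_additive
      linear_comp[OF assms(4,5)] forms_map_elem[OF assms(1,2,4)] forms_map_elem[OF assms(2,3,5)]
      forms_map_elem[OF assms(1,3) linear_comp[OF assms(4,5)]] linear_closed[OF assms(4)] assms)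

lemma forms_map_id:
  assumes "left_module A E" "t \<in> carrier (Om p E)"
  shows "forms_map A W p E (\<lambda>x. x) t = t"
  by (rule forms_eqI[OF assms(1) forms_abelian[OF assms(1)] forms_map_additive additive_id _ assms(2)])
    (simp_all add: forms_map_elem[OF assms(1,1) linear_id] assms(1) linear_id)

lemma tensor_ext_cong:
  assumes "\<And>x e. (x, e) \<in> set (terms t) \<Longrightarrow> f x e = g x e"
  shows "tensor_ext N f t = tensor_ext N g t"
  unfolding tensor_ext_def using assms by (intro arg_cong[where f = "list_sum N"] map_cong) auto

lemma forms_map_cong:
  assumes "left_module A E" "t \<in> carrier (Om p E)" "\<And>x. x \<in> carrier E \<Longrightarrow> f x = g x"
  shows "forms_map A W p E' f t = forms_map A W p E' g t"
  unfolding forms_map_def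
  using forms_terms[OF assms(1,2)] assms(3) by (intro tensor_ext_cong) auto

text \<open>Left multiplication by the form \<theta>. The target degree s is a separate argument,
  tied to p + q by the assumption \<open>deg\<close> of the lemmas, so that 1 + m and m + 1 can be
  treated alike.\<close>

definition left_wedge :: "nat \<Rightarrow> ('w, 'e) lmod \<Rightarrow> 'w \<Rightarrow> ('w, 'e) univ \<Rightarrow> ('w, 'e) univ" where
  "left_wedge s E \<theta> = tensor_ext (Om s E) (\<lambda>\<alpha> e. felem s E (\<theta> \<otimes>\<^bsub>W\<^esub> \<alpha>) e)"

context
  fixes E :: "('w, 'e) lmod" and p q s :: nat
  assumes E: "left_module A E" and deg: "p + q = s"
begin

lemma left_wedge_balanced:
  assumes "\<theta> \<in> grade W p"
  shows "forms_balanced q E (Om s E) (\<lambda>\<alpha> e. felem s E (\<theta> \<otimes>\<^bsub>W\<^esub> \<alpha>) e)"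
  using assms
  by (intro forms_balancedI)
    (simp_all add: elem_closed[OF E] elem_add_right[OF E] elem_add_left[OF E] grade_mult[OF _ _ deg]
      elem_balance[OF E, symmetric] r_distr m_assoc[symmetric] grade_carrier A_in_W)

lemma left_wedge_additive:
  "\<theta> \<in> grade W p \<Longrightarrow> left_wedge s E \<theta> \<in> additive_maps (Om q E) (Om s E)"
  unfolding left_wedge_def by (intro forms_ext_additive E forms_abelian left_wedge_balanced)

lemma left_wedge_elem:
  "\<theta> \<in> grade W p \<Longrightarrow> \<alpha> \<in> grade W q \<Longrightarrow> e \<in> carrier E \<Longrightarrow>
    left_wedge s E \<theta> (felem q E \<alpha> e) = felem s E (\<theta> \<otimes>\<^bsub>W\<^esub> \<alpha>) e"
  unfolding left_wedge_def by (intro forms_ext_elem E forms_abelian left_wedge_balanced)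

lemma left_wedge_closed:
  "\<theta> \<in> grade W p \<Longrightarrow> t \<in> carrier (Om q E) \<Longrightarrow> left_wedge s E \<theta> t \<in> carrier (Om s E)"
  using additive_closed[OF left_wedge_additive] .

lemma left_wedge_add:
  assumes "\<theta> \<in> grade W p" "\<theta>' \<in> grade W p" "t \<in> carrier (Om q E)"
  shows "left_wedge s E (\<theta> \<oplus>\<^bsub>W\<^esub> \<theta>') t = left_wedge s E \<theta> t \<oplus>\<^bsub>Om s E\<^esub> left_wedge s E \<theta>' t"
  using assms(1,2)
  by (intro forms_eqI[OF E forms_abelian[OF E] left_wedge_additive
        additive_plus[OF forms_abelian[OF E] left_wedge_additive left_wedge_additive] _ assms(3)])
    (simp_all add: grade_add left_wedge_elem l_distr grade_carrier elem_add_left[OF E] grade_mult[OF _ _ deg])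

text \<open>Associativity of the product of forms. It is the balancing condition under which
  \<theta> \<otimes> t \<mapsto> \<theta> \<and> t descends to the tensor product over
  \<open>A\<close>, as used for \<open>wedge_map\<close>.\<close>

lemma left_wedge_mult_right:
  assumes "\<theta> \<in> grade W p" "a \<in> carrier A" "t \<in> carrier (Om q E)"
  shows "left_wedge s E (\<theta> \<otimes>\<^bsub>W\<^esub> a) t = left_wedge s E \<theta> (a \<odot>\<^bsub>Om q E\<^esub> t)"
proof -
  have 1: "\<theta> \<otimes>\<^bsub>W\<^esub> a \<in> grade W p" using grade_mult[OF assms(1) A_grade[OF assms(2)]] by simp
  have 2: "a \<otimes>\<^bsub>W\<^esub> \<alpha> \<in> grade W q" if "\<alpha> \<in> grade W q" for \<alpha>
    using grade_mult[OF A_grade[OF assms(2)] that] by simp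
  show ?thesis
    using assms(1,2) 1
    by (intro forms_eqI[OF E forms_abelian[OF E] left_wedge_additive
          additive_comp[OF forms_smult_additive[OF E] left_wedge_additive] _ assms(3)])
      (simp_all add: left_wedge_elem elem_smult[OF E] m_assoc grade_carrier A_in_W 2)
qed

lemma left_wedge_mult_left:
  assumes "\<theta> \<in> grade W p" "a \<in> carrier A" "t \<in> carrier (Om q E)"
  shows "left_wedge s E (a \<otimes>\<^bsub>W\<^esub> \<theta>) t = a \<odot>\<^bsub>Om s E\<^esub> left_wedge s E \<theta> t"
proof -
  have 1: "a \<otimes>\<^bsub>W\<^esub> \<theta> \<in> grade W p" using grade_mult[OF A_grade[OF assms(2)] assms(1)] by simp
  show ?thesis
    using assms(1,2) 1
    by (intro forms_eqI[OF E forms_abelian[OF E] left_wedge_additive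
          additive_comp[OF left_wedge_additive forms_smult_additive[OF E]] _ assms(3)])
      (simp_all add: left_wedge_elem elem_smult[OF E] m_assoc grade_carrier A_in_W grade_mult[OF _ _ deg])
qed

end

lemma left_wedge_natural:
  assumes E: "left_module A E" "left_module A E'" and f: "f \<in> linear_maps A E E'"
    and deg: "p + q = s" and \<theta>: "\<theta> \<in> grade W p" and t: "t \<in> carrier (Om q E)"
  shows "forms_map A W s E' f (left_wedge s E \<theta> t) = left_wedge s E' \<theta> (forms_map A W q E' f t)"
  by (rule forms_eqI[OF E(1) forms_abelian[OF E(2)]
        additive_comp[OF left_wedge_additive[OF E(1) deg \<theta>] forms_map_additive[OF E f]]
        additive_comp[OF forms_map_additive[OF E f] left_wedge_additive[OF E(2) deg \<theta>]] _ t])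
    (simp_all add: left_wedge_elem[OF E(1) deg \<theta>] left_wedge_elem[OF E(2) deg \<theta>]
      forms_map_elem[OF E f] linear_closed[OF f] grade_mult[OF \<theta> _ deg])

section \<open>The first jet module\<close>


text \<open>Degree one must stay written as \<open>1\<close>: simplification to \<open>Suc 0\<close>
  would separate terms in \<open>Om 1\<close> from the facts about them.\<close>

declare One_nat_def [simp del]

abbreviation "free \<equiv> free_module K A"
abbreviation "J1 \<equiv> jet1 K A W"
abbreviation "jelem \<equiv> jet1_elem K A W"
abbreviation "jrel \<equiv> jet1_relations K A W"

text \<open>This is D. Since \<open>tensor_ext\<close> reads formal sums, the same constant is a map
  on the free module over E and, restricted to the chosen coset representatives, a map on
  \<open>J1 E\<close>; the same holds for \<open>jet1_proj\<close>.\<close>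

definition jet1_deriv :: "('w, 'e) lmod \<Rightarrow> ('w, 'e) univ \<Rightarrow> ('w, 'e) univ" where
  "jet1_deriv E = tensor_ext (Om 1 E) (\<lambda>a e. felem 1 E (diff W a) e)"

lemma diff_A_add: "a \<in> carrier A \<Longrightarrow> b \<in> carrier A \<Longrightarrow> diff W (a \<oplus>\<^bsub>A\<^esub> b) = diff W a \<oplus>\<^bsub>W\<^esub> diff W b"
  by (simp add: A_add diff_add A_in_W)

lemma diff_closed:
  assumes "x \<in> grade W p"
  shows "diff W x \<in> carrier W"
  using diff_grade[OF assms] grade_carrier by blast

lemma diff_A_mult:
  assumes "a \<in> carrier A" "y \<in> grade W p"
  shows "diff W (a \<otimes>\<^bsub>W\<^esub> y) = diff W a \<otimes>\<^bsub>W\<^esub> y \<oplus>\<^bsub>W\<^esub> a \<otimes>\<^bsub>W\<^esub> diff W y"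
  using leibniz[OF A_grade[OF assms(1)] grade_carrier[OF assms(2)]]
    diff_closed[OF assms(2)] A_in_W[OF assms(1)] by simp

lemma diff_one: "diff W \<one>\<^bsub>W\<^esub> = \<zero>\<^bsub>W\<^esub>"
proof -
  have 1: "\<one>\<^bsub>W\<^esub> \<in> grade W 0" by (rule one_grade)
  have "diff W \<one>\<^bsub>W\<^esub> = diff W \<one>\<^bsub>W\<^esub> \<oplus>\<^bsub>W\<^esub> diff W \<one>\<^bsub>W\<^esub>"
    using diff_A_mult[of "\<one>\<^bsub>W\<^esub>" "\<one>\<^bsub>W\<^esub>" 0] 1 diff_closed[OF 1] by (simp add: A_carrier)
  then show ?thesis using diff_closed[OF 1] by (metis add.l_cancel_one')
qed

section \<open>The maps \<pi> and D on the free module, before passing to the quotient\<close>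

lemma free_tensor:
  fixes E :: "('w, 'e) lmod"
  assumes E: "left_module A E"
  shows "tensor_action (carrier K) (\<lambda>x c. c \<odot>\<^bsub>A\<^esub> x) (base_smult A E) A E A (monoid.mult A)"
proof -
  interpret E: left_module A E by fact
  show ?thesis
  proof (intro tensor_action.intro tensor_data.intro tensor_action_axioms.intro)
    show "abelian_group A" "abelian_group E" "ring A" by unfold_locales
  qed (auto simp: additive_maps_def A.r_distr A.l_distr A.m_assoc base_smult_def A.smult_mult_right
      E.smult_closed)
qed

context
  fixes E :: "('w, 'e) lmod"
  assumes E: "left_module A E"
begin

interpretation E: left_module A E by (fact E)

interpretation Om1: abelian_group "Om 1 E" by (rule forms_abelian[OF E])

interpretation F: tensor_action "carrier K" "\<lambda>x c. c \<odot>\<^bsub>A\<^esub> x" "base_smult A E" A E A "monoid.mult A"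
  by (rule free_tensor[OF E])

lemma T_free:
  "tensor_module (carrier K) (\<lambda>x c. c \<odot>\<^bsub>A\<^esub> x) (base_smult A E) (monoid.mult A) A E = free E"
  by (simp add: free_module_def)

interpretation free: abelian_group "free E"
  using F.abelian_group_TM[of "monoid.mult A"] by (simp add: T_free)

text \<open>A scalar c of \<open>K\<close> passes from a to e because c a = a (c 1) in
  \<open>A\<close>.\<close>

lemma proj_balanced: "F.balanced E (\<lambda>a e. a \<odot>\<^bsub>E\<^esub> e)"
proof -
  have "a \<odot>\<^bsub>E\<^esub> ((c \<odot>\<^bsub>A\<^esub> \<one>\<^bsub>A\<^esub>) \<odot>\<^bsub>E\<^esub> e) = (c \<odot>\<^bsub>A\<^esub> a) \<odot>\<^bsub>E\<^esub> e"
    if "c \<in> carrier K" "a \<in> carrier A" "e \<in> carrier E" for c a e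
  proof -
    have "c \<odot>\<^bsub>A\<^esub> (a \<otimes>\<^bsub>A\<^esub> \<one>\<^bsub>A\<^esub>) = a \<otimes>\<^bsub>A\<^esub> (c \<odot>\<^bsub>A\<^esub> \<one>\<^bsub>A\<^esub>)"
      using that by (intro A.smult_mult_right A.one_closed)
    moreover have "a \<otimes>\<^bsub>A\<^esub> \<one>\<^bsub>A\<^esub> = a" using that by simp
    ultimately show ?thesis
      using E.smult_assoc[OF that(2) A.smult_closed[OF that(1) A.one_closed] that(3)] by metis
  qed
  then show ?thesis
    by (simp add: F.balanced_def additive_maps_def E.smult_closed E.smult_r_distr E.smult_l_distr
        base_smult_def)
qed

text \<open>As d is linear over \<open>K\<close>, d(c a) = da (c 1), and the factor c 1, being an
  element of \<open>A\<close>, crosses the tensor sign.\<close>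

lemma deriv_balanced: "F.balanced (Om 1 E) (\<lambda>a e. felem 1 E (diff W a) e)"
proof -
  have "felem 1 E (diff W (c \<odot>\<^bsub>A\<^esub> a)) e = felem 1 E (diff W a) ((c \<odot>\<^bsub>A\<^esub> \<one>\<^bsub>A\<^esub>) \<odot>\<^bsub>E\<^esub> e)"
    if "c \<in> carrier K" "a \<in> carrier A" "e \<in> carrier E" for c a e
  proof -
    have "diff W (c \<odot>\<^bsub>A\<^esub> a) = c \<odot>\<^bsub>W\<^esub> (diff W a \<otimes>\<^bsub>W\<^esub> \<one>\<^bsub>W\<^esub>)"
      using that grade_carrier[OF diff_A[OF that(2)]] by (simp add: A_smult diff_smult A_in_W)
    also have "\<dots> = diff W a \<otimes>\<^bsub>W\<^esub> (c \<odot>\<^bsub>W\<^esub> \<one>\<^bsub>W\<^esub>)"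
      using that grade_carrier[OF diff_A[OF that(2)]] smult_mult_right by blast
    also have "c \<odot>\<^bsub>W\<^esub> \<one>\<^bsub>W\<^esub> = c \<odot>\<^bsub>A\<^esub> \<one>\<^bsub>A\<^esub>"
      using A_smult[OF that(1) A.one_closed] A_one by simp
    finally have "diff W (c \<odot>\<^bsub>A\<^esub> a) = diff W a \<otimes>\<^bsub>W\<^esub> (c \<odot>\<^bsub>A\<^esub> \<one>\<^bsub>A\<^esub>)" .
    then show ?thesis
      using that elem_balance[OF E diff_A[OF that(2)], of "c \<odot>\<^bsub>A\<^esub> \<one>\<^bsub>A\<^esub>"] by simp
  qed
  then show ?thesis
    by (simp add: F.balanced_def additive_maps_def base_smult_def diff_A
        diff_A_add elem_closed[OF E] elem_add_left[OF E] elem_add_right[OF E])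
qed

lemma free_proj_additive: "jet1_proj E \<in> additive_maps (free E) E"
  using F.ext_additive[OF E.abelian_group_axioms proj_balanced, of "monoid.mult A"]
  by (simp add: T_free jet1_proj_def)

lemma free_deriv_additive: "jet1_deriv E \<in> additive_maps (free E) (Om 1 E)"
  using F.ext_additive[OF Om1.abelian_group_axioms deriv_balanced, of "monoid.mult A"]
  by (simp add: T_free jet1_deriv_def)

lemma free_class_closed: "set p \<subseteq> carrier A \<times> carrier E \<Longrightarrow> free_class K A E p \<in> carrier (free E)"
  using F.cls_closed[of p "monoid.mult A"] by (simp add: T_free free_class_def)

lemma free_proj_class:
  "set p \<subseteq> carrier A \<times> carrier E \<Longrightarrow>
    jet1_proj E (free_class K A E p) = list_sum E (map (\<lambda>(a, e). a \<odot>\<^bsub>E\<^esub> e) p)"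
  unfolding jet1_proj_def free_class_def
  by (rule F.ext_cls[OF E.abelian_group_axioms proj_balanced])

lemma free_deriv_class:
  "set p \<subseteq> carrier A \<times> carrier E \<Longrightarrow>
    jet1_deriv E (free_class K A E p) = list_sum (Om 1 E) (map (\<lambda>(a, e). felem 1 E (diff W a) e) p)"
  unfolding jet1_deriv_def free_class_def
  by (rule F.ext_cls[OF Om1.abelian_group_axioms deriv_balanced])

lemma free_smult_closed: "a \<in> carrier A \<Longrightarrow> t \<in> carrier (free E) \<Longrightarrow> a \<odot>\<^bsub>free E\<^esub> t \<in> carrier (free E)"
  using additive_closed[OF F.smult_additive] by (simp add: T_free)

lemma free_proj_smult:
  assumes "a \<in> carrier A" "t \<in> carrier (free E)"
  shows "jet1_proj E (a \<odot>\<^bsub>free E\<^esub> t) = a \<odot>\<^bsub>E\<^esub> jet1_proj E t"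
proof -
  have 1: "(\<lambda>e. a \<odot>\<^bsub>E\<^esub> e) \<in> additive_maps E E"
    using assms by (simp add: additive_maps_def E.smult_closed E.smult_r_distr)
  have 2: "(\<lambda>t. a \<odot>\<^bsub>free E\<^esub> t) \<in> additive_maps (free E) (free E)"
    using F.smult_additive[OF assms(1)] by (simp add: T_free)
  have 3: "jet1_proj E (free_class K A E [(x, e)]) = x \<odot>\<^bsub>E\<^esub> e" if "x \<in> carrier A" "e \<in> carrier E" for x e
    using free_proj_class[of "[(x, e)]"] that by (simp add: E.smult_closed)
  show ?thesis
    using F.additive_eqI[OF E.abelian_group_axioms, of _ "monoid.mult A", unfolded T_free,
        OF additive_comp[OF 2 free_proj_additive] additive_comp[OF free_proj_additive 1] _ assms(2)]
      F.smult_tens[OF assms(1), unfolded T_free, folded free_class_def] assms(1)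
    by (simp add: free_class_def[symmetric] 3 E.smult_assoc)
qed

text \<open>On x \<otimes> e this is d(a x) = da x + a dx, where the x of the first term crosses the
  tensor sign and produces \<pi> (x \<otimes> e) = x e.\<close>

lemma free_deriv_smult:
  assumes "a \<in> carrier A" "t \<in> carrier (free E)"
  shows "jet1_deriv E (a \<odot>\<^bsub>free E\<^esub> t)
    = felem 1 E (diff W a) (jet1_proj E t) \<oplus>\<^bsub>Om 1 E\<^esub> a \<odot>\<^bsub>Om 1 E\<^esub> jet1_deriv E t"
proof -
  have 1: "(\<lambda>e. felem 1 E (diff W a) e) \<in> additive_maps E (Om 1 E)"
    using elem_balanced[OF E, of 1] diff_A[OF assms(1)] by (simp add: forms_balanced_def)
  have 2: "(\<lambda>t. a \<odot>\<^bsub>free E\<^esub> t) \<in> additive_maps (free E) (free E)"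
    using F.smult_additive[OF assms(1)] by (simp add: T_free)
  have 3: "jet1_proj E (free_class K A E [(x, e)]) = x \<odot>\<^bsub>E\<^esub> e" if "x \<in> carrier A" "e \<in> carrier E" for x e
    using free_proj_class[of "[(x, e)]"] that by (simp add: E.smult_closed)
  have 4: "jet1_deriv E (free_class K A E [(x, e)]) = felem 1 E (diff W x) e"
    if "x \<in> carrier A" "e \<in> carrier E" for x e
    using free_deriv_class[of "[(x, e)]"] that by (simp add: elem_closed[OF E diff_A])
  have 5: "felem 1 E (diff W (a \<otimes>\<^bsub>A\<^esub> x)) e
      = felem 1 E (diff W a) (x \<odot>\<^bsub>E\<^esub> e) \<oplus>\<^bsub>Om 1 E\<^esub> a \<odot>\<^bsub>Om 1 E\<^esub> felem 1 E (diff W x) e"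
    if "x \<in> carrier A" "e \<in> carrier E" for x e
    using that assms(1) grade_mult[OF diff_A A_grade, of a x 1] grade_mult[OF A_grade diff_A, of a x 1]
    by (simp add: A_mult diff_A_mult[OF _ A_grade] elem_add_left[OF E] elem_smult[OF E _ diff_A]
        elem_balance[OF E diff_A])
  show ?thesis
    using F.additive_eqI[OF Om1.abelian_group_axioms, of _ "monoid.mult A", unfolded T_free,
        OF additive_comp[OF 2 free_deriv_additive] additive_plus[OF Om1.abelian_group_axioms
          additive_comp[OF free_proj_additive 1]
          additive_comp[OF free_deriv_additive forms_smult_additive[OF E assms(1)]]] _ assms(2)]
      F.smult_tens[OF assms(1), unfolded T_free, folded free_class_def] assms(1)
    by (simp add: free_class_def[symmetric] 3 4 5)
qed

text \<open>The two sums in the definition of the relations are the values of \<pi> and D at the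
  class of the formal sum, so the relations form the common kernel of two additive maps.\<close>

lemma jet1_relations_eq:
  "jrel E = {t \<in> carrier (free E). jet1_proj E t = \<zero>\<^bsub>E\<^esub> \<and> jet1_deriv E t = \<zero>\<^bsub>Om 1 E\<^esub>}"
proof -
  have "t \<in> carrier (free E) \<longleftrightarrow> (\<exists>p. t = free_class K A E p \<and> set p \<subseteq> carrier A \<times> carrier E)" for t
    using F.carrier_TM[of "monoid.mult A"] by (auto simp: T_free free_class_def)
  then show ?thesis
    unfolding jet1_relations_def by (auto simp: free_proj_class free_deriv_class)
qed

text \<open>Cosets of a common kernel are the fibres of the pair formed by \<pi> and D.\<close>

lemma jet1_coset:
  assumes x: "x \<in> carrier (free E)"
  shows "y \<in> jrel E +>\<^bsub>free E\<^esub> x \<longleftrightarrow>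
    y \<in> carrier (free E) \<and> jet1_proj E y = jet1_proj E x \<and> jet1_deriv E y = jet1_deriv E x"
proof
  assume "y \<in> jrel E +>\<^bsub>free E\<^esub> x"
  then obtain h where "h \<in> jrel E" "y = h \<oplus>\<^bsub>free E\<^esub> x" by (auto simp: a_r_coset_def')
  then show "y \<in> carrier (free E) \<and> jet1_proj E y = jet1_proj E x \<and> jet1_deriv E y = jet1_deriv E x"
    using x additive_closed[OF free_proj_additive x] additive_closed[OF free_deriv_additive x]
    by (auto simp: jet1_relations_eq additive_add[OF free_proj_additive] additive_add[OF free_deriv_additive])
next
  assume y: "y \<in> carrier (free E) \<and> jet1_proj E y = jet1_proj E x \<and> jet1_deriv E y = jet1_deriv E x"
  have "y \<ominus>\<^bsub>free E\<^esub> x \<in> jrel E"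
    using x y additive_closed[OF free_proj_additive x] additive_closed[OF free_deriv_additive x]
    by (simp add: jet1_relations_eq additive_minus[OF free.abelian_group_axioms E.abelian_group_axioms free_proj_additive]
        additive_minus[OF free.abelian_group_axioms Om1.abelian_group_axioms free_deriv_additive]
        E.minus_eq E.r_neg Om1.minus_eq Om1.r_neg)
  moreover have "y = (y \<ominus>\<^bsub>free E\<^esub> x) \<oplus>\<^bsub>free E\<^esub> x"
    using x y by (simp add: a_minus_def free.a_assoc free.l_neg)
  ultimately show "y \<in> jrel E +>\<^bsub>free E\<^esub> x" by (auto simp: a_r_coset_def')
qed

lemma coset_rep_eqI:
  assumes "x \<in> carrier (free E)" "y \<in> carrier (free E)"
    "jet1_proj E x = jet1_proj E y" "jet1_deriv E x = jet1_deriv E y"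
  shows "coset_rep (free E) (jrel E) x = coset_rep (free E) (jrel E) y"
  unfolding coset_rep_def by (simp add: jet1_coset[OF assms(1)] jet1_coset[OF assms(2)] assms(3,4))

lemma coset_rep_props:
  assumes x: "x \<in> carrier (free E)"
  shows "coset_rep (free E) (jrel E) x \<in> carrier (free E)"
    and "jet1_proj E (coset_rep (free E) (jrel E) x) = jet1_proj E x"
    and "jet1_deriv E (coset_rep (free E) (jrel E) x) = jet1_deriv E x"
proof -
  have "coset_rep (free E) (jrel E) x \<in> jrel E +>\<^bsub>free E\<^esub> x"
    unfolding coset_rep_def by (rule someI[of _ x]) (simp add: jet1_coset x)
  then show "coset_rep (free E) (jrel E) x \<in> carrier (free E)"
    "jet1_proj E (coset_rep (free E) (jrel E) x) = jet1_proj E x"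
    "jet1_deriv E (coset_rep (free E) (jrel E) x) = jet1_deriv E x"
    by (simp_all add: jet1_coset x)
qed

section \<open>The module of 1-jets and its coordinates \<pi> and D\<close>

lemma jet1_carrier: "carrier (J1 E) = coset_rep (free E) (jrel E) ` carrier (free E)"
  and jet1_zero_def: "\<zero>\<^bsub>J1 E\<^esub> = coset_rep (free E) (jrel E) \<zero>\<^bsub>free E\<^esub>"
  and jet1_add_def: "x \<oplus>\<^bsub>J1 E\<^esub> y = coset_rep (free E) (jrel E) (x \<oplus>\<^bsub>free E\<^esub> y)"
  and jet1_smult_def: "a \<odot>\<^bsub>J1 E\<^esub> x = coset_rep (free E) (jrel E) (a \<odot>\<^bsub>free E\<^esub> x)"
  by (simp_all add: jet1_def quotient_module_def)

lemma jet1_free: "x \<in> carrier (J1 E) \<Longrightarrow> x \<in> carrier (free E)"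
  by (auto simp: jet1_carrier coset_rep_props)

lemma coset_rep_closed: "x \<in> carrier (free E) \<Longrightarrow> coset_rep (free E) (jrel E) x \<in> carrier (J1 E)"
  by (auto simp: jet1_carrier)

text \<open>The choice made by \<open>coset_rep\<close> depends only on the fibre, and
  \<open>coset_rep\<close> fixes the elements of \<open>J1 E\<close>; hence equal coordinates force
  equal elements.\<close>

lemma jet1_eqI:
  assumes "x \<in> carrier (J1 E)" "y \<in> carrier (J1 E)"
    "jet1_proj E x = jet1_proj E y" "jet1_deriv E x = jet1_deriv E y"
  shows "x = y"
proof -
  have *: "coset_rep (free E) (jrel E) z = z" if "z \<in> carrier (J1 E)" for z
    using that by (auto simp: jet1_carrier coset_rep_props intro!: coset_rep_eqI)
  show ?thesis
    using coset_rep_eqI[OF jet1_free jet1_free, OF assms] assms(1,2) by (simp add: *)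
qed

lemma jet1_add_closed: "x \<in> carrier (J1 E) \<Longrightarrow> y \<in> carrier (J1 E) \<Longrightarrow> x \<oplus>\<^bsub>J1 E\<^esub> y \<in> carrier (J1 E)"
  by (simp add: jet1_add_def coset_rep_closed jet1_free)

lemma jet1_smult_closed: "a \<in> carrier A \<Longrightarrow> x \<in> carrier (J1 E) \<Longrightarrow> a \<odot>\<^bsub>J1 E\<^esub> x \<in> carrier (J1 E)"
  by (simp add: jet1_smult_def coset_rep_closed jet1_free free_smult_closed)

lemma jet1_proj_additive: "jet1_proj E \<in> additive_maps (J1 E) E"
  by (rule additive_mapsI)
    (simp_all add: jet1_free additive_closed[OF free_proj_additive] additive_add[OF free_proj_additive]
      jet1_add_def coset_rep_props)

lemma jet1_deriv_additive: "jet1_deriv E \<in> additive_maps (J1 E) (Om 1 E)"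
  by (rule additive_mapsI)
    (simp_all add: jet1_free additive_closed[OF free_deriv_additive] additive_add[OF free_deriv_additive]
      jet1_add_def coset_rep_props)

lemma jet1_proj_smult:
  "a \<in> carrier A \<Longrightarrow> x \<in> carrier (J1 E) \<Longrightarrow> jet1_proj E (a \<odot>\<^bsub>J1 E\<^esub> x) = a \<odot>\<^bsub>E\<^esub> jet1_proj E x"
  by (simp add: jet1_smult_def coset_rep_props jet1_free free_smult_closed free_proj_smult)

lemma jet1_proj_linear: "jet1_proj E \<in> linear_maps A (J1 E) E"
  by (intro linear_mapsI jet1_proj_additive jet1_proj_smult)

lemma jet1_deriv_smult:
  "a \<in> carrier A \<Longrightarrow> x \<in> carrier (J1 E) \<Longrightarrow> jet1_deriv E (a \<odot>\<^bsub>J1 E\<^esub> x)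
    = felem 1 E (diff W a) (jet1_proj E x) \<oplus>\<^bsub>Om 1 E\<^esub> a \<odot>\<^bsub>Om 1 E\<^esub> jet1_deriv E x"
  by (simp add: jet1_smult_def coset_rep_props jet1_free free_smult_closed free_deriv_smult)

lemma jet1_zero_closed: "\<zero>\<^bsub>J1 E\<^esub> \<in> carrier (J1 E)"
  by (simp add: jet1_zero_def coset_rep_closed)

lemma jet1_proj_zero: "jet1_proj E \<zero>\<^bsub>J1 E\<^esub> = \<zero>\<^bsub>E\<^esub>"
  using additive_zero[OF free.abelian_group_axioms E.abelian_group_axioms free_proj_additive]
  by (simp add: jet1_zero_def coset_rep_props)

lemma jet1_deriv_zero: "jet1_deriv E \<zero>\<^bsub>J1 E\<^esub> = \<zero>\<^bsub>Om 1 E\<^esub>"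
  using additive_zero[OF free.abelian_group_axioms Om1.abelian_group_axioms free_deriv_additive]
  by (simp add: jet1_zero_def coset_rep_props)

text \<open>Each axiom is tested under \<pi> and D. Under D, associativity of the action is the
  Leibniz rule for d(a b), distributivity over sums of scalars uses additivity of d, and the unit
  law is d 1 = 0.\<close>

lemma jet1_module: "left_module A (J1 E)"
proof -
  interpret O1: left_module A "Om 1 E" by (rule forms_module[OF E])
  note P = additive_closed[OF jet1_proj_additive] and PA = additive_add[OF jet1_proj_additive]
    and D = additive_closed[OF jet1_deriv_additive] and DA = additive_add[OF jet1_deriv_additive]
  note simps = P PA D DA jet1_add_closed jet1_smult_closed jet1_zero_closed jet1_proj_zero
    jet1_deriv_zero jet1_proj_smult jet1_deriv_smult
  have ab: "abelian_group (J1 E)"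
  proof (rule abelian_groupI)
    show "\<zero>\<^bsub>J1 E\<^esub> \<in> carrier (J1 E)" by (rule jet1_zero_closed)
    show "\<exists>y\<in>carrier (J1 E). y \<oplus>\<^bsub>J1 E\<^esub> x = \<zero>\<^bsub>J1 E\<^esub>" if x: "x \<in> carrier (J1 E)" for x
    proof -
      let ?y = "coset_rep (free E) (jrel E) (\<ominus>\<^bsub>free E\<^esub> x)"
      have y: "?y \<in> carrier (J1 E)" using jet1_free[OF x] by (simp add: coset_rep_closed)
      have py: "jet1_proj E ?y = \<ominus>\<^bsub>E\<^esub> jet1_proj E x"
        using jet1_free[OF x] additive_a_inv[OF free.abelian_group_axioms E.abelian_group_axioms free_proj_additive]
        by (simp add: coset_rep_props)
      have dy: "jet1_deriv E ?y = \<ominus>\<^bsub>Om 1 E\<^esub> jet1_deriv E x"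
        using jet1_free[OF x] additive_a_inv[OF free.abelian_group_axioms Om1.abelian_group_axioms free_deriv_additive]
        by (simp add: coset_rep_props)
      have "?y \<oplus>\<^bsub>J1 E\<^esub> x = \<zero>\<^bsub>J1 E\<^esub>"
        by (rule jet1_eqI) (simp_all add: simps x y py dy E.l_neg Om1.l_neg)
      with y show ?thesis by blast
    qed
  next
    fix x y assume xy: "x \<in> carrier (J1 E)" "y \<in> carrier (J1 E)"
    show "x \<oplus>\<^bsub>J1 E\<^esub> y \<in> carrier (J1 E)" by (rule jet1_add_closed[OF xy])
    show "x \<oplus>\<^bsub>J1 E\<^esub> y = y \<oplus>\<^bsub>J1 E\<^esub> x"
      using xy by - (rule jet1_eqI; simp add: simps E.a_comm Om1.a_comm)
    show "\<zero>\<^bsub>J1 E\<^esub> \<oplus>\<^bsub>J1 E\<^esub> x = x" using xy(1) by - (rule jet1_eqI; simp add: simps)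
    fix z assume "z \<in> carrier (J1 E)"
    with xy show "x \<oplus>\<^bsub>J1 E\<^esub> y \<oplus>\<^bsub>J1 E\<^esub> z = x \<oplus>\<^bsub>J1 E\<^esub> (y \<oplus>\<^bsub>J1 E\<^esub> z)"
      by - (rule jet1_eqI; simp add: simps E.a_assoc Om1.a_assoc)
  qed
  have d_mult: "diff W (a \<otimes>\<^bsub>A\<^esub> b) = diff W a \<otimes>\<^bsub>W\<^esub> b \<oplus>\<^bsub>W\<^esub> a \<otimes>\<^bsub>W\<^esub> diff W b"
    if "a \<in> carrier A" "b \<in> carrier A" for a b
    using that by (simp add: A_mult diff_A_mult[OF _ A_grade])
  have e_mult: "felem 1 E (diff W a \<otimes>\<^bsub>W\<^esub> b \<oplus>\<^bsub>W\<^esub> a \<otimes>\<^bsub>W\<^esub> diff W b) e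
     = felem 1 E (diff W a) (b \<odot>\<^bsub>E\<^esub> e) \<oplus>\<^bsub>Om 1 E\<^esub> a \<odot>\<^bsub>Om 1 E\<^esub> felem 1 E (diff W b) e"
    if "a \<in> carrier A" "b \<in> carrier A" "e \<in> carrier E" for a b e
    using that grade_mult[OF diff_A A_grade, of a b 1] grade_mult[OF A_grade diff_A, of a b 1]
    by (simp add: elem_add_left[OF E] elem_smult[OF E _ diff_A]
        elem_balance[OF E diff_A])
  have e_one: "felem 1 E (diff W \<one>\<^bsub>A\<^esub>) e = \<zero>\<^bsub>Om 1 E\<^esub>" if "e \<in> carrier E" for e
    using additive_zero[OF abelian_homogeneous[of 1] Om1.abelian_group_axioms, of "\<lambda>\<omega>. felem 1 E \<omega> e"]
      elem_balanced[OF E, of 1] that by (simp add: forms_balanced_def A_one diff_one)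
  note simps = d_mult e_mult e_one simps elem_closed[OF E] diff_A diff_A_add elem_add_left[OF E]
    elem_add_right[OF E]
  show ?thesis
  proof (intro left_module.intro left_module_axioms.intro ab)
    show "ring A" by unfold_locales
  next
    fix a b x assume abx: "a \<in> carrier A" "b \<in> carrier A" "x \<in> carrier (J1 E)"
    then show "(a \<oplus>\<^bsub>A\<^esub> b) \<odot>\<^bsub>J1 E\<^esub> x = a \<odot>\<^bsub>J1 E\<^esub> x \<oplus>\<^bsub>J1 E\<^esub> b \<odot>\<^bsub>J1 E\<^esub> x"
      by - (rule jet1_eqI; simp add: simps E.smult_closed E.smult_l_distr O1.smult_closed
          O1.smult_l_distr Om1.add.m_ac)
    from abx show "(a \<otimes>\<^bsub>A\<^esub> b) \<odot>\<^bsub>J1 E\<^esub> x = a \<odot>\<^bsub>J1 E\<^esub> (b \<odot>\<^bsub>J1 E\<^esub> x)"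
      by - (rule jet1_eqI; simp add: simps E.smult_closed E.smult_assoc O1.smult_closed
          O1.smult_r_distr O1.smult_assoc Om1.add.m_ac)
  next
    fix a x y assume "a \<in> carrier A" "x \<in> carrier (J1 E)" "y \<in> carrier (J1 E)"
    then show "a \<odot>\<^bsub>J1 E\<^esub> (x \<oplus>\<^bsub>J1 E\<^esub> y) = a \<odot>\<^bsub>J1 E\<^esub> x \<oplus>\<^bsub>J1 E\<^esub> a \<odot>\<^bsub>J1 E\<^esub> y"
      by - (rule jet1_eqI; simp add: simps E.smult_closed E.smult_r_distr O1.smult_closed
          O1.smult_r_distr Om1.add.m_ac)
  next
    fix x assume "x \<in> carrier (J1 E)"
    then show "\<one>\<^bsub>A\<^esub> \<odot>\<^bsub>J1 E\<^esub> x = x"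
      by - (rule jet1_eqI; simp add: simps E.smult_one O1.smult_one)
  qed (rule jet1_smult_closed)
qed

lemma jet1_elem_closed: "a \<in> carrier A \<Longrightarrow> e \<in> carrier E \<Longrightarrow> jelem E a e \<in> carrier (J1 E)"
  by (simp add: jet1_elem_def coset_rep_closed free_class_closed)

lemma jet1_proj_elem: "a \<in> carrier A \<Longrightarrow> e \<in> carrier E \<Longrightarrow> jet1_proj E (jelem E a e) = a \<odot>\<^bsub>E\<^esub> e"
  by (simp add: jet1_elem_def coset_rep_props free_class_closed free_proj_class E.smult_closed)

lemma jet1_deriv_elem:
  "a \<in> carrier A \<Longrightarrow> e \<in> carrier E \<Longrightarrow> jet1_deriv E (jelem E a e) = felem 1 E (diff W a) e"
  by (simp add: jet1_elem_def coset_rep_props free_class_closed free_deriv_class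
      elem_closed[OF E] diff_A)

lemma jet1_terms: "\<lbrakk> x \<in> carrier (J1 E); (a, e) \<in> set (terms x) \<rbrakk> \<Longrightarrow> a \<in> carrier A \<and> e \<in> carrier E"
  using F.terms_ok[of x "monoid.mult A"] jet1_free by (auto simp: T_free)

text \<open>All three values are sums over the same list \<open>terms x\<close>.\<close>

lemma jet1_ext:
  assumes N: "abelian_group N" and g: "g \<in> additive_maps E N" and h: "h \<in> additive_maps (Om 1 E) N"
    and f: "\<And>a e. \<lbrakk> a \<in> carrier A; e \<in> carrier E \<rbrakk> \<Longrightarrow>
      f a e = g (a \<odot>\<^bsub>E\<^esub> e) \<oplus>\<^bsub>N\<^esub> h (felem 1 E (diff W a) e)"
    and x: "x \<in> carrier (J1 E)"
  shows "tensor_ext N f x = g (jet1_proj E x) \<oplus>\<^bsub>N\<^esub> h (jet1_deriv E x)"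
proof -
  note t = jet1_terms[OF x]
  have c1: "(case z of (a, e) \<Rightarrow> a \<odot>\<^bsub>E\<^esub> e) \<in> carrier E" if "z \<in> set (terms x)" for z
    using t[of "fst z" "snd z"] that by (auto simp: E.smult_closed split: prod.split)
  have c2: "(case z of (a, e) \<Rightarrow> felem 1 E (diff W a) e) \<in> carrier (Om 1 E)" if "z \<in> set (terms x)" for z
    using t[of "fst z" "snd z"] that
    by (auto simp: elem_closed[OF E] diff_A split: prod.split)
  have "map (\<lambda>(a, e). f a e) (terms x) = map (\<lambda>z. g (case z of (a, e) \<Rightarrow> a \<odot>\<^bsub>E\<^esub> e)
      \<oplus>\<^bsub>N\<^esub> h (case z of (a, e) \<Rightarrow> felem 1 E (diff W a) e)) (terms x)"
    using t f by (intro map_cong) auto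
  then have "tensor_ext N f x = list_sum N (map (\<lambda>z. g (case z of (a, e) \<Rightarrow> a \<odot>\<^bsub>E\<^esub> e)) (terms x))
      \<oplus>\<^bsub>N\<^esub> list_sum N (map (\<lambda>z. h (case z of (a, e) \<Rightarrow> felem 1 E (diff W a) e)) (terms x))"
    unfolding tensor_ext_def
    by (simp only: list_sum_add[OF N additive_closed[OF g c1] additive_closed[OF h c2]])
  then show ?thesis
    unfolding jet1_proj_def jet1_deriv_def tensor_ext_def
    by (simp only: additive_list_sum_map[OF E.abelian_group_axioms N g c1]
        additive_list_sum_map[OF Om1.abelian_group_axioms N h c2])
qed

end

section \<open>Functoriality of 1-jets\<close>

context
  fixes E E' :: "('w, 'e) lmod" and f
  assumes E: "left_module A E" and E': "left_module A E'" and f: "f \<in> linear_maps A E E'"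
begin

interpretation E: left_module A E by (fact E)
interpretation E': left_module A E' by (fact E')
interpretation J: left_module A "J1 E'" by (rule jet1_module[OF E'])
interpretation O: left_module A "Om 1 E'" by (rule forms_module[OF E'])
interpretation OE: left_module A "Om 1 E" by (rule forms_module[OF E])

lemma jet1_map_closed: "x \<in> carrier (J1 E) \<Longrightarrow> jet1_map K A W E' f x \<in> carrier (J1 E')"
  unfolding jet1_map_def tensor_ext_def using jet1_terms[OF E]
  by (intro list_sum_closed J.abelian_group_axioms) (auto intro!: jet1_elem_closed E' linear_closed[OF f])

text \<open>Naturality of \<pi>, by comparing the sums term by term. Together with the analogous
  statement for D it says that J1 of f acts on the coordinates as f and \<open>forms_map\<close> of
  f; linearity, identities and composites follow from this through \<open>jet1_eqI\<close>.\<close>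

lemma jet1_map_proj:
  assumes x: "x \<in> carrier (J1 E)"
  shows "jet1_proj E' (jet1_map K A W E' f x) = f (jet1_proj E x)"
proof -
  note t = jet1_terms[OF E x]
  have "jet1_proj E' (jet1_map K A W E' f x)
      = list_sum E' (map (\<lambda>z. jet1_proj E' (case z of (a, e) \<Rightarrow> jelem E' a (f e))) (terms x))"
    unfolding jet1_map_def tensor_ext_def using t
    by (intro additive_list_sum_map[OF J.abelian_group_axioms E'.abelian_group_axioms jet1_proj_additive[OF E']])
      (auto intro!: jet1_elem_closed E' linear_closed[OF f])
  also have "\<dots> = list_sum E' (map (\<lambda>z. f (case z of (a, e) \<Rightarrow> a \<odot>\<^bsub>E\<^esub> e)) (terms x))"
    using t by (intro arg_cong[where f = "list_sum E'"] map_cong)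
      (auto simp: jet1_proj_elem[OF E'] linear_closed[OF f] linear_smult[OF f])
  also have "\<dots> = f (jet1_proj E x)"
    unfolding jet1_proj_def tensor_ext_def using t
    by (intro additive_list_sum_map[OF E.abelian_group_axioms E'.abelian_group_axioms linear_additive[OF f], symmetric])
      (auto simp: E.smult_closed)
  finally show ?thesis .
qed

lemma jet1_map_deriv:
  assumes x: "x \<in> carrier (J1 E)"
  shows "jet1_deriv E' (jet1_map K A W E' f x) = forms_map A W 1 E' f (jet1_deriv E x)"
proof -
  note t = jet1_terms[OF E x]
  have "jet1_deriv E' (jet1_map K A W E' f x)
      = list_sum (Om 1 E') (map (\<lambda>z. jet1_deriv E' (case z of (a, e) \<Rightarrow> jelem E' a (f e))) (terms x))"
    unfolding jet1_map_def tensor_ext_def using t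
    by (intro additive_list_sum_map[OF J.abelian_group_axioms O.abelian_group_axioms jet1_deriv_additive[OF E']])
      (auto intro!: jet1_elem_closed E' linear_closed[OF f])
  also have "\<dots> = list_sum (Om 1 E') (map (\<lambda>z. forms_map A W 1 E' f (case z of (a, e) \<Rightarrow> felem 1 E (diff W a) e)) (terms x))"
    using t by (intro arg_cong[where f = "list_sum (Om 1 E')"] map_cong)
      (auto simp: jet1_deriv_elem[OF E'] linear_closed[OF f] forms_map_elem[OF E E' f] diff_A)
  also have "\<dots> = forms_map A W 1 E' f (jet1_deriv E x)"
    unfolding jet1_deriv_def tensor_ext_def using t
    by (intro additive_list_sum_map[OF OE.abelian_group_axioms O.abelian_group_axioms
          forms_map_additive[OF E E' f], symmetric])
      (auto simp: elem_closed[OF E] diff_A)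
  finally show ?thesis .
qed

lemma jet1_map_linear: "jet1_map K A W E' f \<in> linear_maps A (J1 E) (J1 E')"
proof -
  interpret JE: left_module A "J1 E" by (rule jet1_module[OF E])
  note simps = jet1_map_closed jet1_map_proj jet1_map_deriv JE.smult_closed J.smult_closed
    additive_add[OF jet1_proj_additive] additive_add[OF jet1_deriv_additive]
    additive_closed[OF jet1_proj_additive] additive_closed[OF jet1_deriv_additive]
    jet1_proj_smult jet1_deriv_smult E E' linear_closed[OF f] linear_smult[OF f] additive_add[OF linear_additive[OF f]]
    additive_add[OF forms_map_additive[OF E E' f]] linear_smult[OF forms_map_linear[OF E E' f]]
    forms_map_elem[OF E E' f] elem_closed[OF E] OE.smult_closed diff_A
  show ?thesis
  proof (intro linear_mapsI additive_mapsI jet1_map_closed)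
    fix x y assume "x \<in> carrier (J1 E)" "y \<in> carrier (J1 E)"
    then show "jet1_map K A W E' f (x \<oplus>\<^bsub>J1 E\<^esub> y) = jet1_map K A W E' f x \<oplus>\<^bsub>J1 E'\<^esub> jet1_map K A W E' f y"
      by - (rule jet1_eqI[OF E']; simp add: simps)
  next
    fix a x assume "a \<in> carrier A" "x \<in> carrier (J1 E)"
    then show "jet1_map K A W E' f (a \<odot>\<^bsub>J1 E\<^esub> x) = a \<odot>\<^bsub>J1 E'\<^esub> jet1_map K A W E' f x"
      by - (rule jet1_eqI[OF E']; simp add: simps)
  qed
qed

end

lemma jet1_map_comp:
  assumes "left_module A E" "left_module A E'" "left_module A E''"
    "f \<in> linear_maps A E E'" "g \<in> linear_maps A E' E''" "x \<in> carrier (J1 E)"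
  shows "jet1_map K A W E'' g (jet1_map K A W E' f x) = jet1_map K A W E'' (\<lambda>x. g (f x)) x"
proof (rule jet1_eqI[OF assms(3)])
  note gf = linear_comp[OF assms(4,5)] and fx = jet1_map_closed[OF assms(1,2,4,6)]
  note dx = additive_closed[OF jet1_deriv_additive[OF assms(1)] assms(6)]
  show "jet1_map K A W E'' g (jet1_map K A W E' f x) \<in> carrier (J1 E'')"
    "jet1_map K A W E'' (\<lambda>x. g (f x)) x \<in> carrier (J1 E'')"
    using jet1_map_closed[OF assms(2,3,5) fx] jet1_map_closed[OF assms(1,3) gf assms(6)] by auto
  show "jet1_proj E'' (jet1_map K A W E'' g (jet1_map K A W E' f x))
      = jet1_proj E'' (jet1_map K A W E'' (\<lambda>x. g (f x)) x)"
    by (simp add: jet1_map_proj[OF assms(2,3,5) fx] jet1_map_proj[OF assms(1,2,4,6)]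
        jet1_map_proj[OF assms(1,3) gf assms(6)])
  show "jet1_deriv E'' (jet1_map K A W E'' g (jet1_map K A W E' f x))
      = jet1_deriv E'' (jet1_map K A W E'' (\<lambda>x. g (f x)) x)"
    by (simp only: jet1_map_deriv[OF assms(2,3,5) fx] jet1_map_deriv[OF assms(1,2,4,6)]
        jet1_map_deriv[OF assms(1,3) gf assms(6)] forms_map_comp[OF assms(1-5) dx])
qed

lemma jet1_map_id:
  assumes E: "left_module A E" and x: "x \<in> carrier (J1 E)"
  shows "jet1_map K A W E (\<lambda>x. x) x = x"
proof (rule jet1_eqI[OF E _ x])
  show "jet1_map K A W E (\<lambda>x. x) x \<in> carrier (J1 E)" by (rule jet1_map_closed[OF E E linear_id x])
  show "jet1_proj E (jet1_map K A W E (\<lambda>x. x) x) = jet1_proj E x"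
    by (rule jet1_map_proj[OF E E linear_id x])
  show "jet1_deriv E (jet1_map K A W E (\<lambda>x. x) x) = jet1_deriv E x"
    unfolding jet1_map_deriv[OF E E linear_id x]
    by (rule forms_map_id[OF E additive_closed[OF jet1_deriv_additive[OF E] x]])
qed

lemma jet1_map_cong:
  assumes "left_module A E" "x \<in> carrier (J1 E)" "\<And>x. x \<in> carrier E \<Longrightarrow> f x = g x"
  shows "jet1_map K A W E' f x = jet1_map K A W E' g x"
  unfolding jet1_map_def
  using jet1_terms[OF assms(1,2)] assms(3) by (intro tensor_ext_cong) auto

text \<open>The prolongation of x has coordinates x and 0, the second because d 1 = 0.\<close>

lemma jet1_prolong:
  assumes E: "left_module A E" and x: "x \<in> carrier E"
  shows "jet1_prolong K A W E x \<in> carrier (J1 E)"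
    and "jet1_proj E (jet1_prolong K A W E x) = x"
    and "jet1_deriv E (jet1_prolong K A W E x) = \<zero>\<^bsub>Om 1 E\<^esub>"
proof -
  interpret E: left_module A E by fact
  show "jet1_prolong K A W E x \<in> carrier (J1 E)"
    unfolding jet1_prolong_def by (rule jet1_elem_closed[OF E A.one_closed x])
  show "jet1_proj E (jet1_prolong K A W E x) = x"
    unfolding jet1_prolong_def by (simp add: jet1_proj_elem[OF E A.one_closed x] E.smult_one x)
  have "(\<lambda>\<omega>. felem 1 E \<omega> x) \<in> additive_maps (homogeneous 1) (Om 1 E)"
    using elem_balanced[OF E, of 1] x by (simp add: forms_balanced_def)
  from additive_zero[OF abelian_homogeneous forms_abelian[OF E] this]
  show "jet1_deriv E (jet1_prolong K A W E x) = \<zero>\<^bsub>Om 1 E\<^esub>"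
    unfolding jet1_prolong_def jet1_deriv_elem[OF E A.one_closed x] by (simp add: A_one diff_one)
qed

text \<open>Both sides have coordinates a x and da \<otimes> x. Consequently a linear map out of
  \<open>J1 E\<close> is determined by its values on prolongations.\<close>

lemma jet1_elem_prolong:
  assumes E: "left_module A E" and a: "a \<in> carrier A" and x: "x \<in> carrier E"
  shows "jelem E a x = a \<odot>\<^bsub>J1 E\<^esub> jet1_prolong K A W E x"
proof -
  interpret JE: left_module A "J1 E" by (rule jet1_module[OF E])
  interpret OE: left_module A "Om 1 E" by (rule forms_module[OF E])
  have "a \<odot>\<^bsub>Om 1 E\<^esub> \<zero>\<^bsub>Om 1 E\<^esub> = \<zero>\<^bsub>Om 1 E\<^esub>"
    by (rule additive_zero[OF OE.abelian_group_axioms OE.abelian_group_axioms forms_smult_additive[OF E a]])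
  then show ?thesis
    using a x jet1_prolong[OF E x]
    by - (rule jet1_eqI[OF E]; simp add: jet1_elem_closed[OF E] JE.smult_closed jet1_proj_elem[OF E]
        jet1_proj_smult[OF E] jet1_deriv_smult[OF E] jet1_deriv_elem[OF E] elem_closed[OF E] diff_A)
qed

section \<open>Spencer operators over a module of jets\<close>


text \<open>A function that agrees on elementary tensors with an additive map h is balanced, because
  the elementary tensors are. So giving h replaces a separate verification of
  \<open>forms_balanced\<close>.\<close>

lemma forms_ext_additive_map:
  assumes E: "left_module A E" and N: "abelian_group N" and h: "h \<in> additive_maps (Om p E) N"
    and f: "\<And>\<omega> e. \<lbrakk> \<omega> \<in> grade W p; e \<in> carrier E \<rbrakk> \<Longrightarrow> f \<omega> e = h (felem p E \<omega> e)"
    and t: "t \<in> carrier (Om p E)"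
  shows "tensor_ext N f t = h t"
proof -
  interpret E: left_module A E by (fact E)
  have "forms_balanced p E N f"
    by (rule forms_balancedI)
      (simp_all add: f E.smult_closed elem_closed[OF E] elem_add_left[OF E] elem_add_right[OF E] grade_add
        elem_balance[OF E] grade_mult[OF _ A_grade] additive_closed[OF h] additive_add[OF h])
  then show ?thesis
    by (intro forms_eqI[OF E N forms_ext_additive[OF E N] h _ t])
      (simp_all add: forms_ext_elem[OF E N] f)
qed

text \<open>The map \<alpha> \<otimes> x \<mapsto> \<alpha> \<and> u x for a linear u from Q to the
  m-forms with values in F. With Q the m-forms on P and u induced by \<pi>, it is the symbol to be
  found.\<close>

definition wedge_map ::
    "nat \<Rightarrow> ('w, 'e) lmod \<Rightarrow> (('w, 'e) univ \<Rightarrow> ('w, 'e) univ) \<Rightarrow> ('w, 'e) univ \<Rightarrow> ('w, 'e) univ" where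
  "wedge_map s F u = tensor_ext (Om s F) (\<lambda>\<alpha> x. left_wedge s F \<alpha> (u x))"

context
  fixes Q F :: "('w, 'e) lmod" and m s u
  assumes Q: "left_module A Q" and F: "left_module A F" and deg: "1 + m = s"
    and u: "u \<in> linear_maps A Q (Om m F)"
begin

lemma wedge_map_balanced: "forms_balanced 1 Q (Om s F) (\<lambda>\<alpha> x. left_wedge s F \<alpha> (u x))"
  by (rule forms_balancedI)
    (simp_all add: left_wedge_closed[OF F deg] linear_closed[OF u] additive_add[OF linear_additive[OF u]]
      additive_add[OF left_wedge_additive[OF F deg]] left_wedge_add[OF F deg] linear_smult[OF u]
      left_wedge_mult_right[OF F deg])

lemma wedge_map_additive: "wedge_map s F u \<in> additive_maps (Om 1 Q) (Om s F)"
  unfolding wedge_map_def by (intro forms_ext_additive Q forms_abelian F wedge_map_balanced)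

lemma wedge_map_elem:
  "\<alpha> \<in> grade W 1 \<Longrightarrow> x \<in> carrier Q \<Longrightarrow> wedge_map s F u (felem 1 Q \<alpha> x) = left_wedge s F \<alpha> (u x)"
  unfolding wedge_map_def by (intro forms_ext_elem Q forms_abelian F wedge_map_balanced)

lemma wedge_map_smult:
  assumes a: "a \<in> carrier A" and t: "t \<in> carrier (Om 1 Q)"
  shows "wedge_map s F u (a \<odot>\<^bsub>Om 1 Q\<^esub> t) = a \<odot>\<^bsub>Om s F\<^esub> wedge_map s F u t"
proof (rule forms_eqI[OF Q forms_abelian[OF F]
      additive_comp[OF forms_smult_additive[OF Q a] wedge_map_additive]
      additive_comp[OF wedge_map_additive forms_smult_additive[OF F a]] _ t])
  fix \<alpha> x assume \<alpha>: "\<alpha> \<in> grade W 1" and x: "x \<in> carrier Q"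
  have "a \<otimes>\<^bsub>W\<^esub> \<alpha> \<in> grade W 1" using grade_mult[OF A_grade[OF a] \<alpha>] by simp
  then show "wedge_map s F u (a \<odot>\<^bsub>Om 1 Q\<^esub> felem 1 Q \<alpha> x) = a \<odot>\<^bsub>Om s F\<^esub> wedge_map s F u (felem 1 Q \<alpha> x)"
    by (simp add: elem_smult[OF Q a \<alpha> x] wedge_map_elem \<alpha> x left_wedge_mult_left[OF F deg \<alpha> a]
        linear_closed[OF u])
qed

end

text \<open>The sign of the graded Leibniz rule as an element of \<open>W\<close>. Being 1 or -1, it
  preserves degrees and commutes with all forms.\<close>

definition sign :: "nat \<Rightarrow> 'w" where
  "sign p = (\<ominus>\<^bsub>W\<^esub> \<one>\<^bsub>W\<^esub>) [^]\<^bsub>W\<^esub> p"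

lemma sign_cases: "sign p = \<one>\<^bsub>W\<^esub> \<or> sign p = \<ominus>\<^bsub>W\<^esub> \<one>\<^bsub>W\<^esub>"
  unfolding sign_def by (induction p) (auto simp: l_minus)

lemma sign_grade: "\<omega> \<in> grade W p \<Longrightarrow> sign q \<otimes>\<^bsub>W\<^esub> \<omega> \<in> grade W p"
  using sign_cases[of q] grade_carrier[of \<omega> p] by (auto simp: l_minus grade_uminus)

lemma sign_mult: "x \<in> carrier W \<Longrightarrow> y \<in> carrier W \<Longrightarrow> sign q \<otimes>\<^bsub>W\<^esub> (x \<otimes>\<^bsub>W\<^esub> y) = x \<otimes>\<^bsub>W\<^esub> (sign q \<otimes>\<^bsub>W\<^esub> y)"
  using sign_cases[of q] by (auto simp: l_minus r_minus)

lemma sign_add: "x \<in> carrier W \<Longrightarrow> y \<in> carrier W \<Longrightarrow> sign q \<otimes>\<^bsub>W\<^esub> (x \<oplus>\<^bsub>W\<^esub> y) = sign q \<otimes>\<^bsub>W\<^esub> x \<oplus>\<^bsub>W\<^esub> sign q \<otimes>\<^bsub>W\<^esub> y"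
  using sign_cases[of q] by (auto simp: r_distr)

text \<open>The sign is attached to x, so that the second term is left multiplication by one form
  and fits \<open>left_wedge\<close>.\<close>

lemma diff_mult:
  assumes "x \<in> grade W p" "y \<in> grade W q"
  shows "diff W (x \<otimes>\<^bsub>W\<^esub> y) = diff W x \<otimes>\<^bsub>W\<^esub> y \<oplus>\<^bsub>W\<^esub> (sign p \<otimes>\<^bsub>W\<^esub> x) \<otimes>\<^bsub>W\<^esub> diff W y"
proof -
  have "sign p \<in> carrier W" using sign_cases[of p] by auto
  then show ?thesis
    using leibniz[OF assms(1) grade_carrier[OF assms(2)]] grade_carrier[OF assms(1)] diff_closed[OF assms(2)]
    by (simp add: sign_def m_assoc)
qed

text \<open>The value of the Spencer operator at \<open>\<omega> \<otimes> \<xi>\<close>, with the Leibniz rule applied to \<open>d(\<omega> y\<^sub>j)\<close>.\<close>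

definition spencer_term :: "nat \<Rightarrow> nat \<Rightarrow> ('w, 'e) lmod \<Rightarrow> 'w \<Rightarrow> ('w, 'e) univ \<Rightarrow> ('w, 'e) univ" where
  "spencer_term s m F \<omega> \<xi> = felem s F (diff W \<omega>) (jet1_proj F \<xi>)
     \<oplus>\<^bsub>Om s F\<^esub> left_wedge s F (sign m \<otimes>\<^bsub>W\<^esub> \<omega>) (jet1_deriv F \<xi>)"

text \<open>The source P does not occur: \<open>tensor_ext\<close> reads only formal sums, and the
  lemmas below supply P as a module included in \<open>J1 F\<close>.\<close>

definition spencer_op :: "nat \<Rightarrow> nat \<Rightarrow> ('w, 'e) lmod \<Rightarrow> ('w, 'e) univ \<Rightarrow> ('w, 'e) univ" where
  "spencer_op s m F = tensor_ext (Om s F) (spencer_term s m F)"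

text \<open>\<open>jet1_ext\<close> applies with g = d\<omega> \<otimes> - and h = (-1)^m \<omega>
  \<and> -. The graded Leibniz rule splits d(\<omega> y) into exactly these two parts, so the sum
  over the representative depends on \<xi> alone.\<close>

lemma spencer_term_eq:
  assumes F: "left_module A F" and deg: "m + 1 = s" and \<omega>: "\<omega> \<in> grade W m" and \<xi>: "\<xi> \<in> carrier (J1 F)"
  shows "tensor_ext (Om s F) (\<lambda>y \<eta>. felem s F (diff W (\<omega> \<otimes>\<^bsub>W\<^esub> y)) \<eta>) \<xi> = spencer_term s m F \<omega> \<xi>"
proof -
  interpret F: left_module A F by (fact F)
  have d: "diff W \<omega> \<in> grade W s" using diff_grade[OF \<omega>, unfolded Suc_eq_plus1] deg by simp
  have "(\<lambda>e. felem s F (diff W \<omega>) e) \<in> additive_maps F (Om s F)"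
    using elem_balanced[OF F, of s] d by (simp add: forms_balanced_def)
  then show ?thesis
    unfolding spencer_term_def
  proof (rule jet1_ext[OF F forms_abelian[OF F] _ left_wedge_additive[OF F deg sign_grade[OF \<omega>]] _ \<xi>])
    fix y \<eta> assume y: "y \<in> carrier A" and \<eta>: "\<eta> \<in> carrier F"
    have "diff W \<omega> \<otimes>\<^bsub>W\<^esub> y \<in> grade W s" using grade_mult[OF d A_grade[OF y]] by simp
    then show "felem s F (diff W (\<omega> \<otimes>\<^bsub>W\<^esub> y)) \<eta> = felem s F (diff W \<omega>) (y \<odot>\<^bsub>F\<^esub> \<eta>)
        \<oplus>\<^bsub>Om s F\<^esub> left_wedge s F (sign m \<otimes>\<^bsub>W\<^esub> \<omega>) (felem 1 F (diff W y) \<eta>)"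
      using y \<eta>
      by (simp add: diff_mult[OF \<omega> A_grade] left_wedge_elem[OF F deg] sign_grade[OF \<omega>] diff_A
          elem_add_left[OF F] elem_balance[OF F d] grade_mult[OF _ _ deg])
  qed
qed

lemma sub_proj_linear:
  assumes "left_module A F" "(\<lambda>x. x) \<in> linear_maps A P (J1 F)"
  shows "jet1_proj F \<in> linear_maps A P F"
  using linear_comp[OF assms(2) jet1_proj_linear[OF assms(1)]] .

context
  fixes P F :: "('w, 'e) lmod" and m s :: nat
  assumes P: "left_module A P" and F: "left_module A F" and incl: "(\<lambda>x. x) \<in> linear_maps A P (J1 F)"
    and deg: "m + 1 = s"
begin

interpretation P: left_module A P by (fact P)
interpretation F: left_module A F by (fact F)
interpretation JF: left_module A "J1 F" by (rule jet1_module[OF F])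
interpretation Os: left_module A "Om s F" by (rule forms_module[OF F])
interpretation O1: left_module A "Om 1 F" by (rule forms_module[OF F])

lemmas proj_linear = sub_proj_linear[OF F incl]

lemma sub_deriv_additive: "jet1_deriv F \<in> additive_maps P (Om 1 F)"
  using additive_comp[OF linear_additive[OF incl] jet1_deriv_additive[OF F]] .

lemma sub_deriv_smult:
  "a \<in> carrier A \<Longrightarrow> x \<in> carrier P \<Longrightarrow> jet1_deriv F (a \<odot>\<^bsub>P\<^esub> x)
    = felem 1 F (diff W a) (jet1_proj F x) \<oplus>\<^bsub>Om 1 F\<^esub> a \<odot>\<^bsub>Om 1 F\<^esub> jet1_deriv F x"
  using linear_smult[OF incl] linear_closed[OF incl] jet1_deriv_smult[OF F] by simp

lemma diff_grade_deg: "\<omega> \<in> grade W m \<Longrightarrow> diff W \<omega> \<in> grade W s"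
  using diff_grade[of \<omega> m, unfolded Suc_eq_plus1] deg by simp

lemma spencer_term_closed:
  "\<omega> \<in> grade W m \<Longrightarrow> \<xi> \<in> carrier P \<Longrightarrow> spencer_term s m F \<omega> \<xi> \<in> carrier (Om s F)"
  by (simp add: spencer_term_def elem_closed[OF F] diff_grade_deg left_wedge_closed[OF F deg] sign_grade
      linear_closed[OF proj_linear] additive_closed[OF sub_deriv_additive])

text \<open>Replacing \<omega> by \<omega> a adds (-1)^m \<omega> \<and> da \<otimes> \<pi> \<xi>
  through d(\<omega> a), and replacing \<xi> by a \<xi> adds the same term through D (a
  \<xi>).\<close>

lemma spencer_term_balanced: "forms_balanced m P (Om s F) (spencer_term s m F)"
proof (rule forms_balancedI)
  note simps = diff_grade_deg sign_grade linear_closed[OF proj_linear] linear_smult[OF proj_linear]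
    additive_closed[OF sub_deriv_additive] additive_add[OF sub_deriv_additive]
    additive_add[OF linear_additive[OF proj_linear]]
    elem_closed[OF F] elem_add_left[OF F] elem_add_right[OF F]
    left_wedge_closed[OF F deg] left_wedge_add[OF F deg] additive_add[OF left_wedge_additive[OF F deg]]
  show "spencer_term s m F \<omega> e \<in> carrier (Om s F)" if "\<omega> \<in> grade W m" "e \<in> carrier P" for \<omega> e
    using that by (rule spencer_term_closed)
  show "spencer_term s m F \<omega> (e \<oplus>\<^bsub>P\<^esub> e') = spencer_term s m F \<omega> e \<oplus>\<^bsub>Om s F\<^esub> spencer_term s m F \<omega> e'"
    if "\<omega> \<in> grade W m" "e \<in> carrier P" "e' \<in> carrier P" for \<omega> e e'
    using that by (simp add: spencer_term_def simps Os.add.m_ac)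
  show "spencer_term s m F (\<omega> \<oplus>\<^bsub>W\<^esub> \<omega>') e = spencer_term s m F \<omega> e \<oplus>\<^bsub>Om s F\<^esub> spencer_term s m F \<omega>' e"
    if "\<omega> \<in> grade W m" "\<omega>' \<in> grade W m" "e \<in> carrier P" for \<omega> \<omega>' e
    using that
    by (simp add: spencer_term_def simps diff_add sign_add grade_carrier[of _ m] Os.add.m_ac)
  fix \<omega> a e assume \<omega>: "\<omega> \<in> grade W m" and a: "a \<in> carrier A" and e: "e \<in> carrier P"
  have s: "sign m \<otimes>\<^bsub>W\<^esub> (\<omega> \<otimes>\<^bsub>W\<^esub> a) = (sign m \<otimes>\<^bsub>W\<^esub> \<omega>) \<otimes>\<^bsub>W\<^esub> a"
    using sign_cases[of m] \<omega> a by (auto simp: m_assoc grade_carrier[of _ m] A_in_W)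
  have 1: "diff W \<omega> \<otimes>\<^bsub>W\<^esub> a \<in> grade W s" using grade_mult[OF diff_grade_deg[OF \<omega>] A_grade[OF a]] by simp
  have 2: "(sign m \<otimes>\<^bsub>W\<^esub> \<omega>) \<otimes>\<^bsub>W\<^esub> diff W a \<in> grade W s"
    using grade_mult[OF sign_grade[OF \<omega>] diff_A[OF a] deg] .
  show "spencer_term s m F (\<omega> \<otimes>\<^bsub>W\<^esub> a) e = spencer_term s m F \<omega> (a \<odot>\<^bsub>P\<^esub> e)"
    using \<omega> a e
    by (simp add: spencer_term_def simps s diff_mult[OF \<omega> A_grade[OF a]] 1 2 elem_balance[OF F diff_grade_deg]
        left_wedge_mult_right[OF F deg] sub_deriv_smult left_wedge_elem[OF F deg] O1.smult_closed diff_A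
        F.smult_closed Os.a_assoc)
qed

lemma spencer_op_additive: "spencer_op s m F \<in> additive_maps (Om m P) (Om s F)"
  unfolding spencer_op_def by (intro forms_ext_additive P forms_abelian F spencer_term_balanced)

lemma spencer_op_elem:
  "\<omega> \<in> grade W m \<Longrightarrow> \<xi> \<in> carrier P \<Longrightarrow> spencer_op s m F (felem m P \<omega> \<xi>) = spencer_term s m F \<omega> \<xi>"
  unfolding spencer_op_def by (intro forms_ext_elem P forms_abelian F spencer_term_balanced)

text \<open>On \<omega> \<otimes> \<xi> the failure of linearity is the term da \<and> \<omega> of
  d(a \<omega>); in the other summand a moves past the sign to the front.\<close>

lemma spencer_op_smult:
  assumes a: "a \<in> carrier A" and t: "t \<in> carrier (Om m P)"
  shows "spencer_op s m F (a \<odot>\<^bsub>Om m P\<^esub> t)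
    = left_wedge s F (diff W a) (forms_map A W m F (jet1_proj F) t) \<oplus>\<^bsub>Om s F\<^esub> a \<odot>\<^bsub>Om s F\<^esub> spencer_op s m F t"
proof (rule forms_eqI[OF P forms_abelian[OF F]
      additive_comp[OF forms_smult_additive[OF P a] spencer_op_additive] _ _ t])
  have deg': "1 + m = s" using deg by simp
  show "(\<lambda>t. left_wedge s F (diff W a) (forms_map A W m F (jet1_proj F) t)
      \<oplus>\<^bsub>Om s F\<^esub> a \<odot>\<^bsub>Om s F\<^esub> spencer_op s m F t) \<in> additive_maps (Om m P) (Om s F)"
    by (intro additive_plus forms_abelian F additive_comp[OF forms_map_additive[OF P F proj_linear]
          left_wedge_additive[OF F deg' diff_A[OF a]]]
        additive_comp[OF spencer_op_additive forms_smult_additive[OF F a]])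
  fix \<omega> \<xi> assume \<omega>: "\<omega> \<in> grade W m" and \<xi>: "\<xi> \<in> carrier P"
  note d = diff_grade_deg[OF \<omega>] and \<xi>' = linear_closed[OF proj_linear \<xi>]
  have 1: "a \<otimes>\<^bsub>W\<^esub> \<omega> \<in> grade W m" using grade_mult[OF A_grade[OF a] \<omega>] by simp
  have 2: "a \<otimes>\<^bsub>W\<^esub> diff W \<omega> \<in> grade W s" using grade_mult[OF A_grade[OF a] d] by simp
  have 3: "diff W a \<otimes>\<^bsub>W\<^esub> \<omega> \<in> grade W s" using grade_mult[OF diff_A[OF a] \<omega> deg'] .
  show "spencer_op s m F (a \<odot>\<^bsub>Om m P\<^esub> felem m P \<omega> \<xi>)
      = left_wedge s F (diff W a) (forms_map A W m F (jet1_proj F) (felem m P \<omega> \<xi>))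
      \<oplus>\<^bsub>Om s F\<^esub> a \<odot>\<^bsub>Om s F\<^esub> spencer_op s m F (felem m P \<omega> \<xi>)"
    using additive_closed[OF sub_deriv_additive \<xi>]
    by (simp add: elem_smult[OF P a \<omega> \<xi>] spencer_op_elem[OF 1 \<xi>] spencer_op_elem[OF \<omega> \<xi>] spencer_term_def
        diff_A_mult[OF a \<omega>] sign_mult A_in_W[OF a] grade_carrier[OF \<omega>] elem_add_left[OF F 3 2 \<xi>']
        forms_map_elem[OF P F proj_linear \<omega> \<xi>] left_wedge_elem[OF F deg' diff_A[OF a] \<omega> \<xi>']
        left_wedge_mult_left[OF F deg sign_grade[OF \<omega>] a] elem_smult[OF F a d \<xi>'] Os.smult_r_distr a
        elem_closed[OF F d \<xi>'] elem_closed[OF F 2 \<xi>'] elem_closed[OF F 3 \<xi>'] Os.smult_closed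
        left_wedge_closed[OF F deg sign_grade[OF \<omega>]] Os.a_assoc)
qed

end

text \<open>Since g agrees with J1 of f on P, it acts on the coordinates \<pi> and D through f, and
  the two terms of \<open>spencer_term\<close> are natural in them.\<close>

lemma spencer_op_natural:
  assumes P: "left_module A P" and F: "left_module A F" and incl: "(\<lambda>x. x) \<in> linear_maps A P (J1 F)"
    and P': "left_module A P'" and F': "left_module A F'" and incl': "(\<lambda>x. x) \<in> linear_maps A P' (J1 F')"
    and deg: "m + 1 = s"
    and f: "f \<in> linear_maps A F F'" and g: "g \<in> linear_maps A P P'"
    and gf: "\<And>x. x \<in> carrier P \<Longrightarrow> g x = jet1_map K A W F' f x" and t: "t \<in> carrier (Om m P)"
  shows "forms_map A W s F' f (spencer_op s m F t) = spencer_op s m F' (forms_map A W m P' g t)"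
proof (rule forms_eqI[OF P forms_abelian[OF F']
      additive_comp[OF spencer_op_additive[OF P F incl deg] forms_map_additive[OF F F' f]]
      additive_comp[OF forms_map_additive[OF P P' g] spencer_op_additive[OF P' F' incl' deg]] _ t])
  fix \<omega> \<xi> assume \<omega>: "\<omega> \<in> grade W m" and \<xi>: "\<xi> \<in> carrier P"
  have d: "diff W \<omega> \<in> grade W s" using diff_grade[OF \<omega>, unfolded Suc_eq_plus1] deg by simp
  have \<xi>J: "\<xi> \<in> carrier (J1 F)" using linear_closed[OF incl \<xi>] .
  have p: "jet1_proj F' (g \<xi>) = f (jet1_proj F \<xi>)" using jet1_map_proj[OF F F' f \<xi>J] gf[OF \<xi>] by simp
  have e: "jet1_deriv F' (g \<xi>) = forms_map A W 1 F' f (jet1_deriv F \<xi>)"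
    using jet1_map_deriv[OF F F' f \<xi>J] gf[OF \<xi>] by simp
  show "forms_map A W s F' f (spencer_op s m F (felem m P \<omega> \<xi>))
      = spencer_op s m F' (forms_map A W m P' g (felem m P \<omega> \<xi>))"
    using additive_closed[OF jet1_deriv_additive[OF F] \<xi>J] additive_closed[OF jet1_proj_additive[OF F] \<xi>J]
    by (simp add: spencer_op_elem[OF P F incl deg \<omega> \<xi>] forms_map_elem[OF P P' g \<omega> \<xi>]
        spencer_op_elem[OF P' F' incl' deg \<omega>] linear_closed[OF g \<xi>] spencer_term_def p e
        additive_add[OF forms_map_additive[OF F F' f]] elem_closed[OF F d]
        left_wedge_closed[OF F deg sign_grade[OF \<omega>]] forms_map_elem[OF F F' f d]
        left_wedge_natural[OF F F' f deg sign_grade[OF \<omega>]])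
qed

section \<open>Holonomy\<close>

context
  fixes F :: "('w, 'e) lmod"
  assumes F: "left_module A F"
begin

interpretation F: left_module A F by (fact F)
interpretation JF: left_module A "J1 F" by (rule jet1_module[OF F])
interpretation JJF: left_module A "J1 (J1 F)" by (rule jet1_module[OF jet1_module[OF F]])
interpretation O1: left_module A "Om 1 F" by (rule forms_module[OF F])
interpretation O2: left_module A "Om 2 F" by (rule forms_module[OF F])

text \<open>For y = [a \<otimes> \<xi>] the first term is D (a \<xi>) = da \<otimes> \<pi> \<xi> + a
  D \<xi> and the second is da \<otimes> \<pi> \<xi>. What remains is a D \<xi>, the sum of the a dc
  \<otimes> e.\<close>

lemma form1_eq:
  assumes y: "y \<in> carrier (J1 (J1 F))"
  shows "jet1_jet1_form1 A W F y = jet1_deriv F (jet1_proj (J1 F) y)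
    \<ominus>\<^bsub>Om 1 F\<^esub> forms_map A W 1 F (jet1_proj F) (jet1_deriv (J1 F) y)"
  unfolding jet1_jet1_form1_def a_minus_def
proof (rule jet1_ext[OF JF.left_module_axioms O1.abelian_group_axioms jet1_deriv_additive[OF F]
      additive_uminus[OF O1.abelian_group_axioms forms_map_additive[OF JF.left_module_axioms F jet1_proj_linear[OF F]]] _ y])
  fix a \<xi> assume a: "a \<in> carrier A" and \<xi>: "\<xi> \<in> carrier (J1 F)"
  note dx = additive_closed[OF jet1_deriv_additive[OF F] \<xi>] and px = linear_closed[OF jet1_proj_linear[OF F] \<xi>]
  have g: "a \<otimes>\<^bsub>W\<^esub> diff W c \<in> grade W 1" if "c \<in> carrier A" for c
    using grade_mult[OF A_grade[OF a] diff_A[OF that]] by simp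
  have "tensor_ext (Om 1 F) (\<lambda>c e. felem 1 F (a \<otimes>\<^bsub>W\<^esub> diff W c) e) \<xi>
      = \<zero>\<^bsub>Om 1 F\<^esub> \<oplus>\<^bsub>Om 1 F\<^esub> a \<odot>\<^bsub>Om 1 F\<^esub> jet1_deriv F \<xi>"
    using a by (intro jet1_ext[OF F O1.abelian_group_axioms additive_zero_map[OF O1.abelian_group_axioms]
          forms_smult_additive[OF F a] _ \<xi>])
      (simp_all add: elem_smult[OF F] diff_A elem_closed[OF F] g)
  also have "\<dots> = a \<odot>\<^bsub>Om 1 F\<^esub> jet1_deriv F \<xi>" using a dx by (simp add: O1.smult_closed)
  also have "\<dots> = jet1_deriv F (a \<odot>\<^bsub>J1 F\<^esub> \<xi>)
      \<oplus>\<^bsub>Om 1 F\<^esub> \<ominus>\<^bsub>Om 1 F\<^esub> forms_map A W 1 F (jet1_proj F) (felem 1 (J1 F) (diff W a) \<xi>)"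
    using a dx px
    by (simp add: jet1_deriv_smult[OF F a \<xi>] forms_map_elem[OF JF.left_module_axioms F jet1_proj_linear[OF F] diff_A[OF a] \<xi>]
        O1.smult_closed elem_closed[OF F] diff_A O1.a_comm[of "felem 1 F (diff W a) (jet1_proj F \<xi>)"]
        O1.a_assoc O1.r_neg)
  finally show "tensor_ext (Om 1 F) (\<lambda>c e. felem 1 F (a \<otimes>\<^bsub>W\<^esub> diff W c) e) \<xi> = \<dots>" .
qed

text \<open>The first term of the Spencer operator vanishes because d d a = 0, and the sign of the
  second is (-1)^1.\<close>

lemma spencer_op_exact:
  assumes a: "a \<in> carrier A" and \<xi>: "\<xi> \<in> carrier (J1 F)"
  shows "spencer_op 2 1 F (felem 1 (J1 F) (diff W a) \<xi>) = \<ominus>\<^bsub>Om 2 F\<^esub> left_wedge 2 F (diff W a) (jet1_deriv F \<xi>)"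
proof -
  have deg: "(1::nat) + 1 = 2" by simp
  note dx = additive_closed[OF jet1_deriv_additive[OF F] \<xi>] and px = linear_closed[OF jet1_proj_linear[OF F] \<xi>]
  note da = diff_A[OF a]
  have lw: "left_wedge 2 F (diff W a) (jet1_deriv F \<xi>) \<in> carrier (Om 2 F)"
    using left_wedge_closed[OF F deg da dx] .
  have "felem 2 F \<zero>\<^bsub>W\<^esub> (jet1_proj F \<xi>) = \<zero>\<^bsub>Om 2 F\<^esub>"
    using additive_zero[OF abelian_homogeneous[of 2] O2.abelian_group_axioms, of "\<lambda>\<omega>. felem 2 F \<omega> (jet1_proj F \<xi>)"]
      elem_balanced[OF F, of 2] px by (simp add: forms_balanced_def)
  moreover have "diff W (diff W a) = \<zero>\<^bsub>W\<^esub>" using diff_diff[OF A_in_W[OF a]] .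
  moreover have "sign 1 \<otimes>\<^bsub>W\<^esub> diff W a = \<ominus>\<^bsub>W\<^esub> diff W a"
    using grade_carrier[OF da] by (simp add: sign_def l_minus)
  moreover have "left_wedge 2 F (\<ominus>\<^bsub>W\<^esub> diff W a) (jet1_deriv F \<xi>)
      = \<ominus>\<^bsub>Om 2 F\<^esub> left_wedge 2 F (diff W a) (jet1_deriv F \<xi>)"
  proof -
    let ?l = "\<lambda>\<omega>. left_wedge 2 F \<omega> (jet1_deriv F \<xi>)"
    have l: "?l \<in> additive_maps (homogeneous 1) (Om 2 F)"
      by (rule additive_mapsI)
        (simp_all add: left_wedge_closed[OF F deg _ dx] left_wedge_add[OF F deg _ _ dx])
    have "?l (\<ominus>\<^bsub>homogeneous 1\<^esub> diff W a) = \<ominus>\<^bsub>Om 2 F\<^esub> ?l (diff W a)"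
      by (rule additive_a_inv[OF abelian_homogeneous O2.abelian_group_axioms l]) (simp add: da)
    \<comment> \<open>Negation is a definite description over the carrier, so negation in the
      homogeneous part and in \<open>W\<close> are different terms; uniqueness of inverses
      identifies their values.\<close>
    moreover have "\<ominus>\<^bsub>homogeneous 1\<^esub> diff W a = \<ominus>\<^bsub>W\<^esub> diff W a"
      using abelian_group.minus_equality[OF abelian_homogeneous[of 1], of "\<ominus>\<^bsub>W\<^esub> diff W a" "diff W a"]
        da grade_uminus grade_carrier[OF da] by (simp add: l_neg)
    ultimately show ?thesis by simp
  qed
  ultimately show ?thesis
    using lw by (simp add: spencer_op_elem[OF JF.left_module_axioms F linear_id deg da \<xi>] spencer_term_def)
qed

text \<open>D sends [a \<otimes> \<xi>] to da \<otimes> \<xi>, on which the Spencer operator is - da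
  \<and> D \<xi> by \<open>spencer_op_exact\<close>; up to sign this is the sum of the da \<and> dc
  \<otimes> e.\<close>

lemma form2_eq:
  assumes y: "y \<in> carrier (J1 (J1 F))"
  shows "jet1_jet1_form2 A W F y = \<ominus>\<^bsub>Om 2 F\<^esub> spencer_op 2 1 F (jet1_deriv (J1 F) y)"
proof -
  have deg: "(1::nat) + 1 = 2" by simp
  note sp = spencer_op_additive[OF JF.left_module_axioms F linear_id deg]
  have "jet1_jet1_form2 A W F y = \<zero>\<^bsub>Om 2 F\<^esub> \<oplus>\<^bsub>Om 2 F\<^esub> \<ominus>\<^bsub>Om 2 F\<^esub> spencer_op 2 1 F (jet1_deriv (J1 F) y)"
    unfolding jet1_jet1_form2_def
  proof (rule jet1_ext[OF JF.left_module_axioms O2.abelian_group_axioms additive_zero_map[OF O2.abelian_group_axioms]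
        additive_uminus[OF O2.abelian_group_axioms sp] _ y])
    fix a \<xi> assume a: "a \<in> carrier A" and \<xi>: "\<xi> \<in> carrier (J1 F)"
    note dx = additive_closed[OF jet1_deriv_additive[OF F] \<xi>] and px = linear_closed[OF jet1_proj_linear[OF F] \<xi>]
    note da = diff_A[OF a]
    have lw: "left_wedge 2 F (diff W a) (jet1_deriv F \<xi>) \<in> carrier (Om 2 F)"
      using left_wedge_closed[OF F deg da dx] .
    have "tensor_ext (Om 2 F) (\<lambda>c e. felem 2 F (diff W a \<otimes>\<^bsub>W\<^esub> diff W c) e) \<xi>
        = \<zero>\<^bsub>Om 2 F\<^esub> \<oplus>\<^bsub>Om 2 F\<^esub> left_wedge 2 F (diff W a) (jet1_deriv F \<xi>)"
      by (intro jet1_ext[OF F O2.abelian_group_axioms additive_zero_map[OF O2.abelian_group_axioms]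
            left_wedge_additive[OF F deg da] _ \<xi>])
        (simp_all add: left_wedge_elem[OF F deg da] diff_A elem_closed[OF F] grade_mult[OF da _ deg])
    moreover note spencer_op_exact[OF a \<xi>]
    ultimately show "tensor_ext (Om 2 F) (\<lambda>c e. felem 2 F (diff W a \<otimes>\<^bsub>W\<^esub> diff W c) e) \<xi>
        = \<zero>\<^bsub>Om 2 F\<^esub> \<oplus>\<^bsub>Om 2 F\<^esub> \<ominus>\<^bsub>Om 2 F\<^esub> spencer_op 2 1 F (felem 1 (J1 F) (diff W a) \<xi>)"
      using lw by simp
  qed
  then show ?thesis
    using additive_closed[OF sp additive_closed[OF jet1_deriv_additive[OF JF.left_module_axioms] y]] by simp
qed

lemma form1_additive: "jet1_jet1_form1 A W F \<in> additive_maps (J1 (J1 F)) (Om 1 F)"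
proof -
  have "(\<lambda>y. jet1_deriv F (jet1_proj (J1 F) y)
      \<ominus>\<^bsub>Om 1 F\<^esub> forms_map A W 1 F (jet1_proj F) (jet1_deriv (J1 F) y)) \<in> additive_maps (J1 (J1 F)) (Om 1 F)"
    by (intro additive_diff O1.abelian_group_axioms
        additive_comp[OF jet1_proj_additive[OF JF.left_module_axioms] jet1_deriv_additive[OF F]]
        additive_comp[OF jet1_deriv_additive[OF JF.left_module_axioms]
          forms_map_additive[OF JF.left_module_axioms F jet1_proj_linear[OF F]]])
  then show ?thesis by (simp add: additive_maps_def form1_eq Pi_def)
qed

lemma form2_additive: "jet1_jet1_form2 A W F \<in> additive_maps (J1 (J1 F)) (Om 2 F)"
proof -
  have "(\<lambda>y. \<ominus>\<^bsub>Om 2 F\<^esub> spencer_op 2 1 F (jet1_deriv (J1 F) y)) \<in> additive_maps (J1 (J1 F)) (Om 2 F)"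
    by (intro additive_uminus O2.abelian_group_axioms
        additive_comp[OF jet1_deriv_additive[OF JF.left_module_axioms]
          spencer_op_additive[OF JF.left_module_axioms F linear_id]]) simp
  then show ?thesis by (simp add: additive_maps_def form2_eq Pi_def)
qed

text \<open>Both terms of \<open>form1_eq\<close> acquire the summand da \<otimes> \<pi> (\<pi> y)
  when y is multiplied by a, and these cancel.\<close>

lemma form1_smult:
  assumes a: "a \<in> carrier A" and y: "y \<in> carrier (J1 (J1 F))"
  shows "jet1_jet1_form1 A W F (a \<odot>\<^bsub>J1 (J1 F)\<^esub> y) = a \<odot>\<^bsub>Om 1 F\<^esub> jet1_jet1_form1 A W F y"
proof -
  note J = JF.left_module_axioms
  note pl = forms_map_linear[OF J F jet1_proj_linear[OF F], of 1]
  note py = linear_closed[OF jet1_proj_linear[OF J] y] and dy = additive_closed[OF jet1_deriv_additive[OF J] y]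
  note ppy = linear_closed[OF jet1_proj_linear[OF F] py] and dpy = additive_closed[OF jet1_deriv_additive[OF F] py]
    and pdy = linear_closed[OF pl dy]
  interpret OJ: left_module A "Om 1 (J1 F)" by (rule forms_module[OF J])
  have "a \<odot>\<^bsub>Om 1 F\<^esub> (\<ominus>\<^bsub>Om 1 F\<^esub> x) = \<ominus>\<^bsub>Om 1 F\<^esub> (a \<odot>\<^bsub>Om 1 F\<^esub> x)" if "x \<in> carrier (Om 1 F)" for x
    using additive_a_inv[OF O1.abelian_group_axioms O1.abelian_group_axioms forms_smult_additive[OF F a] that] .
  moreover have "x \<oplus>\<^bsub>Om 1 F\<^esub> (z \<oplus>\<^bsub>Om 1 F\<^esub> (\<ominus>\<^bsub>Om 1 F\<^esub> x \<oplus>\<^bsub>Om 1 F\<^esub> w)) = z \<oplus>\<^bsub>Om 1 F\<^esub> w"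
    if "x \<in> carrier (Om 1 F)" "z \<in> carrier (Om 1 F)" "w \<in> carrier (Om 1 F)" for x z w
    using that by (simp add: O1.a_lcomm[of x z] O1.r_neg2)
  ultimately show ?thesis
    using a y py dy ppy dpy pdy
    by (simp add: form1_eq JJF.smult_closed jet1_proj_smult[OF J] jet1_deriv_smult[OF J] jet1_deriv_smult[OF F]
        additive_add[OF linear_additive[OF pl]] elem_closed[OF J] diff_A OJ.smult_closed linear_smult[OF pl]
        forms_map_elem[OF J F jet1_proj_linear[OF F]] O1.minus_eq O1.minus_add O1.smult_r_distr
        O1.smult_closed elem_closed[OF F] O1.a_assoc)
qed

text \<open>Write D (a y) = da \<otimes> \<pi> y + a D y. The Spencer operator gives - da \<and> D
  (\<pi> y) on the first summand and the extra term da \<and> u (D y) on the second, u being the map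
  on 1-forms induced by \<pi>. The first holonomy condition says that D (\<pi> y) = u (D y), so they
  cancel.\<close>

lemma form2_smult:
  assumes a: "a \<in> carrier A" and y: "y \<in> carrier (J1 (J1 F))"
    and form1: "jet1_jet1_form1 A W F y = \<zero>\<^bsub>Om 1 F\<^esub>"
  shows "jet1_jet1_form2 A W F (a \<odot>\<^bsub>J1 (J1 F)\<^esub> y) = a \<odot>\<^bsub>Om 2 F\<^esub> jet1_jet1_form2 A W F y"
proof -
  have deg: "(1::nat) + 1 = 2" by simp
  note J = JF.left_module_axioms
  interpret OJ: left_module A "Om 1 (J1 F)" by (rule forms_module[OF J])
  note py = linear_closed[OF jet1_proj_linear[OF J] y] and dy = additive_closed[OF jet1_deriv_additive[OF J] y]
  note dpy = additive_closed[OF jet1_deriv_additive[OF F] py]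
    and pdy = additive_closed[OF forms_map_additive[OF J F jet1_proj_linear[OF F]] dy]
  note sp = spencer_op_additive[OF J F linear_id deg]
  let ?l = "left_wedge 2 F (diff W a) (jet1_deriv F (jet1_proj (J1 F) y))"
  let ?s = "spencer_op 2 1 F (jet1_deriv (J1 F) y)"
  have l: "?l \<in> carrier (Om 2 F)" using left_wedge_closed[OF F deg diff_A[OF a] dpy] .
  have s: "?s \<in> carrier (Om 2 F)" using additive_closed[OF sp dy] .
  have eq: "forms_map A W 1 F (jet1_proj F) (jet1_deriv (J1 F) y) = jet1_deriv F (jet1_proj (J1 F) y)"
    using form1 dpy pdy unfolding form1_eq[OF y] O1.minus_eq
    by (metis O1.a_inv_closed O1.minus_equality O1.minus_minus)
  have "spencer_op 2 1 F (jet1_deriv (J1 F) (a \<odot>\<^bsub>J1 (J1 F)\<^esub> y))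
      = \<ominus>\<^bsub>Om 2 F\<^esub> ?l \<oplus>\<^bsub>Om 2 F\<^esub> (?l \<oplus>\<^bsub>Om 2 F\<^esub> a \<odot>\<^bsub>Om 2 F\<^esub> ?s)"
    using a dy
    by (simp add: jet1_deriv_smult[OF J a y] additive_add[OF sp] elem_closed[OF J diff_A[OF a] py]
        OJ.smult_closed spencer_op_exact[OF a py] spencer_op_smult[OF J F linear_id deg a dy] eq)
  also have "\<dots> = a \<odot>\<^bsub>Om 2 F\<^esub> ?s" using l O2.smult_closed[OF a s] by (rule O2.r_neg1)
  finally show ?thesis
    using additive_a_inv[OF O2.abelian_group_axioms O2.abelian_group_axioms forms_smult_additive[OF F a] s]
    by (simp add: form2_eq y JJF.smult_closed a)
qed

end

text \<open>\<open>form1_eq\<close> and \<open>form2_eq\<close> express both maps through \<pi>, D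
  and the Spencer operator, which are natural.\<close>

lemma forms12_natural:
  assumes F: "left_module A F" and F': "left_module A F'" and f: "f \<in> linear_maps A F F'"
    and y: "y \<in> carrier (J1 (J1 F))"
  defines "y' \<equiv> jet1_map K A W (J1 F') (jet1_map K A W F' f) y"
  shows "jet1_jet1_form1 A W F' y' = forms_map A W 1 F' f (jet1_jet1_form1 A W F y)"
    and "jet1_jet1_form2 A W F' y' = forms_map A W 2 F' f (jet1_jet1_form2 A W F y)"
proof -
  have deg: "(1::nat) + 1 = 2" by simp
  note J = jet1_module[OF F] and J' = jet1_module[OF F'] and g = jet1_map_linear[OF F F' f]
  note pf = jet1_proj_linear[OF F] and pf' = jet1_proj_linear[OF F']
  note py = linear_closed[OF jet1_proj_linear[OF J] y] and dy = additive_closed[OF jet1_deriv_additive[OF J] y]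
  note dpy = additive_closed[OF jet1_deriv_additive[OF F] py]
    and pdy = additive_closed[OF forms_map_additive[OF J F pf] dy]
  have y': "y' \<in> carrier (J1 (J1 F'))" unfolding y'_def by (rule jet1_map_closed[OF J J' g y])
  have 1: "jet1_proj (J1 F') y' = jet1_map K A W F' f (jet1_proj (J1 F) y)"
    unfolding y'_def by (rule jet1_map_proj[OF J J' g y])
  have 2: "jet1_deriv (J1 F') y' = forms_map A W 1 (J1 F') (jet1_map K A W F' f) (jet1_deriv (J1 F) y)"
    unfolding y'_def by (rule jet1_map_deriv[OF J J' g y])
  have "forms_map A W 1 F' (jet1_proj F') (forms_map A W 1 (J1 F') (jet1_map K A W F' f) (jet1_deriv (J1 F) y))
      = forms_map A W 1 F' (\<lambda>\<xi>. jet1_proj F' (jet1_map K A W F' f \<xi>)) (jet1_deriv (J1 F) y)"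
    by (rule forms_map_comp[OF J J' F' g pf' dy])
  also have "\<dots> = forms_map A W 1 F' (\<lambda>\<xi>. f (jet1_proj F \<xi>)) (jet1_deriv (J1 F) y)"
    by (rule forms_map_cong[OF J dy jet1_map_proj[OF F F' f]])
  also have "\<dots> = forms_map A W 1 F' f (forms_map A W 1 F (jet1_proj F) (jet1_deriv (J1 F) y))"
    by (rule forms_map_comp[OF J F F' pf f dy, symmetric])
  finally show "jet1_jet1_form1 A W F' y' = forms_map A W 1 F' f (jet1_jet1_form1 A W F y)"
    unfolding form1_eq[OF F' y'] form1_eq[OF F y] 1 2
    by (simp add: jet1_map_deriv[OF F F' f py]
        additive_minus[OF forms_abelian[OF F] forms_abelian[OF F'] forms_map_additive[OF F F' f] dpy pdy])
  show "jet1_jet1_form2 A W F' y' = forms_map A W 2 F' f (jet1_jet1_form2 A W F y)"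
    unfolding form2_eq[OF F' y'] form2_eq[OF F y] 2
    using spencer_op_natural[OF J F linear_id J' F' linear_id deg f g _ dy]
      additive_closed[OF spencer_op_additive[OF J F linear_id deg] dy]
    by (simp add: additive_a_inv[OF forms_abelian[OF F] forms_abelian[OF F'] forms_map_additive[OF F F' f]])
qed

text \<open>Inverses in H come from the action of -1, since (-1) x + x = 0.\<close>

lemma restrict_left_module:
  assumes M: "left_module A M" and sub: "H \<subseteq> carrier M" and zero: "\<zero>\<^bsub>M\<^esub> \<in> H"
    and add: "\<And>x y. \<lbrakk> x \<in> H; y \<in> H \<rbrakk> \<Longrightarrow> x \<oplus>\<^bsub>M\<^esub> y \<in> H"
    and smult: "\<And>a x. \<lbrakk> a \<in> carrier A; x \<in> H \<rbrakk> \<Longrightarrow> a \<odot>\<^bsub>M\<^esub> x \<in> H"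
  shows "left_module A (M\<lparr>carrier := H\<rparr>)"
proof -
  interpret M: left_module A M by fact
  have "(\<ominus>\<^bsub>A\<^esub> \<one>\<^bsub>A\<^esub>) \<odot>\<^bsub>M\<^esub> x \<oplus>\<^bsub>M\<^esub> x = \<zero>\<^bsub>M\<^esub>" if x: "x \<in> carrier M" for x
  proof -
    have "(\<lambda>a. a \<odot>\<^bsub>M\<^esub> x) \<in> additive_maps A M"
      using x by (simp add: additive_maps_def M.smult_closed M.smult_l_distr)
    from additive_zero[OF A.abelian_group_axioms M.abelian_group_axioms this]
    show ?thesis
      using M.smult_l_distr[OF A.a_inv_closed[OF A.one_closed] A.one_closed x] x
      by (simp add: A.l_neg M.smult_one)
  qed
  then have "\<exists>y\<in>H. y \<oplus>\<^bsub>M\<^esub> x = \<zero>\<^bsub>M\<^esub>" if "x \<in> H" for x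
    using sub smult[OF A.a_inv_closed[OF A.one_closed] that] that by blast
  then have "abelian_group (M\<lparr>carrier := H\<rparr>)"
    using sub zero add by (intro abelian_groupI) (auto simp: subset_iff M.a_assoc intro: M.a_comm)
  moreover have "ring A" by unfold_locales
  ultimately show ?thesis
    using sub smult
    by (intro left_module.intro left_module_axioms.intro)
      (auto simp: subset_iff M.smult_l_distr M.smult_r_distr M.smult_assoc M.smult_one)
qed

text \<open>One step of the recursion for \<open>jet\<close>, with J^(n+1) E and J^n E abstracted to
  P and F. The inductions on n then rest on statements about a pair of modules with an inclusion of
  P into \<open>J1 F\<close>.\<close>

definition holonomic :: "('w, 'e) lmod \<Rightarrow> ('w, 'e) lmod \<Rightarrow> ('w, 'e) lmod" where
  "holonomic P F = (J1 P)\<lparr>carrier := {x \<in> carrier (J1 P).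
     let y = jet1_map K A W (J1 F) (\<lambda>x. x) x in
       jet1_jet1_form1 A W F y = \<zero>\<^bsub>Om 1 F\<^esub> \<and> jet1_jet1_form2 A W F y = \<zero>\<^bsub>Om 2 F\<^esub>}\<rparr>"

lemma holonomic_carrier: "x \<in> carrier (holonomic P F) \<longleftrightarrow> x \<in> carrier (J1 P)
    \<and> jet1_jet1_form1 A W F (jet1_map K A W (J1 F) (\<lambda>x. x) x) = \<zero>\<^bsub>Om 1 F\<^esub>
    \<and> jet1_jet1_form2 A W F (jet1_map K A W (J1 F) (\<lambda>x. x) x) = \<zero>\<^bsub>Om 2 F\<^esub>"
  by (simp add: holonomic_def Let_def)

lemma holonomic_incl: "(\<lambda>x. x) \<in> linear_maps A (holonomic P F) (J1 P)"
  by (simp add: holonomic_def linear_maps_def)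

lemma holonomic_module:
  assumes P: "left_module A P" and F: "left_module A F" and incl: "(\<lambda>x. x) \<in> linear_maps A P (J1 F)"
  shows "left_module A (holonomic P F)"
proof -
  interpret JP: left_module A "J1 P" by (rule jet1_module[OF P])
  interpret J: left_module A "J1 (J1 F)" by (rule jet1_module[OF jet1_module[OF F]])
  interpret O1: left_module A "Om 1 F" by (rule forms_module[OF F])
  interpret O2: left_module A "Om 2 F" by (rule forms_module[OF F])
  note j = jet1_map_linear[OF P jet1_module[OF F] incl]
  note f1 = additive_comp[OF linear_additive[OF j] form1_additive[OF F]]
    and f2 = additive_comp[OF linear_additive[OF j] form2_additive[OF F]]
  have z: "a \<odot>\<^bsub>Om p F\<^esub> \<zero>\<^bsub>Om p F\<^esub> = \<zero>\<^bsub>Om p F\<^esub>" if "a \<in> carrier A" for a p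
    using additive_zero[OF forms_abelian[OF F] forms_abelian[OF F] forms_smult_additive[OF F that]] .
  have *: "carrier (holonomic P F) \<subseteq> carrier (J1 P)" by (auto simp: holonomic_carrier)
  have "holonomic P F = (J1 P)\<lparr>carrier := carrier (holonomic P F)\<rparr>" by (simp add: holonomic_def)
  moreover have "left_module A ((J1 P)\<lparr>carrier := carrier (holonomic P F)\<rparr>)"
  proof (rule restrict_left_module[OF JP.left_module_axioms *])
    show "\<zero>\<^bsub>J1 P\<^esub> \<in> carrier (holonomic P F)"
      using additive_zero[OF JP.abelian_group_axioms O1.abelian_group_axioms f1]
        additive_zero[OF JP.abelian_group_axioms O2.abelian_group_axioms f2]
      by (simp add: holonomic_carrier)
  next
    fix x y assume "x \<in> carrier (holonomic P F)" "y \<in> carrier (holonomic P F)"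
    then show "x \<oplus>\<^bsub>J1 P\<^esub> y \<in> carrier (holonomic P F)"
      using additive_add[OF f1, of x y] additive_add[OF f2, of x y] by (simp add: holonomic_carrier)
  next
    fix a x assume "a \<in> carrier A" "x \<in> carrier (holonomic P F)"
    then show "a \<odot>\<^bsub>J1 P\<^esub> x \<in> carrier (holonomic P F)"
      \<comment> \<open>Membership of x contains the first holonomy condition, which is the
        hypothesis under which \<open>form2_smult\<close> rewrites the second.\<close>
      by (simp add: holonomic_carrier linear_smult[OF j] linear_closed[OF j] form1_smult[OF F]
          form2_smult[OF F] z JP.smult_closed)
  qed
  ultimately show ?thesis by simp
qed

text \<open>As g restricts J1 of f, mapping by J1 of g and then including P' equals including P and
  then mapping by J1 of J1 of f. The holonomy conditions are therefore carried over by
  \<open>forms12_natural\<close>.\<close>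

lemma holonomic_map_linear:
  assumes P: "left_module A P" and F: "left_module A F" and incl: "(\<lambda>x. x) \<in> linear_maps A P (J1 F)"
    and P': "left_module A P'" and F': "left_module A F'" and incl': "(\<lambda>x. x) \<in> linear_maps A P' (J1 F')"
    and f: "f \<in> linear_maps A F F'" and g: "g \<in> linear_maps A P P'"
    and gf: "\<And>x. x \<in> carrier P \<Longrightarrow> g x = jet1_map K A W F' f x"
  shows "jet1_map K A W P' g \<in> linear_maps A (holonomic P F) (holonomic P' F')"
proof -
  note J = jet1_module[OF F] and J' = jet1_module[OF F']
  have "jet1_map K A W P' g x \<in> carrier (holonomic P' F')" if x: "x \<in> carrier (holonomic P F)" for x
  proof -
    have xJ: "x \<in> carrier (J1 P)" using x by (simp add: holonomic_carrier)
    let ?y = "jet1_map K A W (J1 F) (\<lambda>x. x) x"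
    have y: "?y \<in> carrier (J1 (J1 F))" by (rule jet1_map_closed[OF P J incl xJ])
    have "jet1_map K A W (J1 F') (\<lambda>x. x) (jet1_map K A W P' g x) = jet1_map K A W (J1 F') g x"
      by (rule jet1_map_comp[OF P P' J' g incl' xJ])
    also have "\<dots> = jet1_map K A W (J1 F') (jet1_map K A W F' f) x"
      by (rule jet1_map_cong[OF P xJ gf])
    also have "\<dots> = jet1_map K A W (J1 F') (jet1_map K A W F' f) ?y"
      by (rule jet1_map_comp[OF P J J' incl jet1_map_linear[OF F F' f] xJ, symmetric])
    finally show ?thesis
      using x jet1_map_closed[OF P P' g xJ] forms12_natural[OF F F' f y]
        additive_zero[OF forms_abelian[OF F] forms_abelian[OF F'] forms_map_additive[OF F F' f]]
      by (simp add: holonomic_carrier)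
  qed
  then show ?thesis
    using jet1_map_linear[OF P P' g] by (auto simp: linear_maps_def holonomic_def)
qed

section \<open>The functors of holonomic jets\<close>


abbreviation "J \<equiv> jet K A W"

lemma jet_Suc_Suc: "J (Suc (Suc n)) E = holonomic (J (Suc n) E) (J n E)"
  by (simp add: holonomic_def)

text \<open>The three claims go through the induction together, because
  \<open>holonomic_module\<close> consumes both modules and the inclusion to produce the next
  module.\<close>

lemma jet_module_incl:
  assumes E: "left_module A E"
  shows "left_module A (J n E) \<and> left_module A (J (Suc n) E)
    \<and> (\<lambda>x. x) \<in> linear_maps A (J (Suc n) E) (J1 (J n E))"
proof (induction n)
  case 0
  then show ?case using E jet1_module[OF E] linear_id by simp
next
  case (Suc n)
  then show ?case
    using holonomic_module[of "J (Suc n) E" "J n E"] holonomic_incl[of "J (Suc n) E" "J n E"]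
    by (simp only: jet_Suc_Suc)
qed

lemma jet_module: "left_module A E \<Longrightarrow> left_module A (J n E)"
  and jet_incl: "left_module A E \<Longrightarrow> (\<lambda>x. x) \<in> linear_maps A (J (Suc n) E) (J1 (J n E))"
  using jet_module_incl by blast+

lemma jet_in_jet1: "left_module A E \<Longrightarrow> x \<in> carrier (J (Suc n) E) \<Longrightarrow> x \<in> carrier (J1 (J n E))"
  using linear_closed[OF jet_incl] .

lemma jet_map_linear:
  assumes E: "left_module A E" and E': "left_module A E'" and f: "f \<in> linear_maps A E E'"
  shows "jet_map K A W n E' f \<in> linear_maps A (J n E) (J n E')"
proof -
  \<comment> \<open>Holonomy in order n + 2 refers to both preceding orders, so two consecutive
    orders are carried through the induction.\<close>
  have "jet_map K A W n E' f \<in> linear_maps A (J n E) (J n E')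
    \<and> jet_map K A W (Suc n) E' f \<in> linear_maps A (J (Suc n) E) (J (Suc n) E')"
  proof (induction n)
    case 0
    then show ?case using f jet1_map_linear[OF E E' f] by simp
  next
    case (Suc n)
    then have "jet1_map K A W (J (Suc n) E') (jet_map K A W (Suc n) E' f)
        \<in> linear_maps A (J (Suc (Suc n)) E) (J (Suc (Suc n)) E')"
      unfolding jet_Suc_Suc
      by (intro holonomic_map_linear[of _ _ _ _ "jet_map K A W n E' f"] jet_module jet_incl E E') auto
    with Suc show ?case by simp
  qed
  then show ?thesis ..
qed

lemma jet_map_cong:
  assumes E: "left_module A E" and fg: "\<And>x. x \<in> carrier E \<Longrightarrow> f x = g x" and x: "x \<in> carrier (J n E)"
  shows "jet_map K A W n E' f x = jet_map K A W n E' g x"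
  using x
proof (induction n arbitrary: x)
  case (Suc n)
  show ?case
    using jet1_map_cong[OF jet_module[OF E] jet_in_jet1[OF E Suc.prems] Suc.IH] by simp
qed (simp add: fg)

lemma jet_map_id:
  assumes E: "left_module A E" and x: "x \<in> carrier (J n E)"
  shows "jet_map K A W n E (\<lambda>x. x) x = x"
  using x
proof (induction n arbitrary: x)
  case (Suc n)
  note xJ = jet_in_jet1[OF E Suc.prems]
  show ?case
    using jet1_map_cong[OF jet_module[OF E] xJ Suc.IH] jet1_map_id[OF jet_module[OF E] xJ] by simp
qed simp

lemma jet_map_comp:
  assumes E: "left_module A E" "left_module A E'" "left_module A E''"
    and f: "f \<in> linear_maps A E E'" and g: "g \<in> linear_maps A E' E''" and x: "x \<in> carrier (J n E)"
  shows "jet_map K A W n E'' (g \<circ> f) x = jet_map K A W n E'' g (jet_map K A W n E' f x)"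
  using x
proof (induction n arbitrary: x)
  case (Suc n)
  note xJ = jet_in_jet1[OF E(1) Suc.prems]
  show ?case
    using jet1_map_cong[OF jet_module[OF E(1)] xJ Suc.IH]
      jet1_map_comp[OF jet_module[OF E(1)] jet_module[OF E(2)] jet_module[OF E(3)]
        jet_map_linear[OF E(1,2) f] jet_map_linear[OF E(2,3) g] xJ]
    by simp
qed simp

lemma jet_module_functor: "module_functor A (jet_functor K A W n :: ('w, ('w, 'e) univ) mod_functor)"
proof (rule module_functor.intro)
  fix E E' :: "('w, 'e) lmod" and f g x
  assume "left_module A E" "left_module A E'" "f \<in> linear_maps A E E'" "g \<in> linear_maps A E E'"
    "\<And>x. x \<in> carrier E \<Longrightarrow> f x = g x" "x \<in> carrier (obj (jet_functor K A W n) E)"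
  then show "mor (jet_functor K A W n) E E' f x = mor (jet_functor K A W n) E E' g x"
    using jet_map_cong[of E f g x n E'] by (simp add: jet_functor_def)
qed (simp_all add: jet_functor_def jet_module jet_map_linear jet_map_id jet_map_comp)

lemma forms_module_functor: "module_functor A (forms_functor A W p :: ('w, ('w, 'e) univ) mod_functor)"
proof (rule module_functor.intro)
  fix E E' E'' :: "('w, 'e) lmod" and f g x
  assume "left_module A E" "left_module A E'" "left_module A E''" "f \<in> linear_maps A E E'"
    "g \<in> linear_maps A E' E''" "x \<in> carrier (obj (forms_functor A W p) E)"
  then show "mor (forms_functor A W p) E E'' (g \<circ> f) x
      = mor (forms_functor A W p) E' E'' g (mor (forms_functor A W p) E E' f x)"
    using forms_map_comp[of E E' E'' f g x p] by (simp add: forms_functor_def comp_def)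
next
  fix E E' :: "('w, 'e) lmod" and f g x
  assume "left_module A E" "left_module A E'" "f \<in> linear_maps A E E'" "g \<in> linear_maps A E E'"
    "\<And>x. x \<in> carrier E \<Longrightarrow> f x = g x" "x \<in> carrier (obj (forms_functor A W p) E)"
  then show "mor (forms_functor A W p) E E' f x = mor (forms_functor A W p) E E' g x"
    using forms_map_cong[of E x p f g E'] by (simp add: forms_functor_def)
qed (simp_all add: forms_functor_def forms_module forms_map_linear forms_map_id)

lemma module_functor_comp:
  assumes "module_functor A F" "module_functor A G"
  shows "module_functor A (F \<circ>\<^sub>F G)"
proof -
  interpret F: module_functor A F by fact
  interpret G: module_functor A G by fact
  show ?thesis
  proof (rule module_functor.intro)
    fix E E' E'' f g x
    assume E: "left_module A E" "left_module A E'" "left_module A E''" and f: "f \<in> linear_maps A E E'"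
      and g: "g \<in> linear_maps A E' E''" and x: "x \<in> carrier (obj (F \<circ>\<^sub>F G) E)"
    have gf: "g \<circ> f \<in> linear_maps A E E''" using linear_comp[OF f g] by (simp add: comp_def)
    have "mor F (obj G E) (obj G E'') (mor G E E'' (g \<circ> f)) x
        = mor F (obj G E) (obj G E'') (mor G E' E'' g \<circ> mor G E E' f) x"
      using linear_comp[OF G.mor_linear[OF E(1,2) f] G.mor_linear[OF E(2,3) g]] x
      by (intro F.mor_cong G.obj_module G.mor_linear E gf)
        (simp_all add: functor_comp_def comp_def G.mor_comp[OF E f g, unfolded comp_def])
    also have "\<dots> = mor F (obj G E') (obj G E'') (mor G E' E'' g) (mor F (obj G E) (obj G E') (mor G E E' f) x)"
      using x by (intro F.mor_comp G.obj_module G.mor_linear E f g) (simp add: functor_comp_def)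
    finally show "mor (F \<circ>\<^sub>F G) E E'' (g \<circ> f) x = mor (F \<circ>\<^sub>F G) E' E'' g (mor (F \<circ>\<^sub>F G) E E' f x)"
      by (simp add: functor_comp_def)
  next
    fix E x assume E: "left_module A E" and x: "x \<in> carrier (obj (F \<circ>\<^sub>F G) E)"
    have "mor F (obj G E) (obj G E) (mor G E E (\<lambda>x. x)) x = mor F (obj G E) (obj G E) (\<lambda>x. x) x"
      using x by (intro F.mor_cong G.obj_module G.mor_linear G.mor_id E linear_id) (simp_all add: functor_comp_def)
    then show "mor (F \<circ>\<^sub>F G) E E (\<lambda>x. x) x = x"
      using F.mor_id[OF G.obj_module[OF E]] x by (simp add: functor_comp_def)
  next
    fix E E' f g x
    assume "left_module A E" "left_module A E'" "f \<in> linear_maps A E E'" "g \<in> linear_maps A E E'"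
      "\<And>x. x \<in> carrier E \<Longrightarrow> f x = g x" "x \<in> carrier (obj (F \<circ>\<^sub>F G) E)"
    then show "mor (F \<circ>\<^sub>F G) E E' f x = mor (F \<circ>\<^sub>F G) E E' g x"
      by (auto simp: functor_comp_def intro!: F.mor_cong G.obj_module G.mor_linear G.mor_cong)
  qed (simp_all add: functor_comp_def F.obj_module G.obj_module F.mor_linear G.mor_linear)
qed

section \<open>The lift of a Spencer operator\<close>

lemma left_wedge_additive_left:
  assumes F: "left_module A F" and deg: "p + q = s" and t: "t \<in> carrier (Om q F)"
  shows "(\<lambda>\<alpha>. left_wedge s F \<alpha> t) \<in> additive_maps (homogeneous p) (Om s F)"
  by (rule additive_mapsI) (simp_all add: left_wedge_closed[OF F deg] left_wedge_add[OF F deg] t)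

lemma wedge_map_natural:
  assumes Q: "left_module A Q" and F: "left_module A F" and u: "u \<in> linear_maps A Q (Om m F)"
    and Q': "left_module A Q'" and F': "left_module A F'" and u': "u' \<in> linear_maps A Q' (Om m F')"
    and deg: "1 + m = s" and f: "f \<in> linear_maps A F F'" and q: "q \<in> linear_maps A Q Q'"
    and uq: "\<And>x. x \<in> carrier Q \<Longrightarrow> u' (q x) = forms_map A W m F' f (u x)" and t: "t \<in> carrier (Om 1 Q)"
  shows "wedge_map s F' u' (forms_map A W 1 Q' q t) = forms_map A W s F' f (wedge_map s F u t)"
  by (rule forms_eqI[OF Q forms_abelian[OF F']
        additive_comp[OF forms_map_additive[OF Q Q' q] wedge_map_additive[OF Q' F' deg u']]
        additive_comp[OF wedge_map_additive[OF Q F deg u] forms_map_additive[OF F F' f]] _ t])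
    (simp add: forms_map_elem[OF Q Q' q] wedge_map_elem[OF Q' F' deg u'] wedge_map_elem[OF Q F deg u]
      linear_closed[OF q] linear_closed[OF u] uq left_wedge_natural[OF F F' f deg])

text \<open>The subtracted term cancels the failure of linearity of the Spencer operator and
  vanishes on prolongations, where D is zero.\<close>

definition spencer_lift :: "nat \<Rightarrow> nat \<Rightarrow> ('w, 'e) lmod \<Rightarrow> ('w, 'e) lmod \<Rightarrow> ('w, 'e) univ \<Rightarrow> ('w, 'e) univ" where
  "spencer_lift s m P F z = spencer_op s m F (jet1_proj (Om m P) z)
     \<ominus>\<^bsub>Om s F\<^esub> wedge_map s F (forms_map A W m F (jet1_proj F)) (jet1_deriv (Om m P) z)"

text \<open>This makes the choice inside \<open>jet1_iota\<close> meaningful. The spanning axiom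
  gives a generated subgroup, so inverses also occur; their sign is absorbed into the coefficient
  a.\<close>

lemma one_form_expansion:
  assumes "\<alpha> \<in> grade W 1"
  shows "\<exists>p. set p \<subseteq> carrier A \<times> carrier A \<and> \<alpha> = list_sum W (map (\<lambda>(a, b). a \<otimes>\<^bsub>W\<^esub> diff W b) p)"
proof -
  have W: "abelian_group W" by unfold_locales
  have cl: "set (map (\<lambda>(a, b). a \<otimes>\<^bsub>W\<^esub> diff W b) p) \<subseteq> carrier W" if "set p \<subseteq> carrier A \<times> carrier A" for p
    using that by (auto simp: A_in_W diff_closed[OF A_grade] intro!: m_closed)
  let ?S = "{foldl (\<lambda>w a. w \<otimes>\<^bsub>W\<^esub> diff W a) a0 as | a0 as.
         a0 \<in> carrier A \<and> set as \<subseteq> carrier A \<and> length as = 1}"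
  have S: "\<exists>a b. a \<in> carrier A \<and> b \<in> carrier A \<and> h = a \<otimes>\<^bsub>W\<^esub> diff W b" if "h \<in> ?S" for h
    using that by (auto simp: One_nat_def length_Suc_conv) blast
  have "\<alpha> \<in> generate (add_monoid W) ?S" using spanned[of 1] assms by blast
  then show ?thesis
  proof (induction rule: generate.induct)
    case one
    show ?case by (rule exI[of _ "[]"]) simp
  next
    case (incl h)
    then obtain a b where "a \<in> carrier A" "b \<in> carrier A" "h = a \<otimes>\<^bsub>W\<^esub> diff W b" using S by blast
    then show ?case
      using cl[of "[(a, b)]"] by (intro exI[of _ "[(a, b)]"]) simp
  next
    case (inv h)
    then obtain a b where ab: "a \<in> carrier A" "b \<in> carrier A" "h = a \<otimes>\<^bsub>W\<^esub> diff W b" using S by blast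
    have a': "\<ominus>\<^bsub>W\<^esub> a \<in> carrier A" using grade_uminus[of a 0] ab(1) by (simp add: A_carrier)
    have "inv\<^bsub>add_monoid W\<^esub> h = (\<ominus>\<^bsub>W\<^esub> a) \<otimes>\<^bsub>W\<^esub> diff W b"
      using ab A_in_W diff_closed[OF A_grade[OF ab(2)]] by (simp add: a_inv_def[symmetric] l_minus)
    then show ?case
      using cl[of "[(\<ominus>\<^bsub>W\<^esub> a, b)]"] a' ab(2) by (intro exI[of _ "[(\<ominus>\<^bsub>W\<^esub> a, b)]"]) simp
  next
    case (eng h1 h2)
    then obtain p1 p2 where "set p1 \<subseteq> carrier A \<times> carrier A" "set p2 \<subseteq> carrier A \<times> carrier A"
      "h1 = list_sum W (map (\<lambda>(a, b). a \<otimes>\<^bsub>W\<^esub> diff W b) p1)" "h2 = list_sum W (map (\<lambda>(a, b). a \<otimes>\<^bsub>W\<^esub> diff W b) p2)"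
      by blast
    then show ?case
      using list_sum_append[OF W cl cl] by (intro exI[of _ "p1 @ p2"]) simp
  qed
qed

context
  fixes P F :: "('w, 'e) lmod" and m s :: nat
  assumes P: "left_module A P" and F: "left_module A F" and incl: "(\<lambda>x. x) \<in> linear_maps A P (J1 F)"
    and deg: "m + 1 = s"
begin

abbreviation "Q \<equiv> Om m P"
abbreviation "u \<equiv> forms_map A W m F (jet1_proj F)"

interpretation Q: left_module A Q by (rule forms_module[OF P])
interpretation JQ: left_module A "J1 Q" by (rule jet1_module[OF Q.left_module_axioms])
interpretation OQ: left_module A "Om 1 Q" by (rule forms_module[OF Q.left_module_axioms])
interpretation Os: left_module A "Om s F" by (rule forms_module[OF F])

lemma deg_commute: "1 + m = s"
  using deg by simp

lemma u_linear: "u \<in> linear_maps A Q (Om m F)"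
  by (rule forms_map_linear[OF P F sub_proj_linear[OF F incl]])

lemmas wedge_u_additive = wedge_map_additive[OF Q.left_module_axioms F deg_commute u_linear]
lemmas wedge_u_elem = wedge_map_elem[OF Q.left_module_axioms F deg_commute u_linear]
lemmas wedge_u_smult = wedge_map_smult[OF Q.left_module_axioms F deg_commute u_linear]
lemmas sp_additive = spencer_op_additive[OF P F incl deg]
lemmas sp_smult = spencer_op_smult[OF P F incl deg]

text \<open>Multiplying z by a adds da \<and> u (\<pi> z) to the Spencer term, by
  \<open>spencer_op_smult\<close>, and the same element to the wedge term, by the rule for D (a z).
  The difference is linear.\<close>

lemma spencer_lift_linear: "spencer_lift s m P F \<in> linear_maps A (J1 Q) (Om s F)"
proof (rule linear_mapsI)
  note QM = Q.left_module_axioms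
  show "spencer_lift s m P F \<in> additive_maps (J1 Q) (Om s F)"
    unfolding spencer_lift_def[abs_def]
    by (intro additive_diff Os.abelian_group_axioms additive_comp[OF jet1_proj_additive[OF QM] sp_additive]
        additive_comp[OF jet1_deriv_additive[OF QM] wedge_u_additive])
  fix a z assume a: "a \<in> carrier A" and z: "z \<in> carrier (J1 Q)"
  note pz = linear_closed[OF jet1_proj_linear[OF QM] z] and dz = additive_closed[OF jet1_deriv_additive[OF QM] z]
  have l: "left_wedge s F (diff W a) (u (jet1_proj Q z)) \<in> carrier (Om s F)"
    by (rule left_wedge_closed[OF F deg_commute diff_A[OF a] linear_closed[OF u_linear pz]])
  have cancel: "x \<oplus>\<^bsub>Om s F\<^esub> (b \<oplus>\<^bsub>Om s F\<^esub> (\<ominus>\<^bsub>Om s F\<^esub> x \<oplus>\<^bsub>Om s F\<^esub> c)) = b \<oplus>\<^bsub>Om s F\<^esub> c"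
    if "x \<in> carrier (Om s F)" "b \<in> carrier (Om s F)" "c \<in> carrier (Om s F)" for x b c
    using that by (simp add: Os.a_lcomm[of x b] Os.r_neg2)
  show "spencer_lift s m P F (a \<odot>\<^bsub>J1 Q\<^esub> z) = a \<odot>\<^bsub>Om s F\<^esub> spencer_lift s m P F z"
    using a pz dz l additive_closed[OF sp_additive pz] additive_closed[OF wedge_u_additive dz]
    by (simp add: spencer_lift_def jet1_proj_smult[OF QM a z] jet1_deriv_smult[OF QM a z] sp_smult
        additive_add[OF wedge_u_additive] wedge_u_elem wedge_u_smult elem_closed[OF QM] diff_A OQ.smult_closed
        Os.minus_eq Os.minus_add Os.smult_r_distr Os.smult_closed Os.a_assoc cancel
        additive_a_inv[OF Os.abelian_group_axioms Os.abelian_group_axioms forms_smult_additive[OF F a]])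
qed

lemma spencer_lift_prolong:
  assumes x: "x \<in> carrier Q"
  shows "spencer_lift s m P F (jet1_prolong K A W Q x) = spencer_op s m F x"
  using additive_zero[OF OQ.abelian_group_axioms Os.abelian_group_axioms wedge_u_additive]
    additive_closed[OF sp_additive x]
  by (simp add: spencer_lift_def jet1_prolong[OF Q.left_module_axioms x] Os.minus_eq Os.add.inv_one)

text \<open>\<open>jet1_iota\<close> expands each 1-form in a chosen way, so the equation is proved
  summand by summand: the choice disappears once the contributions of an expansion of \<alpha> add
  up to \<alpha> \<and> u x.\<close>

lemma lift_on_symbol:
  assumes L: "L \<in> linear_maps A (J1 Q) (Om s F)"
    and Lj: "\<And>x. x \<in> carrier Q \<Longrightarrow> L (jet1_prolong K A W Q x) = spencer_op s m F x"
    and t: "t \<in> carrier (Om 1 Q)"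
  shows "L (jet1_iota K A W Q t) = wedge_map s F u t"
proof -
  note QM = Q.left_module_axioms
  have L_elem: "L (jelem Q a x) = a \<odot>\<^bsub>Om s F\<^esub> spencer_op s m F x" if "a \<in> carrier A" "x \<in> carrier Q" for a x
    using that by (simp add: jet1_elem_prolong[OF QM] jet1_prolong(1)[OF QM] linear_smult[OF L] Lj)
  \<comment> \<open>\<open>q\<close> names the expansion chosen in \<open>jet1_iota\<close>, so that
    the definition unfolds to sums over \<open>q\<close>.\<close>
  define q where "q \<alpha> = (SOME p. set p \<subseteq> carrier A \<times> carrier A
      \<and> \<alpha> = list_sum W (map (\<lambda>(a, b). a \<otimes>\<^bsub>W\<^esub> diff W b) p))" for \<alpha>
  have q: "set (q \<alpha>) \<subseteq> carrier A \<times> carrier A"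
    "\<alpha> = list_sum W (map (\<lambda>(a, b). a \<otimes>\<^bsub>W\<^esub> diff W b) (q \<alpha>))" if "\<alpha> \<in> grade W 1" for \<alpha>
    using someI_ex[OF one_form_expansion[OF that]] unfolding q_def by blast+
  define summand where "summand x ab = (case ab of (a, b) \<Rightarrow>
      jelem Q a (b \<odot>\<^bsub>Q\<^esub> x) \<ominus>\<^bsub>J1 Q\<^esub> jelem Q (a \<otimes>\<^bsub>A\<^esub> b) x)" for x and ab :: "'w \<times> 'w"
  have summand_closed: "summand x ab \<in> carrier (J1 Q)"
    if "x \<in> carrier Q" "ab \<in> carrier A \<times> carrier A" for x ab
    using that by (auto simp: summand_def jet1_elem_closed[OF QM] Q.smult_closed)
  have L_summand: "L (summand x (a, b)) = left_wedge s F (a \<otimes>\<^bsub>W\<^esub> diff W b) (u x)"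
    if x: "x \<in> carrier Q" and ab: "a \<in> carrier A" "b \<in> carrier A" for x a b
  proof -
    have ux: "u x \<in> carrier (Om m F)" by (rule linear_closed[OF u_linear x])
    have l: "left_wedge s F (diff W b) (u x) \<in> carrier (Om s F)"
      by (rule left_wedge_closed[OF F deg_commute diff_A[OF ab(2)] ux])
    have sx: "spencer_op s m F x \<in> carrier (Om s F)" by (rule additive_closed[OF sp_additive x])
    have "L (summand x (a, b)) = a \<odot>\<^bsub>Om s F\<^esub> spencer_op s m F (b \<odot>\<^bsub>Q\<^esub> x)
        \<ominus>\<^bsub>Om s F\<^esub> a \<odot>\<^bsub>Om s F\<^esub> (b \<odot>\<^bsub>Om s F\<^esub> spencer_op s m F x)"
      using x ab sx
      by (simp add: summand_def additive_minus[OF JQ.abelian_group_axioms Os.abelian_group_axioms linear_additive[OF L]]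
          jet1_elem_closed[OF QM] Q.smult_closed L_elem Os.smult_assoc)
    also have "\<dots> = a \<odot>\<^bsub>Om s F\<^esub> left_wedge s F (diff W b) (u x)"
      using ab l sx
      by (simp add: sp_smult[OF ab(2) x] Os.smult_r_distr Os.smult_closed Os.minus_eq Os.a_assoc Os.r_neg)
    also have "\<dots> = left_wedge s F (a \<otimes>\<^bsub>W\<^esub> diff W b) (u x)"
      by (rule left_wedge_mult_left[OF F deg_commute diff_A[OF ab(2)] ab(1) ux, symmetric])
    finally show ?thesis .
  qed
  \<comment> \<open>The right-hand side mentions only \<alpha>: additivity of the wedge product in
    its left factor reassembles the chosen expansion.\<close>
  have inner: "L (list_sum (J1 Q) (map (summand x) (q \<alpha>))) = left_wedge s F \<alpha> (u x)"
    if \<alpha>: "\<alpha> \<in> grade W 1" and x: "x \<in> carrier Q" for \<alpha> x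
  proof -
    have g: "(case z of (a, b) \<Rightarrow> a \<otimes>\<^bsub>W\<^esub> diff W b) \<in> carrier (homogeneous 1)" if "z \<in> set (q \<alpha>)" for z
      using that q(1)[OF \<alpha>] grade_mult[OF A_grade diff_A, of _ _ 1] by auto
    have "L (list_sum (J1 Q) (map (summand x) (q \<alpha>))) = list_sum (Om s F) (map (\<lambda>z. L (summand x z)) (q \<alpha>))"
      using q(1)[OF \<alpha>]
      by (intro additive_list_sum_map[OF JQ.abelian_group_axioms Os.abelian_group_axioms linear_additive[OF L]]
          summand_closed[OF x]) blast
    also have "map (\<lambda>z. L (summand x z)) (q \<alpha>)
        = map (\<lambda>z. left_wedge s F (case z of (a, b) \<Rightarrow> a \<otimes>\<^bsub>W\<^esub> diff W b) (u x)) (q \<alpha>)"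
      using q(1)[OF \<alpha>] L_summand[OF x] by (intro map_cong) auto
    also have "list_sum (Om s F) \<dots>
        = left_wedge s F (list_sum (homogeneous 1) (map (\<lambda>(a, b). a \<otimes>\<^bsub>W\<^esub> diff W b) (q \<alpha>))) (u x)"
      by (rule additive_list_sum_map[OF abelian_homogeneous Os.abelian_group_axioms
            left_wedge_additive_left[OF F deg_commute linear_closed[OF u_linear x]] g, symmetric])
    \<comment> \<open>\<open>list_sum\<close> uses only addition and zero, which the homogeneous
      part shares with \<open>W\<close>.\<close>
    also have "list_sum (homogeneous 1) (map (\<lambda>(a, b). a \<otimes>\<^bsub>W\<^esub> diff W b) (q \<alpha>)) = \<alpha>"
      using q(2)[OF \<alpha>] by (simp add: list_sum_def)
    finally show ?thesis .
  qed
  have c: "(case z of (\<alpha>, x) \<Rightarrow> list_sum (J1 Q) (map (summand x) (q \<alpha>))) \<in> carrier (J1 Q)"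
    if "z \<in> set (terms t)" for z
  proof -
    obtain \<alpha> x where z: "z = (\<alpha>, x)" by fastforce
    then have \<alpha>: "\<alpha> \<in> grade W 1" and x: "x \<in> carrier Q" using that forms_terms[OF QM t] by auto
    have "set (map (summand x) (q \<alpha>)) \<subseteq> carrier (J1 Q)"
      using q(1)[OF \<alpha>] summand_closed[OF x] unfolding set_map by blast
    from list_sum_closed[OF JQ.abelian_group_axioms this] show ?thesis by (simp add: z)
  qed
  have "jet1_iota K A W Q t = list_sum (J1 Q) (map (\<lambda>(\<alpha>, x). list_sum (J1 Q) (map (summand x) (q \<alpha>))) (terms t))"
    unfolding jet1_iota_def tensor_ext_def q_def summand_def[abs_def] by simp
  then have "L (jet1_iota K A W Q t)
      = list_sum (Om s F) (map (\<lambda>z. L (case z of (\<alpha>, x) \<Rightarrow> list_sum (J1 Q) (map (summand x) (q \<alpha>)))) (terms t))"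
    using additive_list_sum_map[OF JQ.abelian_group_axioms Os.abelian_group_axioms linear_additive[OF L] c] by simp
  also have "\<dots> = wedge_map s F u t"
    unfolding wedge_map_def tensor_ext_def using forms_terms[OF QM t] inner
    by (intro arg_cong[where f = "list_sum (Om s F)"] map_cong) auto
  finally show ?thesis .
qed

text \<open>A scalar acts through c 1 in \<open>A\<close>, and d(c 1) = c d 1 = 0 removes the
  non-linear term of \<open>spencer_op_smult\<close>.\<close>

lemma spencer_op_base_smult:
  assumes c: "c \<in> carrier K" and x: "x \<in> carrier Q"
  shows "spencer_op s m F (base_smult A Q c x) = base_smult A (Om s F) c (spencer_op s m F x)"
proof -
  have c1: "c \<odot>\<^bsub>A\<^esub> \<one>\<^bsub>A\<^esub> \<in> carrier A" using c by simp
  have "diff W (c \<odot>\<^bsub>A\<^esub> \<one>\<^bsub>A\<^esub>) = c \<odot>\<^bsub>W\<^esub> diff W \<one>\<^bsub>W\<^esub>"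
    using c A_smult[OF c A.one_closed] by (simp add: A_one diff_smult)
  then have "diff W (c \<odot>\<^bsub>A\<^esub> \<one>\<^bsub>A\<^esub>) = \<zero>\<^bsub>W\<^esub>" using c by (simp add: diff_one)
  moreover have "left_wedge s F \<zero>\<^bsub>W\<^esub> (u x) = \<zero>\<^bsub>Om s F\<^esub>"
    using additive_zero[OF abelian_homogeneous Os.abelian_group_axioms
        left_wedge_additive_left[OF F deg_commute linear_closed[OF u_linear x]]] by simp
  ultimately show ?thesis
    using sp_smult[OF c1 x] Os.smult_closed[OF c1 additive_closed[OF sp_additive x]]
    by (simp add: base_smult_def)
qed

text \<open>The left side is the literal formula of \<open>wedge_proj\<close>. Both sides sum over
  the same \<open>terms t\<close>, and each inner extension is the additive map \<alpha> \<and> u -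
  evaluated at x.\<close>

lemma wedge_u_eq:
  assumes t: "t \<in> carrier (Om 1 Q)"
  shows "tensor_ext (Om s F) (\<lambda>\<alpha>. tensor_ext (Om s F) (\<lambda>\<omega> \<xi>. felem s F (\<alpha> \<otimes>\<^bsub>W\<^esub> \<omega>) (jet1_proj F \<xi>))) t
    = wedge_map s F u t"
  unfolding wedge_map_def
proof (rule tensor_ext_cong)
  fix \<alpha> x assume "(\<alpha>, x) \<in> set (terms t)"
  then have \<alpha>: "\<alpha> \<in> grade W 1" and x: "x \<in> carrier Q"
    using forms_terms[OF Q.left_module_axioms t] by auto
  note pl = sub_proj_linear[OF F incl]
  show "tensor_ext (Om s F) (\<lambda>\<omega> \<xi>. felem s F (\<alpha> \<otimes>\<^bsub>W\<^esub> \<omega>) (jet1_proj F \<xi>)) x = left_wedge s F \<alpha> (u x)"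
    by (rule forms_ext_additive_map[OF P Os.abelian_group_axioms
          additive_comp[OF linear_additive[OF u_linear] left_wedge_additive[OF F deg_commute \<alpha>]] _ x])
      (simp add: forms_map_elem[OF P F pl] left_wedge_elem[OF F deg_commute \<alpha>] linear_closed[OF pl])
qed

text \<open>The left side is the literal formula of \<open>spencer\<close>; over the same
  \<open>terms t\<close> its inner extensions are the Leibniz forms given by
  \<open>spencer_term_eq\<close>.\<close>

lemma spencer_eq:
  assumes t: "t \<in> carrier Q"
  shows "tensor_ext (Om s F) (\<lambda>\<omega>. tensor_ext (Om s F) (\<lambda>y \<eta>. felem s F (diff W (\<omega> \<otimes>\<^bsub>W\<^esub> y)) \<eta>)) t
    = spencer_op s m F t"
  unfolding spencer_op_def
  using forms_terms[OF P t] linear_closed[OF incl] spencer_term_eq[OF F deg]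
  by (intro tensor_ext_cong) auto

end

text \<open>The two terms are natural separately. For the wedge term, the maps induced on m-forms by
  \<pi> must commute with those induced by f and g, which is naturality of \<pi>.\<close>

lemma spencer_lift_natural:
  assumes P: "left_module A P" and F: "left_module A F" and incl: "(\<lambda>x. x) \<in> linear_maps A P (J1 F)"
    and P': "left_module A P'" and F': "left_module A F'" and incl': "(\<lambda>x. x) \<in> linear_maps A P' (J1 F')"
    and deg: "m + 1 = s"
    and f: "f \<in> linear_maps A F F'" and g: "g \<in> linear_maps A P P'"
    and gf: "\<And>x. x \<in> carrier P \<Longrightarrow> g x = jet1_map K A W F' f x" and z: "z \<in> carrier (J1 (Om m P))"
  shows "spencer_lift s m P' F' (jet1_map K A W (Om m P') (forms_map A W m P' g) z)
    = forms_map A W s F' f (spencer_lift s m P F z)"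
proof -
  have deg': "1 + m = s" using deg by simp
  note Q = forms_module[OF P, of m] and Q' = forms_module[OF P', of m]
  note q = forms_map_linear[OF P P' g, of m]
  note u = u_linear[OF P F incl deg] and u' = u_linear[OF P' F' incl' deg]
  note pl = sub_proj_linear[OF F incl] and pl' = sub_proj_linear[OF F' incl']
  note pz = linear_closed[OF jet1_proj_linear[OF Q] z] and dz = additive_closed[OF jet1_deriv_additive[OF Q] z]
  let ?u = "forms_map A W m F (jet1_proj F)" and ?u' = "forms_map A W m F' (jet1_proj F')"
  have w: "wedge_map s F' ?u' (forms_map A W 1 (Om m P') (forms_map A W m P' g) (jet1_deriv (Om m P) z))
      = forms_map A W s F' f (wedge_map s F ?u (jet1_deriv (Om m P) z))"
  proof (rule wedge_map_natural[OF Q F u Q' F' u' deg' f q _ dz])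
    fix x assume x: "x \<in> carrier (Om m P)"
    have "jet1_proj F' (g \<xi>) = f (jet1_proj F \<xi>)" if "\<xi> \<in> carrier P" for \<xi>
      using jet1_map_proj[OF F F' f linear_closed[OF incl that]] gf[OF that] by simp
    then have "forms_map A W m F' (\<lambda>\<xi>. jet1_proj F' (g \<xi>)) x = forms_map A W m F' (\<lambda>\<xi>. f (jet1_proj F \<xi>)) x"
      by (rule forms_map_cong[OF P x])
    then show "?u' (forms_map A W m P' g x) = forms_map A W m F' f (?u x)"
      using forms_map_comp[OF P P' F' g pl' x] forms_map_comp[OF P F F' pl f x] by simp
  qed
  show ?thesis
    unfolding spencer_lift_def jet1_map_proj[OF Q Q' q z] jet1_map_deriv[OF Q Q' q z] w
    using spencer_op_natural[OF P F incl P' F' incl' deg f g gf pz]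
      additive_minus[OF forms_abelian[OF F] forms_abelian[OF F'] forms_map_additive[OF F F' f]
        additive_closed[OF spencer_op_additive[OF P F incl deg] pz]
        additive_closed[OF wedge_map_additive[OF Q F deg' u] dz]]
    by simp
qed

end

theorem proposition3p5:
  fixes K :: "'k ring" and A :: "('k, 'w) module" and W :: "('k, 'w) dga" and n m :: nat
  assumes "cring K" and "assoc_algebra K A" and "exterior_algebra K A W" and "n \<ge> 1"
  defines "F \<equiv> forms_functor A W m \<circ>\<^sub>F jet_functor K A W n"
    and "G \<equiv> forms_functor A W (m + 1) \<circ>\<^sub>F jet_functor K A W (n - 1)"
  shows "natural_diff_op K A W 1 F G
           (spencer K A W n m :: ('w, 'e) lmod \<Rightarrow> ('w, 'e) univ \<Rightarrow> ('w, 'e) univ)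
       \<and> (\<forall>L. natural_lift K A W 1 F G (spencer K A W n m) L \<longrightarrow>
            (\<forall>E :: ('w, 'e) lmod. left_module A E \<longrightarrow>
              (\<forall>t \<in> carrier (forms A W 1 (forms A W m (jet K A W n E))).
                 L E (jet1_iota K A W (forms A W m (jet K A W n E)) t) = wedge_proj K A W n m E t)))"
proof -
  interpret calculus K A W using assms(2,3) by (simp add: calculus_def)
  \<comment> \<open>With n = Suc k the difference n - 1 becomes k, and \<open>jet_incl\<close>
    provides the inclusion of \<open>J (Suc k) E\<close> into \<open>J1 (J k E)\<close>.\<close>
  obtain k where n: "n = Suc k" using assms(4) by (cases n) auto
  have deg: "m + 1 = m + 1" by simp
  have obj_F: "obj F E = Om m (J (Suc k) E)" and obj_G: "obj G E = Om (m + 1) (J k E)" for E :: "('w, 'e) lmod"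
    by (simp_all add: F_def G_def n functor_comp_def forms_functor_def jet_functor_def)
  have mor_F: "mor F E E' f = forms_map A W m (J (Suc k) E') (jet_map K A W (Suc k) E' f)"
    and mor_G: "mor G E E' f = forms_map A W (m + 1) (J k E') (jet_map K A W k E' f)" for E E' :: "('w, 'e) lmod" and f
    unfolding F_def G_def by (simp_all add: n functor_comp_def forms_functor_def jet_functor_def)
  have J1F: "obj (jet_functor K A W 1 \<circ>\<^sub>F F) E = J1 (obj F E)"
    and J1F_mor: "mor (jet_functor K A W 1 \<circ>\<^sub>F F) E E' f = jet1_map K A W (obj F E') (mor F E E' f)"
    for E E' :: "('w, 'e) lmod" and f
    by (simp_all add: functor_comp_def jet_functor_def One_nat_def)
  have J1_eq: "J 1 Q = J1 Q" and prolong1: "jet_prolong K A W 1 Q x = jet1_prolong K A W Q x" for Q :: "('w, 'e) lmod" and x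
    by (simp_all add: One_nat_def)
  note jm = jet_module and ji = jet_incl[where n = k]
  \<comment> \<open>The constants of the statement agree with \<open>spencer_op\<close> and
    \<open>wedge_map\<close> on the relevant carriers.\<close>
  have sp: "spencer K A W n m E t = spencer_op (m + 1) m (J k E) t"
    if "left_module A E" "t \<in> carrier (Om m (J (Suc k) E))" for E :: "('w, 'e) lmod" and t
    using spencer_eq[OF jm jm ji deg that(2)] that(1) by (simp add: spencer_def n Let_def)
  have wp: "wedge_proj K A W n m E t = wedge_map (m + 1) (J k E) (forms_map A W m (J k E) (jet1_proj (J k E))) t"
    if "left_module A E" "t \<in> carrier (Om 1 (Om m (J (Suc k) E)))" for E :: "('w, 'e) lmod" and t
    using wedge_u_eq[OF jm jm ji deg that(2)] that(1) by (simp add: wedge_proj_def jet_proj_def n Let_def)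
  note sp_add = spencer_op_additive[OF jm jm ji deg]
  \<comment> \<open>This is the hypothesis \<open>gf\<close> of the naturality lemmas, with f and g
    the maps induced on jets of orders k and k + 1.\<close>
  have jm_Suc: "jet_map K A W (Suc k) E' f x = jet1_map K A W (J k E') (jet_map K A W k E' f) x"
    for E' :: "('w, 'e) lmod" and f x by simp
  define L0 where "L0 E = spencer_lift (m + 1) m (J (Suc k) E) (J k E)" for E :: "('w, 'e) lmod"
  have L0_lin: "L0 E \<in> linear_maps A (J1 (obj F E)) (obj G E)" if "left_module A E" for E
    unfolding L0_def obj_F obj_G by (rule spencer_lift_linear[OF jm jm ji deg]) (rule that)+
  have lift: "natural_lift K A W 1 F G (spencer K A W n m) L0"
    unfolding natural_lift_def natural_def J1F J1F_mor J1_eq prolong1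
  proof (intro conjI allI impI ballI)
    fix E :: "('w, 'e) lmod" assume E: "left_module A E"
    show "L0 E \<in> linear_maps A (J1 (obj F E)) (obj G E)" by (rule L0_lin[OF E])
    then show "L0 E \<in> carrier (J1 (obj F E)) \<rightarrow> carrier (obj G E)" by (auto simp: linear_closed)
    show "L0 E (jet1_prolong K A W (obj F E) x) = spencer K A W n m E x" if "x \<in> carrier (obj F E)" for x
      using spencer_lift_prolong[OF jm jm ji deg] sp[OF E] E that by (simp add: L0_def obj_F)
  next
    fix E E' :: "('w, 'e) lmod" and f z
    assume E: "left_module A E" and E': "left_module A E'" and f: "f \<in> linear_maps A E E'"
      and z: "z \<in> carrier (J1 (obj F E))"
    show "L0 E' (jet1_map K A W (obj F E') (mor F E E' f) z) = mor G E E' f (L0 E z)"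
      using z unfolding L0_def obj_F mor_F mor_G
      by (intro spencer_lift_natural jm ji E E' deg jet_map_linear f jm_Suc)
  qed
  have mf: "module_functor A F" "module_functor A G"
    unfolding F_def G_def by (intro module_functor_comp forms_module_functor jet_module_functor)+
  have nat: "natural A F G (spencer K A W n m)"
    unfolding natural_def
  proof (intro conjI allI impI)
    fix E :: "('w, 'e) lmod" assume E: "left_module A E"
    show "spencer K A W n m E \<in> carrier (obj F E) \<rightarrow> carrier (obj G E)"
      using additive_closed[OF sp_add] E by (auto simp: sp obj_F obj_G)
  next
    fix E E' :: "('w, 'e) lmod" and f x
    assume E: "left_module A E" and E': "left_module A E'" and f: "f \<in> linear_maps A E E'"
      and x: "x \<in> carrier (obj F E)"
    have "mor F E E' f x \<in> carrier (obj F E')"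
      using linear_closed[OF module_functor.mor_linear[OF mf(1) E E' f] x] .
    then show "spencer K A W n m E' (mor F E E' f x) = mor G E E' f (spencer K A W n m E x)"
      using x sp[OF E] sp[OF E']
        spencer_op_natural[OF jm[OF E] jm[OF E] ji[OF E] jm[OF E'] jm[OF E'] ji[OF E'] deg
          jet_map_linear[OF E E' f] jet_map_linear[OF E E' f] jm_Suc]
      unfolding obj_F mor_F mor_G by simp
  qed
  have base: "spencer K A W n m E \<in> base_linear_maps K A (obj F E) (obj G E)" if E: "left_module A E" for E
  proof -
    interpret Q: left_module A "Om m (J (Suc k) E)" by (rule forms_module[OF jm[OF E]])
    note add = sp_add[OF E E E]
    have "base_smult A (Om m (J (Suc k) E)) c x \<in> carrier (Om m (J (Suc k) E))"
      if "c \<in> carrier K" "x \<in> carrier (Om m (J (Suc k) E))" for c x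
      using that by (simp add: base_smult_def Q.smult_closed)
    then show ?thesis
      using additive_closed[OF add] additive_add[OF add] spencer_op_base_smult[OF jm jm ji deg] E
      by (auto simp: base_linear_maps_def obj_F obj_G sp[OF E])
  qed
  \<comment> \<open>The argument is pointwise in E: linearity of \<open>L E\<close> and its values
    on prolongations feed \<open>lift_on_symbol\<close>.\<close>
  have "L E (jet1_iota K A W (Om m (J n E)) t) = wedge_proj K A W n m E t"
    if L: "natural_lift K A W 1 F G (spencer K A W n m) L" and E: "left_module A E"
      and t: "t \<in> carrier (Om 1 (Om m (J n E)))" for L and E :: "('w, 'e) lmod" and t
  proof -
    have lin: "L E \<in> linear_maps A (J1 (Om m (J (Suc k) E))) (Om (m + 1) (J k E))"
      using L E by (simp add: natural_lift_def J1_eq obj_F obj_G)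
    have "L E (jet1_prolong K A W (Om m (J (Suc k) E)) x) = spencer_op (m + 1) m (J k E) x"
      if "x \<in> carrier (Om m (J (Suc k) E))" for x
      using L E that sp[OF E that] by (simp add: natural_lift_def prolong1 obj_F)
    from lift_on_symbol[OF jm jm ji deg lin this] show ?thesis
      using E t wp[OF E] by (simp add: n)
  qed
  with mf nat base lift show ?thesis unfolding natural_diff_op_def by blast
qed

end
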